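(* Let $H$ be a Hopf algebra over a field $\Bbbk$ such that $H^0$ separates points, and let $(\bar\lambda,A,\bar\rho)$ be a partial $H$-bicomodule algebra, regarded also as a partial $H^0$-bimodule algebra via the induced actions $f\rightharpoonup a=(I_A\otimes f)\bar\rho(a)$, $a\leftharpoonup f=(f\otimes I_A)\bar\lambda(a)$. Let $\theta:A\to H\otimes A\otimes H$, $\theta=(I_H\otimes\bar\rho)\bar\lambda=(\bar\lambda\otimes I_H)\bar\rho$, let $\varphi:A\to\mathrm{Hom}(H^0\otimes H^0,A)$, $\varphi(a)(f\otimes g)=f\rightharpoonup a\leftharpoonup g$, and let $\Psi:H\otimes A\otimes H\to\mathrm{Hom}(H^0\otimes H^0,A)$ be the linear map $\Psi(h\otimes a\otimes k)(f\otimes g)=g(h)\,a\,f(k)$. Then the restriction $$\Psi|_{H^0\triangleright\theta(A)\triangleleft H^0}:\ H^0\triangleright\theta(A)\triangleleft H^0\ \to\ H^0\triangleright\varphi(A)\triangleleft H^0$$ is an isomorphism of $H^0$-bimodule algebras.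
   Context: Algebras are over $\Bbbk$, associative, not necessarily unital; $\otimes=\otimes_\Bbbk$; $\Delta(h)=h_1\otimes h_2$, $\varepsilon$ are the comultiplication and counit of $H$. $H^0$ is the finite dual Hopf algebra, with product $(f\ast g)(h)=f(h_1)g(h_2)$ and comultiplication $f\mapsto f_1\otimes f_2$ determined by $f(hk)=f_1(h)f_2(k)$. $H^0$ separates points if for every nonzero $h\in H$ there is $f\in H^0$ with $f(h)\neq0$. A partial $H$-bicomodule algebra $(\bar\lambda,A,\bar\rho)$ is a unital algebra $A$ with multiplicative linear maps $\bar\rho:A\to A\otimes H$, $\bar\lambda:A\to H\otimes A$ such that for all $a$: $(I_A\otimes\varepsilon)\bar\rho(a)=a$; $(\bar\rho\otimes I_H)\bar\rho(a)=(\bar\rho(1_A)\otimes 1_H)[(I_A\otimes\Delta)\bar\rho(a)]$; $(\varepsilon\otimes I_A)\bar\lambda(a)=a$; $(I_H\otimes\bar\lambda)\bar\lambda(a)=[(\Delta\otimes I_A)\bar\lambda(a)](1_H\otimes\bar\lambda(1_A))$; and $(I_H\otimes\bar\rho)\bar\lambda=(\bar\lambda\otimes I_H)\bar\rho$. For a Hopf algebra $K$, a $K$-bimodule algebra is an algebra $B$ that is a $K$-bimodule via $\triangleright,\triangleleft$ with $h\triangleright(bc)=(h_1\triangleright b)(h_2\triangleright c)$ and $(bc)\triangleleft h=(b\triangleleft h_1)(c\triangleleft h_2)$. $H\otimes A\otimes H$ (tensor product algebra) is an $H^0$-bimodule algebra via $f\triangleright(h\otimes a\otimes k)=h\otimes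 a\otimes k_1f(k_2)$ and $(h\otimes a\otimes k)\triangleleft f=f(h_1)h_2\otimes a\otimes k$. $\mathrm{Hom}(H^0\otimes H^0,A)$ is an $H^0$-bimodule algebra under the convolution product $(\alpha\ast\beta)(f\otimes g)=\alpha(f_1\otimes g_1)\beta(f_2\otimes g_2)$ and the actions $(f\triangleright\alpha)(g\otimes k)=\alpha(g\ast f\otimes k)$, $(\alpha\triangleleft f)(g\otimes k)=\alpha(g\otimes f\ast k)$. For a subset $X$, $H^0\triangleright X\triangleleft H^0$ denotes the linear span of the elements $f\triangleright x\triangleleft g$, $f,g\in H^0$, $x\in X$. ($H^0\triangleright\theta(A)\triangleleft H^0$ and $H^0\triangleright\varphi(A)\triangleleft H^0$ are the standard globalizations of $A$ as a partial $H$-bicomodule algebra and as a partial $H^0$-bimodule algebra, respectively.) *)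

theory Defs
  imports "Jordan_Normal_Form.Missing_VectorSpace" "HOL-Algebra.QuotRing"
begin

section \<open>Algebras over a field\<close>

text \<open>The field \<open>one\<close> of the record carries no meaning for a \<open>nonunital_algebra\<close>, and the algebra
  may be the zero algebra.\<close>

locale nonunital_algebra = vectorspace K B for K and B (structure) +
  assumes mult_closed: "\<lbrakk>x \<in> carrier B; y \<in> carrier B\<rbrakk> \<Longrightarrow> x \<otimes> y \<in> carrier B"
    and mult_assoc: "\<lbrakk>x \<in> carrier B; y \<in> carrier B; z \<in> carrier B\<rbrakk>
      \<Longrightarrow> (x \<otimes> y) \<otimes> z = x \<otimes> (y \<otimes> z)"
    and mult_add_left: "\<lbrakk>x \<in> carrier B; y \<in> carrier B; z \<in> carrier B\<rbrakk>
      \<Longrightarrow> (x \<oplus> y) \<otimes> z = (x \<otimes> z) \<oplus> (y \<otimes> z)"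
    and mult_add_right: "\<lbrakk>x \<in> carrier B; y \<in> carrier B; z \<in> carrier B\<rbrakk>
      \<Longrightarrow> x \<otimes> (y \<oplus> z) = (x \<otimes> y) \<oplus> (x \<otimes> z)"
    and mult_smult_left: "\<lbrakk>c \<in> carrier K; x \<in> carrier B; y \<in> carrier B\<rbrakk>
      \<Longrightarrow> (c \<odot> x) \<otimes> y = c \<odot> (x \<otimes> y)"
    and mult_smult_right: "\<lbrakk>c \<in> carrier K; x \<in> carrier B; y \<in> carrier B\<rbrakk>
      \<Longrightarrow> x \<otimes> (c \<odot> y) = c \<odot> (x \<otimes> y)"

locale unital_algebra = nonunital_algebra K B for K and B (structure) +
  assumes unit_closed: "\<one> \<in> carrier B"
    and unit_left: "x \<in> carrier B \<Longrightarrow> \<one> \<otimes> x = x"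
    and unit_right: "x \<in> carrier B \<Longrightarrow> x \<otimes> \<one> = x"

definition scalars :: "('k, 'm) ring_scheme \<Rightarrow> ('k, 'k) module" where
  "scalars K = \<lparr>carrier = carrier K, mult = mult K, one = \<one>\<^bsub>K\<^esub>, zero = \<zero>\<^bsub>K\<^esub>, add = add K,
    smult = mult K\<rparr>"


section \<open>Quotient spaces and tensor products\<close>

definition quot_space ::
    "('k, 'v, 'n) module_scheme \<Rightarrow> 'v set \<Rightarrow> ('k, 'v set) module" where
  "quot_space V U = ring.extend (V Quot U)
     (module.fields (\<lambda>c X. \<Union>x\<in>X. U +>\<^bsub>V\<^esub> (c \<odot>\<^bsub>V\<^esub> x)))"

definition free_space :: "('k, 'm) ring_scheme \<Rightarrow> 's set \<Rightarrow> ('k, 's \<Rightarrow> 'k) module" where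
  "free_space K S = (ring.func_space K S)
     \<lparr>carrier := {f \<in> S \<rightarrow>\<^sub>E carrier K. finite {s \<in> S. f s \<noteq> \<zero>\<^bsub>K\<^esub>}}\<rparr>"

definition free_gen :: "('k, 'm) ring_scheme \<Rightarrow> 's set \<Rightarrow> 's \<Rightarrow> 's \<Rightarrow> 'k" where
  "free_gen K S s = (\<lambda>t\<in>S. if t = s then \<one>\<^bsub>K\<^esub> else \<zero>\<^bsub>K\<^esub>)"

definition tensor_relators ::
    "('k, 'm) ring_scheme \<Rightarrow> ('k, 'v, 'n) module_scheme \<Rightarrow> ('k, 'w, 'p) module_scheme
      \<Rightarrow> ('v \<times> 'w \<Rightarrow> 'k) set" where
  "tensor_relators K V W =
    (let S = carrier V \<times> carrier W; F = free_space K S; d = (\<lambda>v w. free_gen K S (v, w)) in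
      {d (v \<oplus>\<^bsub>V\<^esub> v') w \<ominus>\<^bsub>F\<^esub> (d v w \<oplus>\<^bsub>F\<^esub> d v' w) | v v' w.
          v \<in> carrier V \<and> v' \<in> carrier V \<and> w \<in> carrier W} \<union>
      {d v (w \<oplus>\<^bsub>W\<^esub> w') \<ominus>\<^bsub>F\<^esub> (d v w \<oplus>\<^bsub>F\<^esub> d v w') | v w w'.
          v \<in> carrier V \<and> w \<in> carrier W \<and> w' \<in> carrier W} \<union>
      {d (c \<odot>\<^bsub>V\<^esub> v) w \<ominus>\<^bsub>F\<^esub> (c \<odot>\<^bsub>F\<^esub> d v w) | c v w.
          c \<in> carrier K \<and> v \<in> carrier V \<and> w \<in> carrier W} \<union>
      {d v (c \<odot>\<^bsub>W\<^esub> w) \<ominus>\<^bsub>F\<^esub> (c \<odot>\<^bsub>F\<^esub> d v w) | c v w.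
          c \<in> carrier K \<and> v \<in> carrier V \<and> w \<in> carrier W})"

definition tensor_null ::
    "('k, 'm) ring_scheme \<Rightarrow> ('k, 'v, 'n) module_scheme \<Rightarrow> ('k, 'w, 'p) module_scheme
      \<Rightarrow> ('v \<times> 'w \<Rightarrow> 'k) set" where
  "tensor_null K V W =
    module.span K (free_space K (carrier V \<times> carrier W)) (tensor_relators K V W)"

definition tensor_space ::
    "('k, 'm) ring_scheme \<Rightarrow> ('k, 'v, 'n) module_scheme \<Rightarrow> ('k, 'w, 'p) module_scheme
      \<Rightarrow> ('k, ('v \<times> 'w \<Rightarrow> 'k) set) module" where
  "tensor_space K V W =
    quot_space (free_space K (carrier V \<times> carrier W)) (tensor_null K V W)"

definition pure_tensor ::
    "('k, 'm) ring_scheme \<Rightarrow> ('k, 'v, 'n) module_scheme \<Rightarrow> ('k, 'w, 'p) module_scheme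
      \<Rightarrow> 'v \<Rightarrow> 'w \<Rightarrow> ('v \<times> 'w \<Rightarrow> 'k) set" where
  "pure_tensor K V W v w = tensor_null K V W
     +>\<^bsub>free_space K (carrier V \<times> carrier W)\<^esub> free_gen K (carrier V \<times> carrier W) (v, w)"

text \<open>The linear map on \<open>V \<otimes> W\<close> with \<open>v \<otimes> w \<mapsto> b v w\<close>, for \<open>b\<close> bilinear with values in \<open>Z\<close>.
  It is determined by \<open>b\<close> on \<open>carrier (tensor_space K V W)\<close> only.\<close>

definition tensor_lift ::
    "('k, 'm) ring_scheme \<Rightarrow> ('k, 'v, 'n) module_scheme \<Rightarrow> ('k, 'w, 'p) module_scheme
      \<Rightarrow> ('k, 'z, 'q) module_scheme \<Rightarrow> ('v \<Rightarrow> 'w \<Rightarrow> 'z) \<Rightarrow> ('v \<times> 'w \<Rightarrow> 'k) set \<Rightarrow> 'z" where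
  "tensor_lift K V W Z b = (SOME \<phi>. \<phi> \<in> module_hom K (tensor_space K V W) Z \<and>
     (\<forall>v\<in>carrier V. \<forall>w\<in>carrier W. \<phi> (pure_tensor K V W v w) = b v w))"

text \<open>\<open>(v \<otimes> w) (v' \<otimes> w') = v v' \<otimes> w w'\<close>. The multiplicative part is only meaningful if \<open>V\<close> and
  \<open>W\<close> are algebras.\<close>

definition tensor ::
    "('k, 'm) ring_scheme \<Rightarrow> ('k, 'v, 'n) module_scheme \<Rightarrow> ('k, 'w, 'p) module_scheme
      \<Rightarrow> ('k, ('v \<times> 'w \<Rightarrow> 'k) set) module" where
  "tensor K V W = (let T = tensor_space K V W in
     T\<lparr>mult := (\<lambda>X Y. tensor_lift K V W T (\<lambda>v w.
         tensor_lift K V W T (\<lambda>v' w'. pure_tensor K V W (v \<otimes>\<^bsub>V\<^esub> v') (w \<otimes>\<^bsub>W\<^esub> w')) Y) X),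
       one := pure_tensor K V W \<one>\<^bsub>V\<^esub> \<one>\<^bsub>W\<^esub>\<rparr>)"

text \<open>\<open>f \<otimes> g : V \<otimes> W \<rightarrow> V' \<otimes> W'\<close> for linear \<open>f\<close>, \<open>g\<close>\<close>

definition tensor_map ::
    "('k, 'm) ring_scheme \<Rightarrow> ('k, 'v, 'n) module_scheme \<Rightarrow> ('k, 'w, 'p) module_scheme
      \<Rightarrow> ('k, 'v2, 'q) module_scheme \<Rightarrow> ('k, 'w2, 'r) module_scheme
      \<Rightarrow> ('v \<Rightarrow> 'v2) \<Rightarrow> ('w \<Rightarrow> 'w2) \<Rightarrow> ('v \<times> 'w \<Rightarrow> 'k) set \<Rightarrow> ('v2 \<times> 'w2 \<Rightarrow> 'k) set" where
  "tensor_map K V W V' W' f g =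
    tensor_lift K V W (tensor K V' W') (\<lambda>v w. pure_tensor K V' W' (f v) (g w))"

text \<open>The canonical identification \<open>(U \<otimes> V) \<otimes> W \<rightarrow> U \<otimes> (V \<otimes> W)\<close>. Triple tensor products are
  always nested to the right.\<close>

definition tensor_assoc ::
    "('k, 'm) ring_scheme \<Rightarrow> ('k, 'u, 'l) module_scheme \<Rightarrow> ('k, 'v, 'n) module_scheme
      \<Rightarrow> ('k, 'w, 'p) module_scheme \<Rightarrow> (('u \<times> 'v \<Rightarrow> 'k) set \<times> 'w \<Rightarrow> 'k) set
      \<Rightarrow> ('u \<times> ('v \<times> 'w \<Rightarrow> 'k) set \<Rightarrow> 'k) set" where
  "tensor_assoc K U V W =
    (let T = tensor K U (tensor K V W) in
      tensor_lift K (tensor K U V) W T (\<lambda>x w.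
        tensor_lift K U V T (\<lambda>u v.
          pure_tensor K U (tensor K V W) u (pure_tensor K V W v w)) x))"


section \<open>Hopf algebras\<close>

record ('k, 'h) hopf = "('k, 'h) module" +
  comult :: "'h \<Rightarrow> ('h \<times> 'h \<Rightarrow> 'k) set"
  counit :: "'h \<Rightarrow> 'k"
  antipode :: "'h \<Rightarrow> 'h"

locale hopf_algebra = unital_algebra K H
  for K :: "('k, 'm) ring_scheme" and H :: "('k, 'h, 'n) hopf_scheme" (structure) +
  assumes comult_linear: "comult H \<in> module_hom K H (tensor K H H)"
    and comult_ring_hom: "comult H \<in> ring_hom H (tensor K H H)"
    and counit_linear: "counit H \<in> module_hom K H (scalars K)"
    and counit_ring_hom: "counit H \<in> ring_hom H K"
    and coassoc: "h \<in> carrier H \<Longrightarrow>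
      tensor_assoc K H H H (tensor_map K H H (tensor K H H) H (comult H) id (comult H h))
        = tensor_map K H H H (tensor K H H) id (comult H) (comult H h)"
    and counit_left: "h \<in> carrier H \<Longrightarrow>
      tensor_lift K H H H (\<lambda>x y. counit H x \<odot> y) (comult H h) = h"
    and counit_right: "h \<in> carrier H \<Longrightarrow>
      tensor_lift K H H H (\<lambda>x y. counit H y \<odot> x) (comult H h) = h"
    and antipode_linear: "antipode H \<in> module_hom K H H"
    and antipode_left: "h \<in> carrier H \<Longrightarrow>
      tensor_lift K H H H (\<lambda>x y. antipode H x \<otimes> y) (comult H h) = counit H h \<odot> \<one>"
    and antipode_right: "h \<in> carrier H \<Longrightarrow>
      tensor_lift K H H H (\<lambda>x y. x \<otimes> antipode H y) (comult H h) = counit H h \<odot> \<one>"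


subsection \<open>The finite dual\<close>

text \<open>Linear functionals on \<open>H\<close> that vanish on a two-sided ideal of finite codimension\<close>

definition finite_dual_carrier ::
    "('k, 'm) ring_scheme \<Rightarrow> ('k, 'h, 'n) hopf_scheme \<Rightarrow> ('h \<Rightarrow> 'k) set" where
  "finite_dual_carrier K H =
    {f \<in> extensional (carrier H). f \<in> module_hom K H (scalars K) \<and>
      (\<exists>I. ideal I H \<and> vectorspace.fin_dim K (quot_space H I) \<and> (\<forall>x\<in>I. f x = \<zero>\<^bsub>K\<^esub>))}"

definition finite_dual_algebra ::
    "('k, 'm) ring_scheme \<Rightarrow> ('k, 'h, 'n) hopf_scheme \<Rightarrow> ('k, 'h \<Rightarrow> 'k) module" where
  "finite_dual_algebra K H = (ring.func_space K (carrier H))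
     \<lparr>carrier := finite_dual_carrier K H,
      mult := (\<lambda>f g. \<lambda>h\<in>carrier H.
        tensor_lift K H H (scalars K) (\<lambda>x y. f x \<otimes>\<^bsub>K\<^esub> g y) (comult H h)),
      one := (\<lambda>h\<in>carrier H. counit H h)\<rparr>"

text \<open>The comultiplication is determined by \<open>f(h k) = f\<^sub>1(h) f\<^sub>2(k)\<close>, since
  \<open>D \<otimes> D\<close> embeds into the functions on pairs.\<close>

definition finite_dual ::
    "('k, 'm) ring_scheme \<Rightarrow> ('k, 'h, 'n) hopf_scheme \<Rightarrow> ('k, 'h \<Rightarrow> 'k) hopf" where
  "finite_dual K H = (let D = finite_dual_algebra K H in
     module.extend D (hopf.fields
       (\<lambda>f. THE T. T \<in> carrier (tensor K D D) \<and>
          (\<forall>h\<in>carrier H. \<forall>k\<in>carrier H.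
             f (h \<otimes>\<^bsub>H\<^esub> k)
               = tensor_lift K D D (scalars K) (\<lambda>f1 f2. f1 h \<otimes>\<^bsub>K\<^esub> f2 k) T))
       (\<lambda>f. f \<one>\<^bsub>H\<^esub>)
       (\<lambda>f. \<lambda>h\<in>carrier H. f (antipode H h))))"

definition separates_points ::
    "('k, 'm) ring_scheme \<Rightarrow> ('k, 'h, 'n) hopf_scheme \<Rightarrow> bool" where
  "separates_points K H \<longleftrightarrow>
    (\<forall>h\<in>carrier H. h \<noteq> \<zero>\<^bsub>H\<^esub> \<longrightarrow> (\<exists>f\<in>carrier (finite_dual K H). f h \<noteq> \<zero>\<^bsub>K\<^esub>))"


section \<open>Bimodule algebras\<close>

locale bimodule_algebra = L: hopf_algebra K L + B: nonunital_algebra K B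
  for K :: "('k, 'm) ring_scheme" and L :: "('k, 'l, 'n) hopf_scheme"
    and B :: "('k, 'b, 'p) module_scheme" +
  fixes lact :: "'l \<Rightarrow> 'b \<Rightarrow> 'b" and ract :: "'b \<Rightarrow> 'l \<Rightarrow> 'b"
  assumes lact_linear: "h \<in> carrier L \<Longrightarrow> lact h \<in> module_hom K B B"
    and lact_linear': "b \<in> carrier B \<Longrightarrow> (\<lambda>h. lact h b) \<in> module_hom K L B"
    and lact_one: "b \<in> carrier B \<Longrightarrow> lact \<one>\<^bsub>L\<^esub> b = b"
    and lact_mult: "\<lbrakk>h \<in> carrier L; k \<in> carrier L; b \<in> carrier B\<rbrakk>
      \<Longrightarrow> lact (h \<otimes>\<^bsub>L\<^esub> k) b = lact h (lact k b)"
    and ract_linear: "h \<in> carrier L \<Longrightarrow> (\<lambda>b. ract b h) \<in> module_hom K B B"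
    and ract_linear': "b \<in> carrier B \<Longrightarrow> ract b \<in> module_hom K L B"
    and ract_one: "b \<in> carrier B \<Longrightarrow> ract b \<one>\<^bsub>L\<^esub> = b"
    and ract_mult: "\<lbrakk>h \<in> carrier L; k \<in> carrier L; b \<in> carrier B\<rbrakk>
      \<Longrightarrow> ract b (h \<otimes>\<^bsub>L\<^esub> k) = ract (ract b h) k"
    and lact_ract: "\<lbrakk>h \<in> carrier L; k \<in> carrier L; b \<in> carrier B\<rbrakk>
      \<Longrightarrow> ract (lact h b) k = lact h (ract b k)"
    and lact_algebra: "\<lbrakk>h \<in> carrier L; b \<in> carrier B; c \<in> carrier B\<rbrakk>
      \<Longrightarrow> lact h (b \<otimes>\<^bsub>B\<^esub> c)
        = tensor_lift K L L B (\<lambda>h1 h2. lact h1 b \<otimes>\<^bsub>B\<^esub> lact h2 c) (comult L h)"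
    and ract_algebra: "\<lbrakk>h \<in> carrier L; b \<in> carrier B; c \<in> carrier B\<rbrakk>
      \<Longrightarrow> ract (b \<otimes>\<^bsub>B\<^esub> c) h
        = tensor_lift K L L B (\<lambda>h1 h2. ract b h1 \<otimes>\<^bsub>B\<^esub> ract c h2) (comult L h)"

definition bimodule_algebra_iso ::
    "('k, 'm) ring_scheme \<Rightarrow> ('k, 'l, 'n) hopf_scheme
      \<Rightarrow> ('k, 'b, 'p) module_scheme \<Rightarrow> ('l \<Rightarrow> 'b \<Rightarrow> 'b) \<Rightarrow> ('b \<Rightarrow> 'l \<Rightarrow> 'b)
      \<Rightarrow> ('k, 'c, 'q) module_scheme \<Rightarrow> ('l \<Rightarrow> 'c \<Rightarrow> 'c) \<Rightarrow> ('c \<Rightarrow> 'l \<Rightarrow> 'c)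
      \<Rightarrow> ('b \<Rightarrow> 'c) \<Rightarrow> bool" where
  "bimodule_algebra_iso K L B lact ract C lact' ract' F \<longleftrightarrow>
    bimodule_algebra K L B lact ract \<and>
    bimodule_algebra K L C lact' ract' \<and>
    F \<in> module_hom K B C \<and>
    (\<forall>x\<in>carrier B. \<forall>y\<in>carrier B. F (x \<otimes>\<^bsub>B\<^esub> y) = F x \<otimes>\<^bsub>C\<^esub> F y) \<and>
    (\<forall>h\<in>carrier L. \<forall>x\<in>carrier B. F (lact h x) = lact' h (F x)) \<and>
    (\<forall>h\<in>carrier L. \<forall>x\<in>carrier B. F (ract x h) = ract' (F x) h) \<and>
    bij_betw F (carrier B) (carrier C)"

text \<open>\<open>L \<triangleright> X \<triangleleft> L\<close> as a linear span, with the operations of \<open>B\<close>\<close>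

definition bimodule_span ::
    "('k, 'm) ring_scheme \<Rightarrow> ('k, 'l, 'n) hopf_scheme \<Rightarrow> ('k, 'b, 'p) module_scheme
      \<Rightarrow> ('l \<Rightarrow> 'b \<Rightarrow> 'b) \<Rightarrow> ('b \<Rightarrow> 'l \<Rightarrow> 'b) \<Rightarrow> 'b set \<Rightarrow> ('k, 'b, 'p) module_scheme" where
  "bimodule_span K L B lact ract X = B\<lparr>carrier := module.span K B
     {ract (lact f x) g | f x g. f \<in> carrier L \<and> g \<in> carrier L \<and> x \<in> X}\<rparr>"


subsection \<open>The bimodule algebra \<open>H \<otimes> A \<otimes> H\<close> over the finite dual\<close>

definition HAH ::
    "('k, 'm) ring_scheme \<Rightarrow> ('k, 'h, 'n) hopf_scheme \<Rightarrow> ('k, 'a, 'p) module_scheme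
      \<Rightarrow> ('k, ('h \<times> ('a \<times> 'h \<Rightarrow> 'k) set \<Rightarrow> 'k) set) module" where
  "HAH K H A = tensor K H (tensor K A H)"

text \<open>\<open>f \<triangleright> (h \<otimes> a \<otimes> k) = h \<otimes> a \<otimes> k\<^sub>1 f(k\<^sub>2)\<close> and \<open>(h \<otimes> a \<otimes> k) \<triangleleft> f = f(h\<^sub>1) h\<^sub>2 \<otimes> a \<otimes> k\<close>\<close>

definition HAH_lact ::
    "('k, 'm) ring_scheme \<Rightarrow> ('k, 'h, 'n) hopf_scheme \<Rightarrow> ('k, 'a, 'p) module_scheme
      \<Rightarrow> ('h \<Rightarrow> 'k) \<Rightarrow> ('h \<times> ('a \<times> 'h \<Rightarrow> 'k) set \<Rightarrow> 'k) set
      \<Rightarrow> ('h \<times> ('a \<times> 'h \<Rightarrow> 'k) set \<Rightarrow> 'k) set" where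
  "HAH_lact K H A f = tensor_map K H (tensor K A H) H (tensor K A H) id
     (tensor_map K A H A H id
        (\<lambda>k. tensor_lift K H H H (\<lambda>k1 k2. f k2 \<odot>\<^bsub>H\<^esub> k1) (comult H k)))"

definition HAH_ract ::
    "('k, 'm) ring_scheme \<Rightarrow> ('k, 'h, 'n) hopf_scheme \<Rightarrow> ('k, 'a, 'p) module_scheme
      \<Rightarrow> ('h \<times> ('a \<times> 'h \<Rightarrow> 'k) set \<Rightarrow> 'k) set \<Rightarrow> ('h \<Rightarrow> 'k)
      \<Rightarrow> ('h \<times> ('a \<times> 'h \<Rightarrow> 'k) set \<Rightarrow> 'k) set" where
  "HAH_ract K H A X f = tensor_map K H (tensor K A H) H (tensor K A H)
     (\<lambda>h. tensor_lift K H H H (\<lambda>h1 h2. f h1 \<odot>\<^bsub>H\<^esub> h2) (comult H h)) id X"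


subsection \<open>The bimodule algebra \<open>Hom (L \<otimes> L, A)\<close> over a Hopf algebra \<open>L\<close>\<close>

definition hom_algebra ::
    "('k, 'm) ring_scheme \<Rightarrow> ('k, 'l, 'n) hopf_scheme \<Rightarrow> ('k, 'a, 'p) module_scheme
      \<Rightarrow> ('k, ('l \<times> 'l \<Rightarrow> 'k) set \<Rightarrow> 'a) module" where
  "hom_algebra K L A = (let T = carrier (tensor K L L) in
    \<lparr>carrier = {\<alpha> \<in> extensional T. \<alpha> \<in> module_hom K (tensor K L L) A},
     mult = (\<lambda>\<alpha> \<beta>. \<lambda>X\<in>T. tensor_lift K L L A (\<lambda>f g.
       tensor_lift K L L A (\<lambda>f1 f2.
         tensor_lift K L L A (\<lambda>g1 g2.
           \<alpha> (pure_tensor K L L f1 g1) \<otimes>\<^bsub>A\<^esub> \<beta> (pure_tensor K L L f2 g2))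
         (comult L g)) (comult L f)) X),
     one = (\<lambda>X\<in>T. tensor_lift K L L A
       (\<lambda>f g. (counit L f \<otimes>\<^bsub>K\<^esub> counit L g) \<odot>\<^bsub>A\<^esub> \<one>\<^bsub>A\<^esub>) X),
     zero = (\<lambda>X\<in>T. \<zero>\<^bsub>A\<^esub>),
     add = (\<lambda>\<alpha> \<beta>. \<lambda>X\<in>T. \<alpha> X \<oplus>\<^bsub>A\<^esub> \<beta> X),
     smult = (\<lambda>c \<alpha>. \<lambda>X\<in>T. c \<odot>\<^bsub>A\<^esub> \<alpha> X)\<rparr>)"

text \<open>\<open>(f \<triangleright> \<alpha>)(g \<otimes> k) = \<alpha>(g f \<otimes> k)\<close> and \<open>(\<alpha> \<triangleleft> f)(g \<otimes> k) = \<alpha>(g \<otimes> f k)\<close>\<close>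

definition hom_lact ::
    "('k, 'm) ring_scheme \<Rightarrow> ('k, 'l, 'n) hopf_scheme \<Rightarrow> ('k, 'a, 'p) module_scheme
      \<Rightarrow> 'l \<Rightarrow> (('l \<times> 'l \<Rightarrow> 'k) set \<Rightarrow> 'a) \<Rightarrow> ('l \<times> 'l \<Rightarrow> 'k) set \<Rightarrow> 'a" where
  "hom_lact K L A f \<alpha> = (\<lambda>X\<in>carrier (tensor K L L).
     tensor_lift K L L A (\<lambda>g k. \<alpha> (pure_tensor K L L (g \<otimes>\<^bsub>L\<^esub> f) k)) X)"

definition hom_ract ::
    "('k, 'm) ring_scheme \<Rightarrow> ('k, 'l, 'n) hopf_scheme \<Rightarrow> ('k, 'a, 'p) module_scheme
      \<Rightarrow> (('l \<times> 'l \<Rightarrow> 'k) set \<Rightarrow> 'a) \<Rightarrow> 'l \<Rightarrow> ('l \<times> 'l \<Rightarrow> 'k) set \<Rightarrow> 'a" where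
  "hom_ract K L A \<alpha> f = (\<lambda>X\<in>carrier (tensor K L L).
     tensor_lift K L L A (\<lambda>g k. \<alpha> (pure_tensor K L L g (f \<otimes>\<^bsub>L\<^esub> k))) X)"


section \<open>Partial bicomodule algebras\<close>

locale partial_bicomodule_algebra = H: hopf_algebra K H + A: unital_algebra K A
  for K :: "('k, 'm) ring_scheme" and H :: "('k, 'h, 'n) hopf_scheme"
    and A :: "('k, 'a, 'p) module_scheme" +
  fixes lam :: "'a \<Rightarrow> ('h \<times> 'a \<Rightarrow> 'k) set" and rho :: "'a \<Rightarrow> ('a \<times> 'h \<Rightarrow> 'k) set"
  assumes rho_linear: "rho \<in> module_hom K A (tensor K A H)"
    and rho_mult: "\<lbrakk>a \<in> carrier A; b \<in> carrier A\<rbrakk>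
      \<Longrightarrow> rho (a \<otimes>\<^bsub>A\<^esub> b) = rho a \<otimes>\<^bsub>tensor K A H\<^esub> rho b"
    and lam_linear: "lam \<in> module_hom K A (tensor K H A)"
    and lam_mult: "\<lbrakk>a \<in> carrier A; b \<in> carrier A\<rbrakk>
      \<Longrightarrow> lam (a \<otimes>\<^bsub>A\<^esub> b) = lam a \<otimes>\<^bsub>tensor K H A\<^esub> lam b"
    and rho_counit: "a \<in> carrier A
      \<Longrightarrow> tensor_lift K A H A (\<lambda>b h. counit H h \<odot>\<^bsub>A\<^esub> b) (rho a) = a"
    and rho_coassoc: "a \<in> carrier A \<Longrightarrow>
      tensor_assoc K A H H (tensor_map K A H (tensor K A H) H rho id (rho a))
        = tensor_assoc K A H H (pure_tensor K (tensor K A H) H (rho \<one>\<^bsub>A\<^esub>) \<one>\<^bsub>H\<^esub>)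
            \<otimes>\<^bsub>tensor K A (tensor K H H)\<^esub>
          tensor_map K A H A (tensor K H H) id (comult H) (rho a)"
    and lam_counit: "a \<in> carrier A
      \<Longrightarrow> tensor_lift K H A A (\<lambda>h b. counit H h \<odot>\<^bsub>A\<^esub> b) (lam a) = a"
    and lam_coassoc: "a \<in> carrier A \<Longrightarrow>
      tensor_map K H A H (tensor K H A) id lam (lam a)
        = tensor_assoc K H H A (tensor_map K H A (tensor K H H) A (comult H) id (lam a))
            \<otimes>\<^bsub>tensor K H (tensor K H A)\<^esub>
          pure_tensor K H (tensor K H A) \<one>\<^bsub>H\<^esub> (lam \<one>\<^bsub>A\<^esub>)"
    and lam_rho: "a \<in> carrier A \<Longrightarrow>
      tensor_map K H A H (tensor K A H) id rho (lam a)
        = tensor_assoc K H A H (tensor_map K A H (tensor K H A) H lam id (rho a))"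

text \<open>The induced actions \<open>f \<rightharpoonup> a\<close> and \<open>a \<leftharpoonup> f\<close> of the finite dual\<close>

definition dual_lact ::
    "('k, 'm) ring_scheme \<Rightarrow> ('k, 'h, 'n) hopf_scheme \<Rightarrow> ('k, 'a, 'p) module_scheme
      \<Rightarrow> ('a \<Rightarrow> ('a \<times> 'h \<Rightarrow> 'k) set) \<Rightarrow> ('h \<Rightarrow> 'k) \<Rightarrow> 'a \<Rightarrow> 'a" where
  "dual_lact K H A rho f a = tensor_lift K A H A (\<lambda>b h. f h \<odot>\<^bsub>A\<^esub> b) (rho a)"

definition dual_ract ::
    "('k, 'm) ring_scheme \<Rightarrow> ('k, 'h, 'n) hopf_scheme \<Rightarrow> ('k, 'a, 'p) module_scheme
      \<Rightarrow> ('a \<Rightarrow> ('h \<times> 'a \<Rightarrow> 'k) set) \<Rightarrow> 'a \<Rightarrow> ('h \<Rightarrow> 'k) \<Rightarrow> 'a" where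
  "dual_ract K H A lam a f = tensor_lift K H A A (\<lambda>h b. f h \<odot>\<^bsub>A\<^esub> b) (lam a)"

definition theta ::
    "('k, 'm) ring_scheme \<Rightarrow> ('k, 'h, 'n) hopf_scheme \<Rightarrow> ('k, 'a, 'p) module_scheme
      \<Rightarrow> ('a \<Rightarrow> ('h \<times> 'a \<Rightarrow> 'k) set) \<Rightarrow> ('a \<Rightarrow> ('a \<times> 'h \<Rightarrow> 'k) set)
      \<Rightarrow> 'a \<Rightarrow> ('h \<times> ('a \<times> 'h \<Rightarrow> 'k) set \<Rightarrow> 'k) set" where
  "theta K H A lam rho a = tensor_map K H A H (tensor K A H) id rho (lam a)"

definition phi ::
    "('k, 'm) ring_scheme \<Rightarrow> ('k, 'h, 'n) hopf_scheme \<Rightarrow> ('k, 'a, 'p) module_scheme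
      \<Rightarrow> ('a \<Rightarrow> ('h \<times> 'a \<Rightarrow> 'k) set) \<Rightarrow> ('a \<Rightarrow> ('a \<times> 'h \<Rightarrow> 'k) set)
      \<Rightarrow> 'a \<Rightarrow> (('h \<Rightarrow> 'k) \<times> ('h \<Rightarrow> 'k) \<Rightarrow> 'k) set \<Rightarrow> 'a" where
  "phi K H A lam rho a = (let D = finite_dual K H in
     (\<lambda>X\<in>carrier (tensor K D D).
       tensor_lift K D D A (\<lambda>f g. dual_ract K H A lam (dual_lact K H A rho f a) g) X))"

text \<open>\<open>\<Psi>(h \<otimes> a \<otimes> k)(f \<otimes> g) = g(h) a f(k)\<close>\<close>

definition Psi ::
    "('k, 'm) ring_scheme \<Rightarrow> ('k, 'h, 'n) hopf_scheme \<Rightarrow> ('k, 'a, 'p) module_scheme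
      \<Rightarrow> ('h \<times> ('a \<times> 'h \<Rightarrow> 'k) set \<Rightarrow> 'k) set
      \<Rightarrow> (('h \<Rightarrow> 'k) \<times> ('h \<Rightarrow> 'k) \<Rightarrow> 'k) set \<Rightarrow> 'a" where
  "Psi K H A Y = (let D = finite_dual K H in
     (\<lambda>X\<in>carrier (tensor K D D). tensor_lift K D D A (\<lambda>f g.
       tensor_lift K H (tensor K A H) A (\<lambda>h.
         tensor_lift K A H A (\<lambda>a k. (g h \<otimes>\<^bsub>K\<^esub> f k) \<odot>\<^bsub>A\<^esub> a)) Y) X))"

definition theta_globalization ::
    "('k, 'm) ring_scheme \<Rightarrow> ('k, 'h, 'n) hopf_scheme \<Rightarrow> ('k, 'a, 'p) module_scheme
      \<Rightarrow> ('a \<Rightarrow> ('h \<times> 'a \<Rightarrow> 'k) set) \<Rightarrow> ('a \<Rightarrow> ('a \<times> 'h \<Rightarrow> 'k) set)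
      \<Rightarrow> ('k, ('h \<times> ('a \<times> 'h \<Rightarrow> 'k) set \<Rightarrow> 'k) set) module" where
  "theta_globalization K H A lam rho =
    bimodule_span K (finite_dual K H) (HAH K H A) (HAH_lact K H A) (HAH_ract K H A)
      (theta K H A lam rho ` carrier A)"

definition phi_globalization ::
    "('k, 'm) ring_scheme \<Rightarrow> ('k, 'h, 'n) hopf_scheme \<Rightarrow> ('k, 'a, 'p) module_scheme
      \<Rightarrow> ('a \<Rightarrow> ('h \<times> 'a \<Rightarrow> 'k) set) \<Rightarrow> ('a \<Rightarrow> ('a \<times> 'h \<Rightarrow> 'k) set)
      \<Rightarrow> ('k, (('h \<Rightarrow> 'k) \<times> ('h \<Rightarrow> 'k) \<Rightarrow> 'k) set \<Rightarrow> 'a) module" where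
  "phi_globalization K H A lam rho = (let D = finite_dual K H in
    bimodule_span K D (hom_algebra K D A) (hom_lact K D A) (hom_ract K D A)
      (phi K H A lam rho ` carrier A))"

end

theory Submission imports Defs begin

text \<open>Write \<open>D = H\<^sup>0\<close> and, for \<open>Y\<close> in \<open>H \<otimes> A \<otimes> H\<close> and \<open>f\<close>, \<open>g\<close> in \<open>D\<close>, let \<open>Y^(f, g)\<close> be the image of \<open>Y\<close>
  under \<open>g \<otimes> id \<otimes> f\<close>. By definition \<open>\<Psi>(Y)(f \<otimes> g) = Y^(f, g)\<close>. As \<open>D\<close> separates the points of \<open>H\<close>,
  the elements \<open>Y^(f, g)\<close> determine \<open>Y\<close> (\<open>hat_inj\<close>), so \<open>\<Psi>\<close> is injective on all of
  \<open>H \<otimes> A \<otimes> H\<close>. Moreover \<open>(XY)^(f, g) = X^(f\<^sub>1, g\<^sub>1) Y^(f\<^sub>2, g\<^sub>2)\<close>, \<open>(u \<triangleright> X)^(f, g) = X^(fu, g)\<close>,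
  \<open>(X \<triangleleft> u)^(f, g) = X^(f, ug)\<close> and \<open>\<theta>(a)^(f, g) = (f \<rightharpoonup> a) \<leftharpoonup> g\<close> (\<open>hat_mult\<close>, \<open>hat_lact\<close>,
  \<open>hat_ract\<close>, \<open>hat_theta\<close>). These are the formulas for the operations on \<open>Hom(D \<otimes> D, A)\<close> and
  for \<open>\<phi>\<close>. Hence \<open>\<Psi>\<close> respects products and both actions and maps \<open>\<theta>(a)\<close> to \<open>\<phi>(a)\<close>; it carries
  the generators of one span onto those of the other, and restricts to a bijection between the spans.

  What remains is that both spans are bimodule algebras. First, \<open>D\<close> has to be a Hopf algebra at all
  (\<open>finite_dual_hopf\<close>). Membership in \<open>D\<close> is characterized by \<open>f(hk)\<close> depending on \<open>k\<close> only through
  finitely many functionals (\<open>finite_dual_iff\<close>), a condition that is visibly stable under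
  convolution and, since the antipode reverses products, under composition with it; identities in
  \<open>D \<otimes> D\<close> and \<open>D \<otimes> D \<otimes> D\<close> are tested on points of \<open>H\<close> (\<open>DD_eqI\<close>, \<open>DDD_eqI\<close>). Next,
  \<open>H \<otimes> A \<otimes> H\<close> is a \<open>D\<close>-bimodule algebra, because all axioms can be tested on the values
  \<open>Y^(f, g)\<close>. The span \<open>D \<triangleright> \<theta>(A) \<triangleleft> D\<close> is closed under products: in any bimodule algebra
  \<open>(f \<triangleright> x) y = f\<^sub>1 \<triangleright> (x (S(f\<^sub>2) \<triangleright> y))\<close> and \<open>x (y \<triangleleft> g) = ((x \<triangleleft> S(g\<^sub>1)) y) \<triangleleft> g\<^sub>2\<close>
  (\<open>smash_left\<close>, \<open>smash_right\<close>), which reduces the claim to products \<open>(\<theta>(a) \<triangleleft> p)(u \<triangleright> \<theta>(b))\<close>, and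
  the laws of a partial action show that these equal \<open>\<theta>((a \<leftharpoonup> p)(u \<rightharpoonup> b))\<close> (\<open>theta_mult\<close>). The
  structure on \<open>D \<triangleright> \<phi>(A) \<triangleleft> D\<close> is then transported along \<open>\<Psi>\<close>
  (\<open>bimodule_algebra_transport\<close>); that \<open>Hom(D \<otimes> D, A)\<close> is itself an algebra is not needed.

  Nearly all computations are done with \<^const>\<open>tensor_lift\<close>, through the universal property of the
  tensor product and, where elements have to be compared, through \<open>tensor_separation\<close>.\<close>

section \<open>Linear and bilinear maps\<close>

lemma (in abelian_group) minus_zero_eq:
  "\<lbrakk>x \<ominus> y = \<zero>; x \<in> carrier G; y \<in> carrier G\<rbrakk> \<Longrightarrow> x = y"
  by (metis a_assoc a_inv_closed l_neg l_zero minus_eq r_zero)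

text \<open>Linear maps: membership in \<^const>\<open>module_hom\<close>, together with the fact that both sides are
  vector spaces.\<close>

definition lin :: "('k, 'm) ring_scheme \<Rightarrow> ('k, 'v, 'n) module_scheme
    \<Rightarrow> ('k, 'w, 'p) module_scheme \<Rightarrow> ('v \<Rightarrow> 'w) \<Rightarrow> bool" where
  "lin K V W f \<longleftrightarrow> vectorspace K V \<and> vectorspace K W \<and> f \<in> module_hom K V W"

lemma linI:
  assumes "vectorspace K V" "vectorspace K W"
    and "\<And>x. x \<in> carrier V \<Longrightarrow> f x \<in> carrier W"
    and "\<And>x y. \<lbrakk>x \<in> carrier V; y \<in> carrier V\<rbrakk> \<Longrightarrow> f (x \<oplus>\<^bsub>V\<^esub> y) = f x \<oplus>\<^bsub>W\<^esub> f y"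
    and "\<And>c x. \<lbrakk>c \<in> carrier K; x \<in> carrier V\<rbrakk> \<Longrightarrow> f (c \<odot>\<^bsub>V\<^esub> x) = c \<odot>\<^bsub>W\<^esub> f x"
  shows "lin K V W f"
  using assms by (auto simp: lin_def module_hom_def)

lemma lin_vs: "lin K V W f \<Longrightarrow> vectorspace K V" "lin K V W f \<Longrightarrow> vectorspace K W"
  by (simp_all add: lin_def)

lemma lin_hom: "lin K V W f \<Longrightarrow> f \<in> module_hom K V W"
  by (simp add: lin_def)

lemma lin_closed: "\<lbrakk>lin K V W f; x \<in> carrier V\<rbrakk> \<Longrightarrow> f x \<in> carrier W"
  by (auto simp: lin_def module_hom_def)

lemma lin_add: "\<lbrakk>lin K V W f; x \<in> carrier V; y \<in> carrier V\<rbrakk> \<Longrightarrow> f (x \<oplus>\<^bsub>V\<^esub> y) = f x \<oplus>\<^bsub>W\<^esub> f y"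
  by (auto simp: lin_def module_hom_def)

lemma lin_smult: "\<lbrakk>lin K V W f; c \<in> carrier K; x \<in> carrier V\<rbrakk> \<Longrightarrow> f (c \<odot>\<^bsub>V\<^esub> x) = c \<odot>\<^bsub>W\<^esub> f x"
  by (auto simp: lin_def module_hom_def)

lemma lin_linear_map: "lin K V W f \<Longrightarrow> linear_map K V W f"
  by (simp add: lin_def linear_map_def mod_hom_def mod_hom_axioms_def vectorspace_def)

lemma lin_zero: "lin K V W f \<Longrightarrow> f \<zero>\<^bsub>V\<^esub> = \<zero>\<^bsub>W\<^esub>"
  by (metis lin_linear_map linear_map.T0_is_0)

lemma lin_minus:
  "\<lbrakk>lin K V W f; x \<in> carrier V; y \<in> carrier V\<rbrakk> \<Longrightarrow> f (x \<ominus>\<^bsub>V\<^esub> y) = f x \<ominus>\<^bsub>W\<^esub> f y"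
  by (metis lin_linear_map linear_map.T_minus)

lemma lin_cong:
  assumes "\<And>x. x \<in> carrier V \<Longrightarrow> f x = g x"
  shows "lin K V W f = lin K V W g"
proof -
  have "lin K V W f" if "lin K V W g" "\<And>x. x \<in> carrier V \<Longrightarrow> f x = g x" for f g
  proof -
    interpret V: vectorspace K V by (rule lin_vs[OF that(1)])
    show ?thesis
      using that by (intro linI) (auto simp: lin_vs lin_closed lin_add lin_smult)
  qed
  then show ?thesis using assms by metis
qed

lemma lin_id: "vectorspace K V \<Longrightarrow> lin K V V (\<lambda>x. x)"
  by (auto intro: linI)

lemma lin_comp: "\<lbrakk>lin K W Z g; lin K V W f\<rbrakk> \<Longrightarrow> lin K V Z (\<lambda>x. g (f x))"
  by (auto intro!: linI simp: lin_vs lin_closed lin_add lin_smult)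

lemma subspaceI:
  assumes "vectorspace K V" "U \<subseteq> carrier V" "\<zero>\<^bsub>V\<^esub> \<in> U"
    and "\<And>x y. \<lbrakk>x \<in> U; y \<in> U\<rbrakk> \<Longrightarrow> x \<oplus>\<^bsub>V\<^esub> y \<in> U"
    and "\<And>c x. \<lbrakk>c \<in> carrier K; x \<in> U\<rbrakk> \<Longrightarrow> c \<odot>\<^bsub>V\<^esub> x \<in> U"
  shows "subspace K U V"
  using assms by (auto simp: subspace_def submodule_def vectorspace_def)

lemma subspaceD:
  assumes "subspace K U V"
  shows "vectorspace K V" "U \<subseteq> carrier V" "\<zero>\<^bsub>V\<^esub> \<in> U"
    and "\<And>x y. \<lbrakk>x \<in> U; y \<in> U\<rbrakk> \<Longrightarrow> x \<oplus>\<^bsub>V\<^esub> y \<in> U"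
    and "\<And>c x. \<lbrakk>c \<in> carrier K; x \<in> U\<rbrakk> \<Longrightarrow> c \<odot>\<^bsub>V\<^esub> x \<in> U"
  using assms by (auto simp: subspace_def submodule_def)

lemma subspace_neg: "\<lbrakk>subspace K U V; x \<in> U\<rbrakk> \<Longrightarrow> \<ominus>\<^bsub>V\<^esub> x \<in> U"
proof -
  assume U: "subspace K U V" and x: "x \<in> U"
  interpret V: vectorspace K V by (rule subspaceD(1)[OF U])
  have "x \<in> carrier V" using subspaceD(2)[OF U] x by auto
  then have "\<ominus>\<^bsub>V\<^esub> x = (\<ominus>\<^bsub>K\<^esub> \<one>\<^bsub>K\<^esub>) \<odot>\<^bsub>V\<^esub> x" by (simp add: V.smult_l_minus)
  then show ?thesis using subspaceD(5)[OF U, of "\<ominus>\<^bsub>K\<^esub> \<one>\<^bsub>K\<^esub>" x] x by simp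
qed

lemma lin_preimage_subspace:
  assumes "lin K V W f" "subspace K U W"
  shows "subspace K {x \<in> carrier V. f x \<in> U} V"
proof -
  interpret V: vectorspace K V by (rule lin_vs[OF assms(1)])
  show ?thesis using subspaceD[OF assms(2)] assms(1)
    by (intro subspaceI) (auto simp: lin_vs lin_closed lin_add lin_smult lin_zero)
qed

lemma zero_subspace: "vectorspace K V \<Longrightarrow> subspace K {\<zero>\<^bsub>V\<^esub>} V"
proof -
  assume V: "vectorspace K V"
  interpret V: vectorspace K V by fact
  show ?thesis by (intro subspaceI) (auto intro: V)
qed

lemma lin_kernel_subspace:
  assumes "lin K V W f"
  shows "subspace K {x \<in> carrier V. f x = \<zero>\<^bsub>W\<^esub>} V"
  using lin_preimage_subspace[OF assms zero_subspace[OF lin_vs(2)[OF assms]]] by simp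

lemma lin_image_subspace:
  assumes "lin K V W f" "subspace K U V"
  shows "subspace K (f ` U) W"
proof (rule subspaceI)
  note U = subspaceD[OF assms(2)]
  have c: "x \<in> U \<Longrightarrow> x \<in> carrier V" for x using U by auto
  show "vectorspace K W" by (rule lin_vs[OF assms(1)])
  show "f ` U \<subseteq> carrier W" using assms(1) c by (auto intro: lin_closed)
  show "\<zero>\<^bsub>W\<^esub> \<in> f ` U" using lin_zero[OF assms(1)] U(3) by (metis imageI)
  show "x \<oplus>\<^bsub>W\<^esub> y \<in> f ` U" if xy: "x \<in> f ` U" "y \<in> f ` U" for x y
  proof -
    obtain u v where "u \<in> U" "v \<in> U" "x = f u" "y = f v" using xy by auto
    then have "x \<oplus>\<^bsub>W\<^esub> y = f (u \<oplus>\<^bsub>V\<^esub> v)" using lin_add[OF assms(1)] c by simp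
    then show ?thesis using U(4) \<open>u \<in> U\<close> \<open>v \<in> U\<close> by blast
  qed
  show "k \<odot>\<^bsub>W\<^esub> x \<in> f ` U" if kx: "k \<in> carrier K" "x \<in> f ` U" for k x
  proof -
    obtain u where "u \<in> U" "x = f u" using kx by auto
    then have "k \<odot>\<^bsub>W\<^esub> x = f (k \<odot>\<^bsub>V\<^esub> u)" using lin_smult[OF assms(1)] c kx by simp
    then show ?thesis using U(5) \<open>u \<in> U\<close> kx by blast
  qed
qed

lemma span_subspace:
  assumes "vectorspace K V" "S \<subseteq> carrier V"
  shows "subspace K (module.span K V S) V" "S \<subseteq> module.span K V S"
proof -
  interpret V: vectorspace K V by fact
  show "subspace K (module.span K V S) V" "S \<subseteq> module.span K V S"
    using assms V.span_is_subspace V.in_own_span by auto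
qed

lemma span_least: "\<lbrakk>subspace K U V; S \<subseteq> U\<rbrakk> \<Longrightarrow> module.span K V S \<subseteq> U"
proof -
  assume U: "subspace K U V" and S: "S \<subseteq> U"
  interpret V: vectorspace K V by (rule subspaceD(1)[OF U])
  show ?thesis using V.span_is_subset[OF S] U by (simp add: subspace_def)
qed

lemma span_image:
  assumes f: "lin K V W f" and S: "S \<subseteq> carrier V"
  shows "f ` module.span K V S = module.span K W (f ` S)"
proof
  have V: "vectorspace K V" and W: "vectorspace K W" using lin_vs[OF f] .
  have fS: "f ` S \<subseteq> carrier W" using S lin_closed[OF f] by auto
  show "module.span K W (f ` S) \<subseteq> f ` module.span K V S"
    using span_subspace[OF V S] by (intro span_least lin_image_subspace[OF f]) auto
  have "module.span K V S \<subseteq> {x \<in> carrier V. f x \<in> module.span K W (f ` S)}"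
    using S span_subspace(2)[OF W fS]
    by (intro span_least lin_preimage_subspace[OF f] span_subspace[OF W fS]) auto
  then show "f ` module.span K V S \<subseteq> module.span K W (f ` S)" by auto
qed

lemma subspace_sub_vs: "subspace K U V \<Longrightarrow> vectorspace K (V\<lparr>carrier := U\<rparr>)"
  using vectorspace.subspace_is_vs[of K V U] subspaceD(1) by blast

lemma scalars_simps [simp]:
  "carrier (scalars K) = carrier K" "add (scalars K) = add K" "zero (scalars K) = zero K"
  "smult (scalars K) = mult K" "mult (scalars K) = mult K" "one (scalars K) = one K"
  by (simp_all add: scalars_def)

lemma scalars_vs: "field K \<Longrightarrow> vectorspace K (scalars K)"
proof -
  assume "field K"
  then interpret K: field K .
  show ?thesis
  proof (rule vs_criteria)
    show "\<forall>v\<in>carrier (scalars K). \<exists>neg_v\<in>carrier (scalars K). v \<oplus>\<^bsub>scalars K\<^esub> neg_v = \<zero>\<^bsub>scalars K\<^esub>"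
      by (metis K.a_inv_closed K.r_neg scalars_simps(1-3))
  qed (auto simp: K.field_axioms K.a_ac K.m_assoc K.l_distr K.r_distr)
qed

lemma vs_field: "vectorspace K V \<Longrightarrow> field K"
  by (simp add: vectorspace_def)

text \<open>Bilinear maps. As for \<^const>\<open>lin\<close>, the three spaces are required to be vector spaces.\<close>

definition bilin :: "('k, 'm) ring_scheme \<Rightarrow> ('k, 'v, 'n) module_scheme
    \<Rightarrow> ('k, 'w, 'p) module_scheme \<Rightarrow> ('k, 'z, 'q) module_scheme \<Rightarrow> ('v \<Rightarrow> 'w \<Rightarrow> 'z) \<Rightarrow> bool" where
  "bilin K V W Z b \<longleftrightarrow> vectorspace K V \<and> vectorspace K W \<and> vectorspace K Z \<and>
    (\<forall>v\<in>carrier V. lin K W Z (b v)) \<and> (\<forall>w\<in>carrier W. lin K V Z (\<lambda>v. b v w))"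

lemma bilinI:
  assumes "vectorspace K V" "vectorspace K W"
    and "\<And>v. v \<in> carrier V \<Longrightarrow> lin K W Z (\<lambda>w. b v w)" "\<And>w. w \<in> carrier W \<Longrightarrow> lin K V Z (\<lambda>v. b v w)"
  shows "bilin K V W Z b"
proof -
  interpret V: vectorspace K V by fact
  show ?thesis using assms lin_vs(2)[OF assms(3)[OF V.M.zero_closed]] by (auto simp: bilin_def)
qed

lemma bilin_vs:
  "bilin K V W Z b \<Longrightarrow> vectorspace K V" "bilin K V W Z b \<Longrightarrow> vectorspace K W"
  "bilin K V W Z b \<Longrightarrow> vectorspace K Z"
  by (simp_all add: bilin_def)

lemma bilin_lin1: "\<lbrakk>bilin K V W Z b; v \<in> carrier V\<rbrakk> \<Longrightarrow> lin K W Z (b v)"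
  by (simp add: bilin_def)

lemma bilin_lin2: "\<lbrakk>bilin K V W Z b; w \<in> carrier W\<rbrakk> \<Longrightarrow> lin K V Z (\<lambda>v. b v w)"
  by (simp add: bilin_def)

lemma bilin_closed: "\<lbrakk>bilin K V W Z b; v \<in> carrier V; w \<in> carrier W\<rbrakk> \<Longrightarrow> b v w \<in> carrier Z"
  by (meson bilin_lin1 lin_closed)

lemma lin_bilin: "\<lbrakk>lin K Z Z' \<phi>; bilin K V W Z b\<rbrakk> \<Longrightarrow> bilin K V W Z' (\<lambda>v w. \<phi> (b v w))"
  by (auto intro!: bilinI intro: lin_comp[of K Z Z' \<phi>] simp: bilin_vs bilin_lin1 bilin_lin2)

lemma bilin_compose:
  assumes "bilin K V W Z b" "lin K V' V f" "lin K W' W g"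
  shows "bilin K V' W' Z (\<lambda>v w. b (f v) (g w))"
proof (rule bilinI)
  show "lin K W' Z (\<lambda>w. b (f v) (g w))" if "v \<in> carrier V'" for v
    using lin_comp[OF bilin_lin1[OF assms(1) lin_closed[OF assms(2) that]] assms(3)] .
  show "lin K V' Z (\<lambda>v. b (f v) (g w))" if "w \<in> carrier W'" for w
    using lin_comp[OF bilin_lin2[OF assms(1) lin_closed[OF assms(3) that]] assms(2)] .
qed (use assms lin_vs in auto)

lemma lin_smult_const:
  assumes f: "lin K V Z f" and c: "c \<in> carrier K"
  shows "lin K V Z (\<lambda>x. c \<odot>\<^bsub>Z\<^esub> f x)"
proof -
  interpret Z: vectorspace K Z by (rule lin_vs[OF f])
  show ?thesis
    using lin_vs[OF f] lin_closed[OF f] c by (intro linI)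
      (auto simp: lin_add[OF f] lin_smult[OF f] Z.smult_r_distr Z.smult_assoc1[symmetric] Z.R.m_comm)
qed

lemma lin_smult_var:
  assumes s: "lin K V (scalars K) s" and Z: "vectorspace K Z" and z: "z \<in> carrier Z"
  shows "lin K V Z (\<lambda>x. s x \<odot>\<^bsub>Z\<^esub> z)"
proof -
  interpret Z: vectorspace K Z by fact
  show ?thesis
    using lin_vs[OF s] lin_closed[OF s] z Z by (intro linI)
      (auto simp: lin_add[OF s] lin_smult[OF s] Z.smult_l_distr Z.smult_assoc1)
qed

section \<open>Free spaces and quotients\<close>

lemma func_space_simps:
  assumes "field K"
  shows "carrier (free_space K S) = {f \<in> S \<rightarrow>\<^sub>E carrier K. finite {s \<in> S. f s \<noteq> \<zero>\<^bsub>K\<^esub>}}"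
    "f \<oplus>\<^bsub>free_space K S\<^esub> g = (\<lambda>s\<in>S. f s \<oplus>\<^bsub>K\<^esub> g s)"
    "c \<odot>\<^bsub>free_space K S\<^esub> f = (\<lambda>s\<in>S. c \<otimes>\<^bsub>K\<^esub> f s)"
    "\<zero>\<^bsub>free_space K S\<^esub> = (\<lambda>s\<in>S. \<zero>\<^bsub>K\<^esub>)"
proof -
  interpret K: field K by fact
  show "carrier (free_space K S) = {f \<in> S \<rightarrow>\<^sub>E carrier K. finite {s \<in> S. f s \<noteq> \<zero>\<^bsub>K\<^esub>}}"
    "f \<oplus>\<^bsub>free_space K S\<^esub> g = (\<lambda>s\<in>S. f s \<oplus>\<^bsub>K\<^esub> g s)"
    "c \<odot>\<^bsub>free_space K S\<^esub> f = (\<lambda>s\<in>S. c \<otimes>\<^bsub>K\<^esub> f s)"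
    "\<zero>\<^bsub>free_space K S\<^esub> = (\<lambda>s\<in>S. \<zero>\<^bsub>K\<^esub>)"
    by (simp_all add: free_space_def K.func_space_def)
qed

lemma free_space_vs:
  assumes "field K"
  shows "vectorspace K (free_space K S)"
proof -
  interpret K: field K by fact
  let ?V = "K.func_space S"
  have V: "vectorspace K ?V"
    using K.func_space_is_module K.field_axioms by (simp add: vectorspace_def)
  have "subspace K {f \<in> S \<rightarrow>\<^sub>E carrier K. finite {s \<in> S. f s \<noteq> \<zero>\<^bsub>K\<^esub>}} ?V"
  proof (rule subspaceI[OF V])
    fix f g
    assume f: "f \<in> {f \<in> S \<rightarrow>\<^sub>E carrier K. finite {s \<in> S. f s \<noteq> \<zero>\<^bsub>K\<^esub>}}"
      and g: "g \<in> {f \<in> S \<rightarrow>\<^sub>E carrier K. finite {s \<in> S. f s \<noteq> \<zero>\<^bsub>K\<^esub>}}"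
    have "finite {s \<in> S. (f \<oplus>\<^bsub>?V\<^esub> g) s \<noteq> \<zero>\<^bsub>K\<^esub>}"
      by (rule finite_subset[of _ "{s \<in> S. f s \<noteq> \<zero>\<^bsub>K\<^esub>} \<union> {s \<in> S. g s \<noteq> \<zero>\<^bsub>K\<^esub>}"])
        (use f g in \<open>auto simp: K.func_space_def\<close>)
    then show "f \<oplus>\<^bsub>?V\<^esub> g \<in> {f \<in> S \<rightarrow>\<^sub>E carrier K. finite {s \<in> S. f s \<noteq> \<zero>\<^bsub>K\<^esub>}}"
      using f g by (auto simp: K.func_space_def)
  next
    fix c f
    assume c: "c \<in> carrier K" and f: "f \<in> {f \<in> S \<rightarrow>\<^sub>E carrier K. finite {s \<in> S. f s \<noteq> \<zero>\<^bsub>K\<^esub>}}"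
    have "finite {s \<in> S. (c \<odot>\<^bsub>?V\<^esub> f) s \<noteq> \<zero>\<^bsub>K\<^esub>}"
      by (rule finite_subset[of _ "{s \<in> S. f s \<noteq> \<zero>\<^bsub>K\<^esub>}"])
        (use f c in \<open>auto simp: K.func_space_def\<close>)
    then show "c \<odot>\<^bsub>?V\<^esub> f \<in> {f \<in> S \<rightarrow>\<^sub>E carrier K. finite {s \<in> S. f s \<noteq> \<zero>\<^bsub>K\<^esub>}}"
      using f c by (auto simp: K.func_space_def)
  qed (auto simp: K.func_space_def)
  from subspace_sub_vs[OF this] show ?thesis by (simp add: free_space_def)
qed

lemma free_gen_closed: "\<lbrakk>field K; s \<in> S\<rbrakk> \<Longrightarrow> free_gen K S s \<in> carrier (free_space K S)"
proof -
  assume "field K" and s: "s \<in> S"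
  then interpret K: field K by simp
  have "finite {t \<in> S. free_gen K S s t \<noteq> \<zero>\<^bsub>K\<^esub>}"
    by (rule finite_subset[of _ "{s}"]) (auto simp: free_gen_def)
  then show ?thesis by (auto simp: func_space_simps[OF K.field_axioms] free_gen_def)
qed

lemma free_induct [consumes 2, case_names zero add]:
  assumes K: "field K" and f: "f \<in> carrier (free_space K S)"
    and zero: "P \<zero>\<^bsub>free_space K S\<^esub>"
    and add: "\<And>c s f. \<lbrakk>c \<in> carrier K; s \<in> S; f \<in> carrier (free_space K S); P f\<rbrakk>
      \<Longrightarrow> P (c \<odot>\<^bsub>free_space K S\<^esub> free_gen K S s \<oplus>\<^bsub>free_space K S\<^esub> f)"
  shows "P f"
proof -
  interpret K: field K by fact
  note fs = func_space_simps[OF K]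
  have "P f" if "finite T" "f \<in> carrier (free_space K S)" "{s \<in> S. f s \<noteq> \<zero>\<^bsub>K\<^esub>} = T" for T f
    using that
  proof (induction T arbitrary: f)
    case empty
    then have "f = \<zero>\<^bsub>free_space K S\<^esub>" by (auto simp: fs PiE_def extensional_def)
    then show ?case using zero by simp
  next
    case (insert s T)
    let ?g = "\<lambda>t\<in>S. if t = s then \<zero>\<^bsub>K\<^esub> else f t"
    have s: "s \<in> S" using insert.prems(2) by auto
    have fc: "t \<in> S \<Longrightarrow> f t \<in> carrier K" for t using insert.prems(1) by (auto simp: fs)
    have supp: "{t \<in> S. ?g t \<noteq> \<zero>\<^bsub>K\<^esub>} = T" using insert.prems insert.hyps by auto
    have g: "?g \<in> carrier (free_space K S)"
      unfolding fs using supp insert.hyps fc by auto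
    have "f = f s \<odot>\<^bsub>free_space K S\<^esub> free_gen K S s \<oplus>\<^bsub>free_space K S\<^esub> ?g"
      using insert.prems(1) fc s
      by (auto simp: fs free_gen_def PiE_def extensional_def fun_eq_iff)
    then show ?case using add[OF fc[OF s] s g insert.IH[OF g supp]] by argo
  qed
  then show ?thesis using f unfolding fs by blast
qed

text \<open>The universal property of the free space\<close>

lemma free_lift:
  assumes Z: "vectorspace K Z" and b: "\<And>s. s \<in> S \<Longrightarrow> b s \<in> carrier Z"
  shows "\<exists>\<phi>. lin K (free_space K S) Z \<phi> \<and> (\<forall>s\<in>S. \<phi> (free_gen K S s) = b s)"
proof -
  interpret Z: vectorspace K Z by fact
  have K: "field K" by (rule vs_field[OF Z])
  note fs = func_space_simps[OF K]
  define \<phi> where "\<phi> f = (\<Oplus>\<^bsub>Z\<^esub>s\<in>{s \<in> S. f s \<noteq> \<zero>\<^bsub>K\<^esub>}. f s \<odot>\<^bsub>Z\<^esub> b s)" for f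
  have fc: "f s \<in> carrier K" if "f \<in> carrier (free_space K S)" "s \<in> S" for f s
    using that by (auto simp: fs)
  \<comment> \<open>the sum may be taken over any finite set that contains the support\<close>
  have \<phi>: "\<phi> f = (\<Oplus>\<^bsub>Z\<^esub>s\<in>T. f s \<odot>\<^bsub>Z\<^esub> b s)"
    if "f \<in> carrier (free_space K S)" "finite T" "T \<subseteq> S" "{s \<in> S. f s \<noteq> \<zero>\<^bsub>K\<^esub>} \<subseteq> T" for f T
    unfolding \<phi>_def
  proof (rule Z.M.add.finprod_mono_neutral_cong_left[OF that(2) that(4)])
    show "f i \<odot>\<^bsub>Z\<^esub> b i = \<zero>\<^bsub>Z\<^esub>" if "i \<in> T - {s \<in> S. f s \<noteq> \<zero>\<^bsub>K\<^esub>}" for i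
      using that \<open>T \<subseteq> S\<close> b by auto
    show "(\<lambda>i. f i \<odot>\<^bsub>Z\<^esub> b i) \<in> T \<rightarrow> carrier Z"
      using that(3) b fc[OF that(1)] by auto
  qed auto
  have "lin K (free_space K S) Z \<phi>"
  proof (rule linI[OF free_space_vs[OF K] Z])
    fix f assume f: "f \<in> carrier (free_space K S)"
    show "\<phi> f \<in> carrier Z" unfolding \<phi>_def using fc[OF f] b by (auto intro!: Z.M.finsum_closed)
    fix g assume g: "g \<in> carrier (free_space K S)"
    let ?T = "{s \<in> S. f s \<noteq> \<zero>\<^bsub>K\<^esub>} \<union> {s \<in> S. g s \<noteq> \<zero>\<^bsub>K\<^esub>}"
    have T: "finite ?T" using f g by (auto simp: fs)
    interpret F: vectorspace K "free_space K S" by (rule free_space_vs[OF K])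
    have "\<phi> (f \<oplus>\<^bsub>free_space K S\<^esub> g)
        = (\<Oplus>\<^bsub>Z\<^esub>s\<in>?T. (f \<oplus>\<^bsub>free_space K S\<^esub> g) s \<odot>\<^bsub>Z\<^esub> b s)"
      by (rule \<phi>[OF F.M.a_closed[OF f g] T]) (auto simp: fs(2))
    also have "\<dots> = (\<Oplus>\<^bsub>Z\<^esub>s\<in>?T. f s \<odot>\<^bsub>Z\<^esub> b s \<oplus>\<^bsub>Z\<^esub> g s \<odot>\<^bsub>Z\<^esub> b s)"
      by (rule Z.M.finsum_cong')
        (use fc[OF f] fc[OF g] b in \<open>auto simp: fs(2) Z.smult_l_distr\<close>)
    also have "\<dots> = (\<Oplus>\<^bsub>Z\<^esub>s\<in>?T. f s \<odot>\<^bsub>Z\<^esub> b s) \<oplus>\<^bsub>Z\<^esub> (\<Oplus>\<^bsub>Z\<^esub>s\<in>?T. g s \<odot>\<^bsub>Z\<^esub> b s)"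
      by (rule Z.M.finsum_addf) (use fc[OF f] fc[OF g] b in auto)
    also have "\<dots> = \<phi> f \<oplus>\<^bsub>Z\<^esub> \<phi> g"
      by (subst \<phi>[OF f T], blast, blast, subst \<phi>[OF g T], blast, blast, rule refl)
    finally show "\<phi> (f \<oplus>\<^bsub>free_space K S\<^esub> g) = \<phi> f \<oplus>\<^bsub>Z\<^esub> \<phi> g" .
  next
    fix c f assume c: "c \<in> carrier K" and f: "f \<in> carrier (free_space K S)"
    let ?T = "{s \<in> S. f s \<noteq> \<zero>\<^bsub>K\<^esub>}"
    have T: "finite ?T" using f by (auto simp: fs)
    interpret F: vectorspace K "free_space K S" by (rule free_space_vs[OF K])
    have "\<phi> (c \<odot>\<^bsub>free_space K S\<^esub> f) = (\<Oplus>\<^bsub>Z\<^esub>s\<in>?T. (c \<odot>\<^bsub>free_space K S\<^esub> f) s \<odot>\<^bsub>Z\<^esub> b s)"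
      by (rule \<phi>[OF F.smult_closed[OF c f] T]) (use c in \<open>auto simp: fs(3)\<close>)
    also have "\<dots> = (\<Oplus>\<^bsub>Z\<^esub>s\<in>?T. c \<odot>\<^bsub>Z\<^esub> (f s \<odot>\<^bsub>Z\<^esub> b s))"
      by (rule Z.M.finsum_cong')
        (use fc[OF f] c b in \<open>auto simp: fs(3) Z.smult_assoc1\<close>)
    also have "\<dots> = c \<odot>\<^bsub>Z\<^esub> \<phi> f"
      unfolding \<phi>_def by (rule Z.finsum_smult_ldistr[symmetric]) (use fc[OF f] c b T in auto)
    finally show "\<phi> (c \<odot>\<^bsub>free_space K S\<^esub> f) = c \<odot>\<^bsub>Z\<^esub> \<phi> f" .
  qed
  moreover have "\<phi> (free_gen K S s) = b s" if s: "s \<in> S" for s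
  proof -
    have "\<phi> (free_gen K S s) = (\<Oplus>\<^bsub>Z\<^esub>t\<in>{s}. free_gen K S s t \<odot>\<^bsub>Z\<^esub> b t)"
      by (rule \<phi>) (use s free_gen_closed[OF K s] in \<open>auto simp: free_gen_def\<close>)
    also have "\<dots> = free_gen K S s s \<odot>\<^bsub>Z\<^esub> b s"
      using s b by (simp add: free_gen_def)
    also have "\<dots> = b s" using s b by (simp add: free_gen_def)
    finally show ?thesis .
  qed
  ultimately show ?thesis by blast
qed

lemma quot_space_simps:
  "carrier (quot_space V U) = a_rcosets\<^bsub>V\<^esub> U"
  "X \<oplus>\<^bsub>quot_space V U\<^esub> Y = X <+>\<^bsub>V\<^esub> Y" "\<zero>\<^bsub>quot_space V U\<^esub> = U"
  "c \<odot>\<^bsub>quot_space V U\<^esub> X = (\<Union>x\<in>X. U +>\<^bsub>V\<^esub> (c \<odot>\<^bsub>V\<^esub> x))"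
  by (simp_all add: quot_space_def ring.defs module.defs FactRing_def)

lemma quot_space_props:
  assumes "subspace K U V"
  shows quot_carrier: "carrier (quot_space V U) = (\<lambda>x. U +>\<^bsub>V\<^esub> x) ` carrier V"
    and quot_eq_iff: "\<And>x y. \<lbrakk>x \<in> carrier V; y \<in> carrier V\<rbrakk>
      \<Longrightarrow> U +>\<^bsub>V\<^esub> x = U +>\<^bsub>V\<^esub> y \<longleftrightarrow> x \<ominus>\<^bsub>V\<^esub> y \<in> U"
    and quot_proj: "lin K V (quot_space V U) (\<lambda>x. U +>\<^bsub>V\<^esub> x)"
proof -
  interpret V: vectorspace K V by (rule subspaceD(1)[OF assms])
  note U = subspaceD[OF assms]
  have add: "additive_subgroup U V"
    by (intro additive_subgroup.intro V.M.add.subgroupI)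
      (use U subspace_neg[OF assms] in \<open>auto simp: a_inv_def[symmetric]\<close>)
  then interpret U: abelian_subgroup U V
    by (intro abelian_subgroupI3 V.M.abelian_group_axioms)
  show carr: "carrier (quot_space V U) = (\<lambda>x. U +>\<^bsub>V\<^esub> x) ` carrier V"
    by (auto simp: quot_space_simps A_RCOSETS_def RCOSETS_def a_r_coset_def)
  show eq: "U +>\<^bsub>V\<^esub> x = U +>\<^bsub>V\<^esub> y \<longleftrightarrow> x \<ominus>\<^bsub>V\<^esub> y \<in> U"
    if "x \<in> carrier V" "y \<in> carrier V" for x y
  proof
    assume "U +>\<^bsub>V\<^esub> x = U +>\<^bsub>V\<^esub> y"
    then have "x \<in> U +>\<^bsub>V\<^esub> y" using U.a_rcos_self[OF that(1)] by simp
    then obtain u where u: "u \<in> U" "x = u \<oplus>\<^bsub>V\<^esub> y" by (auto simp: a_r_coset_def r_coset_def)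
    then have "u \<in> carrier V" using U(2) by auto
    then have "x \<ominus>\<^bsub>V\<^esub> y = u" using u(2) that by (simp add: V.M.minus_eq V.M.a_assoc V.M.r_neg)
    then show "x \<ominus>\<^bsub>V\<^esub> y \<in> U" using u(1) by simp
  next
    assume *: "x \<ominus>\<^bsub>V\<^esub> y \<in> U"
    have "x = (x \<ominus>\<^bsub>V\<^esub> y) \<oplus>\<^bsub>V\<^esub> y"
      using that by (simp add: V.M.minus_eq V.M.a_assoc V.M.l_neg)
    then have "x \<in> U +>\<^bsub>V\<^esub> y"
      using V.M.a_rcosI[OF * U(2) that(2)] by simp
    then show "U +>\<^bsub>V\<^esub> x = U +>\<^bsub>V\<^esub> y"
      using V.M.a_repr_independence[OF _ that(2) U.a_subgroup] by simp
  qed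
  have sum: "(U +>\<^bsub>V\<^esub> x) \<oplus>\<^bsub>quot_space V U\<^esub> (U +>\<^bsub>V\<^esub> y) = U +>\<^bsub>V\<^esub> (x \<oplus>\<^bsub>V\<^esub> y)"
    if "x \<in> carrier V" "y \<in> carrier V" for x y
    using that by (simp add: quot_space_simps U.a_rcos_sum)
  have sm: "c \<odot>\<^bsub>quot_space V U\<^esub> (U +>\<^bsub>V\<^esub> x) = U +>\<^bsub>V\<^esub> (c \<odot>\<^bsub>V\<^esub> x)"
    if "c \<in> carrier K" "x \<in> carrier V" for c x
  proof -
    have "U +>\<^bsub>V\<^esub> (c \<odot>\<^bsub>V\<^esub> y) = U +>\<^bsub>V\<^esub> (c \<odot>\<^bsub>V\<^esub> x)" if y: "y \<in> U +>\<^bsub>V\<^esub> x" for y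
    proof -
      obtain u where u: "u \<in> U" "y = u \<oplus>\<^bsub>V\<^esub> x" using y by (auto simp: a_r_coset_def r_coset_def)
      then have uc: "u \<in> carrier V" using U(2) by auto
      have "c \<odot>\<^bsub>V\<^esub> y \<ominus>\<^bsub>V\<^esub> c \<odot>\<^bsub>V\<^esub> x = c \<odot>\<^bsub>V\<^esub> u"
        using u(2) uc \<open>c \<in> carrier K\<close> \<open>x \<in> carrier V\<close>
        by (simp add: V.smult_r_distr V.M.minus_eq V.M.a_assoc V.M.r_neg)
      also have "\<dots> \<in> U" using U(5) u \<open>c \<in> carrier K\<close> by simp
      finally show ?thesis using eq u(2) uc that
        by (simp add: \<open>c \<in> carrier K\<close> \<open>x \<in> carrier V\<close>)
    qed
    moreover have "x \<in> U +>\<^bsub>V\<^esub> x" using U.a_rcos_self that by simp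
    ultimately show ?thesis unfolding quot_space_simps(4) by (intro UN_constant_eq) blast+
  qed
  let ?Q = "quot_space V U"
  have zero: "\<zero>\<^bsub>?Q\<^esub> = U +>\<^bsub>V\<^esub> \<zero>\<^bsub>V\<^esub>"
    using V.M.a_coset_add_zero[OF U(2)] by (simp add: quot_space_simps)
  have "vectorspace K ?Q"
  proof (rule vs_criteria)
    show "field K" using V.field_axioms .
    show "\<forall>v\<in>carrier ?Q. \<exists>neg_v\<in>carrier ?Q. v \<oplus>\<^bsub>?Q\<^esub> neg_v = \<zero>\<^bsub>?Q\<^esub>"
    proof
      fix v assume "v \<in> carrier ?Q"
      then obtain x where "x \<in> carrier V" "v = U +>\<^bsub>V\<^esub> x" by (auto simp: carr)
      then show "\<exists>neg_v\<in>carrier ?Q. v \<oplus>\<^bsub>?Q\<^esub> neg_v = \<zero>\<^bsub>?Q\<^esub>"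
        by (intro bexI[of _ "U +>\<^bsub>V\<^esub> (\<ominus>\<^bsub>V\<^esub> x)"]) (auto simp: carr sum zero V.M.r_neg)
    qed
  qed (auto simp: carr sum sm zero V.M.a_ac V.smult_assoc1 V.smult_l_distr
      V.smult_r_distr)
  then show "lin K V ?Q (\<lambda>x. U +>\<^bsub>V\<^esub> x)"
    by (intro linI subspaceD(1)[OF assms]) (auto simp: carr sum sm)
qed

lemma quot_factor:
  assumes U: "subspace K U V" and \<phi>: "lin K V Z \<phi>" and 0: "\<And>u. u \<in> U \<Longrightarrow> \<phi> u = \<zero>\<^bsub>Z\<^esub>"
  shows "\<exists>\<psi>. lin K (quot_space V U) Z \<psi> \<and> (\<forall>x\<in>carrier V. \<psi> (U +>\<^bsub>V\<^esub> x) = \<phi> x)"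
proof -
  interpret V: vectorspace K V by (rule subspaceD(1)[OF U])
  interpret Z: vectorspace K Z by (rule lin_vs[OF \<phi>])
  note c = quot_carrier[OF U] and e = quot_eq_iff[OF U] and p = quot_proj[OF U]
  define \<psi> where "\<psi> X = \<phi> (SOME x. x \<in> carrier V \<and> U +>\<^bsub>V\<^esub> x = X)" for X
  have \<psi>: "\<psi> (U +>\<^bsub>V\<^esub> x) = \<phi> x" if x: "x \<in> carrier V" for x
  proof -
    let ?y = "SOME y. y \<in> carrier V \<and> U +>\<^bsub>V\<^esub> y = U +>\<^bsub>V\<^esub> x"
    have y: "?y \<in> carrier V" "U +>\<^bsub>V\<^esub> ?y = U +>\<^bsub>V\<^esub> x"
      using someI[of "\<lambda>y. y \<in> carrier V \<and> U +>\<^bsub>V\<^esub> y = U +>\<^bsub>V\<^esub> x" x] x by auto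
    then have "?y \<ominus>\<^bsub>V\<^esub> x \<in> U" using e x by simp
    then have "\<phi> ?y \<ominus>\<^bsub>Z\<^esub> \<phi> x = \<zero>\<^bsub>Z\<^esub>" using 0 lin_minus[OF \<phi> y(1) x] by simp
    then show ?thesis
      unfolding \<psi>_def using lin_closed[OF \<phi>] x y(1) Z.M.minus_zero_eq by blast
  qed
  have "lin K (quot_space V U) Z \<psi>"
    using lin_vs[OF p] lin_vs[OF \<phi>]
    by (intro linI) (auto simp: c \<psi> lin_add[OF p, symmetric] lin_smult[OF p, symmetric]
        lin_add[OF \<phi>] lin_smult[OF \<phi>] lin_closed[OF \<phi>])
  then show ?thesis using \<psi> by blast
qed

section \<open>Tensor products\<close>

lemma tensor_null_subspace:
  assumes "vectorspace K V" "vectorspace K W"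
  shows "subspace K (tensor_null K V W) (free_space K (carrier V \<times> carrier W))"
    and "tensor_relators K V W \<subseteq> tensor_null K V W"
    and "tensor_relators K V W \<subseteq> carrier (free_space K (carrier V \<times> carrier W))"
proof -
  interpret V: vectorspace K V by fact
  interpret W: vectorspace K W by fact
  let ?F = "free_space K (carrier V \<times> carrier W)"
  have F: "vectorspace K ?F" by (rule free_space_vs[OF V.field_axioms])
  interpret F: vectorspace K ?F by (rule F)
  show rel: "tensor_relators K V W \<subseteq> carrier ?F"
    by (auto simp: tensor_relators_def Let_def
        intro!: F.M.minus_closed F.M.a_closed F.smult_closed free_gen_closed V.field_axioms)
  show "subspace K (tensor_null K V W) ?F" "tensor_relators K V W \<subseteq> tensor_null K V W"
    unfolding tensor_null_def by (rule span_subspace[OF F rel])+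
qed

lemma tensor_space_vs:
  assumes "vectorspace K V" "vectorspace K W"
  shows "vectorspace K (tensor_space K V W)"
  unfolding tensor_space_def by (rule lin_vs(2)[OF quot_proj[OF tensor_null_subspace(1)[OF assms]]])

lemma tensor_one [simp]: "one (tensor K V W) = pure_tensor K V W \<one>\<^bsub>V\<^esub> \<one>\<^bsub>W\<^esub>"
  by (simp add: tensor_def Let_def)

lemma tensor_simps:
  "carrier (tensor K V W) = carrier (tensor_space K V W)"
  "add (tensor K V W) = add (tensor_space K V W)"
  "zero (tensor K V W) = zero (tensor_space K V W)"
  "smult (tensor K V W) = smult (tensor_space K V W)"
  by (simp_all add: tensor_def Let_def)

text \<open>Whether a structure is a vector space, or a map linear, depends only on the carrier and on
  the linear operations.\<close>

lemma vs_transfer: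
  assumes "carrier V' = carrier V" "add V' = add V" "zero V' = zero V" "smult V' = smult V"
    and "vectorspace K V"
  shows "vectorspace K V'"
proof -
  interpret V: vectorspace K V by fact
  show ?thesis
  proof (rule vs_criteria)
    show "\<forall>v\<in>carrier V'. \<exists>neg_v\<in>carrier V'. v \<oplus>\<^bsub>V'\<^esub> neg_v = \<zero>\<^bsub>V'\<^esub>"
      unfolding assms using V.M.a_inv_closed V.M.r_neg by blast
  qed (auto simp: assms V.field_axioms V.M.a_ac V.smult_assoc1 V.smult_l_distr V.smult_r_distr)
qed

lemma tensor_vs:
  assumes "vectorspace K V" "vectorspace K W"
  shows "vectorspace K (tensor K V W)"
  by (rule vs_transfer[OF _ _ _ _ tensor_space_vs[OF assms]]) (simp_all add: tensor_simps)

lemma lin_tensor_space: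
  assumes "vectorspace K V" "vectorspace K W"
  shows "lin K (tensor_space K V W) Z f = lin K (tensor K V W) Z f"
    and "lin K Z (tensor_space K V W) g = lin K Z (tensor K V W) g"
  using tensor_vs[OF assms] tensor_space_vs[OF assms] by (auto simp: lin_def module_hom_def tensor_simps)

lemma pure_bilin_space:
  assumes "vectorspace K V" "vectorspace K W"
  shows "bilin K V W (tensor_space K V W) (pure_tensor K V W)"
proof -
  interpret V: vectorspace K V by fact
  interpret W: vectorspace K W by fact
  let ?S = "carrier V \<times> carrier W" and ?N = "tensor_null K V W"
  let ?F = "free_space K ?S"
  interpret F: vectorspace K ?F by (rule free_space_vs[OF V.field_axioms])
  note N = tensor_null_subspace[OF assms]
  note p = quot_proj[OF N(1), folded tensor_space_def]
  let ?d = "\<lambda>v w. free_gen K ?S (v, w)"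
  have d: "?d v w \<in> carrier ?F" if "v \<in> carrier V" "w \<in> carrier W" for v w
    using that by (intro free_gen_closed[OF V.field_axioms]) auto
  have eq: "?N +>\<^bsub>?F\<^esub> x = ?N +>\<^bsub>?F\<^esub> y" if "x \<ominus>\<^bsub>?F\<^esub> y \<in> tensor_relators K V W"
      "x \<in> carrier ?F" "y \<in> carrier ?F" for x y
    using that N(2) quot_eq_iff[OF N(1)] by blast
  have "pure_tensor K V W (v \<oplus>\<^bsub>V\<^esub> v') w
      = pure_tensor K V W v w \<oplus>\<^bsub>tensor_space K V W\<^esub> pure_tensor K V W v' w"
    if "v \<in> carrier V" "v' \<in> carrier V" "w \<in> carrier W" for v v' w
  proof -
    have "?d (v \<oplus>\<^bsub>V\<^esub> v') w \<ominus>\<^bsub>?F\<^esub> (?d v w \<oplus>\<^bsub>?F\<^esub> ?d v' w) \<in> tensor_relators K V W"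
      using that unfolding tensor_relators_def Let_def by blast
    then show ?thesis unfolding pure_tensor_def using that d
      by (subst lin_add[OF p, symmetric]) (simp_all add: eq)
  qed
  moreover have "pure_tensor K V W v (w \<oplus>\<^bsub>W\<^esub> w')
      = pure_tensor K V W v w \<oplus>\<^bsub>tensor_space K V W\<^esub> pure_tensor K V W v w'"
    if "v \<in> carrier V" "w \<in> carrier W" "w' \<in> carrier W" for v w w'
  proof -
    have "?d v (w \<oplus>\<^bsub>W\<^esub> w') \<ominus>\<^bsub>?F\<^esub> (?d v w \<oplus>\<^bsub>?F\<^esub> ?d v w') \<in> tensor_relators K V W"
      using that unfolding tensor_relators_def Let_def by blast
    then show ?thesis unfolding pure_tensor_def using that d
      by (subst lin_add[OF p, symmetric]) (simp_all add: eq)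
  qed
  moreover have "pure_tensor K V W (c \<odot>\<^bsub>V\<^esub> v) w = c \<odot>\<^bsub>tensor_space K V W\<^esub> pure_tensor K V W v w"
    if "c \<in> carrier K" "v \<in> carrier V" "w \<in> carrier W" for c v w
  proof -
    have "?d (c \<odot>\<^bsub>V\<^esub> v) w \<ominus>\<^bsub>?F\<^esub> (c \<odot>\<^bsub>?F\<^esub> ?d v w) \<in> tensor_relators K V W"
      using that unfolding tensor_relators_def Let_def by blast
    then show ?thesis unfolding pure_tensor_def using that d
      by (subst lin_smult[OF p, symmetric]) (simp_all add: eq)
  qed
  moreover have "pure_tensor K V W v (c \<odot>\<^bsub>W\<^esub> w) = c \<odot>\<^bsub>tensor_space K V W\<^esub> pure_tensor K V W v w"
    if "c \<in> carrier K" "v \<in> carrier V" "w \<in> carrier W" for c v w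
  proof -
    have "?d v (c \<odot>\<^bsub>W\<^esub> w) \<ominus>\<^bsub>?F\<^esub> (c \<odot>\<^bsub>?F\<^esub> ?d v w) \<in> tensor_relators K V W"
      using that unfolding tensor_relators_def Let_def by blast
    then show ?thesis unfolding pure_tensor_def using that d
      by (subst lin_smult[OF p, symmetric]) (simp_all add: eq)
  qed
  moreover have "pure_tensor K V W v w \<in> carrier (tensor_space K V W)"
    if "v \<in> carrier V" "w \<in> carrier W" for v w
    unfolding pure_tensor_def using that d lin_closed[OF p] by simp
  ultimately show ?thesis
    by (intro bilinI linI assms tensor_space_vs) auto
qed

lemma pure_bilin:
  assumes "vectorspace K V" "vectorspace K W"
  shows "bilin K V W (tensor K V W) (pure_tensor K V W)"
  using pure_bilin_space[OF assms] tensor_vs[OF assms]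
  by (auto simp: bilin_def lin_tensor_space[OF assms])

lemma pure_closed:
  "\<lbrakk>vectorspace K V; vectorspace K W; v \<in> carrier V; w \<in> carrier W\<rbrakk>
    \<Longrightarrow> pure_tensor K V W v w \<in> carrier (tensor K V W)"
  by (rule bilin_closed[OF pure_bilin])

lemma tensor_induct [consumes 3, case_names pure add]:
  assumes V: "vectorspace K V" and W: "vectorspace K W" and X: "X \<in> carrier (tensor K V W)"
    and pure: "\<And>v w. \<lbrakk>v \<in> carrier V; w \<in> carrier W\<rbrakk> \<Longrightarrow> P (pure_tensor K V W v w)"
    and add: "\<And>X Y. \<lbrakk>X \<in> carrier (tensor K V W); Y \<in> carrier (tensor K V W); P X; P Y\<rbrakk>
      \<Longrightarrow> P (X \<oplus>\<^bsub>tensor K V W\<^esub> Y)"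
  shows "P X"
proof -
  interpret V: vectorspace K V by fact
  interpret W: vectorspace K W by fact
  let ?S = "carrier V \<times> carrier W" and ?N = "tensor_null K V W"
  let ?F = "free_space K ?S"
  interpret F: vectorspace K ?F by (rule free_space_vs[OF V.field_axioms])
  note N = tensor_null_subspace[OF V W]
  note p = quot_proj[OF N(1), folded tensor_space_def]
  note b = pure_bilin_space[OF V W]
  have "P (?N +>\<^bsub>?F\<^esub> f)" if "f \<in> carrier ?F" for f
    using V.field_axioms that
  proof (induction rule: free_induct)
    case zero
    have "?N +>\<^bsub>?F\<^esub> \<zero>\<^bsub>?F\<^esub> = \<zero>\<^bsub>tensor_space K V W\<^esub>" by (rule lin_zero[OF p])
    also have "\<dots> = pure_tensor K V W \<zero>\<^bsub>V\<^esub> \<zero>\<^bsub>W\<^esub>"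
      using lin_zero[OF bilin_lin1[OF b V.M.zero_closed]] by simp
    finally show ?case using pure by simp
  next
    case (add c s f)
    obtain v w where s: "s = (v, w)" "v \<in> carrier V" "w \<in> carrier W" using add(2) by auto
    have g: "free_gen K ?S s \<in> carrier ?F" by (rule free_gen_closed[OF V.field_axioms add(2)])
    have "?N +>\<^bsub>?F\<^esub> (c \<odot>\<^bsub>?F\<^esub> free_gen K ?S s)
        = c \<odot>\<^bsub>tensor_space K V W\<^esub> pure_tensor K V W v w"
      unfolding pure_tensor_def s(1)[symmetric] by (rule lin_smult[OF p add(1) g])
    also have "\<dots> = pure_tensor K V W (c \<odot>\<^bsub>V\<^esub> v) w"
      using lin_smult[OF bilin_lin2[OF b s(3)] add(1) s(2)] by simp
    finally have "P (?N +>\<^bsub>?F\<^esub> (c \<odot>\<^bsub>?F\<^esub> free_gen K ?S s))"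
      using pure[OF V.smult_closed[OF add(1) s(2)] s(3)] by simp
    moreover have "?N +>\<^bsub>?F\<^esub> (c \<odot>\<^bsub>?F\<^esub> free_gen K ?S s \<oplus>\<^bsub>?F\<^esub> f)
        = (?N +>\<^bsub>?F\<^esub> (c \<odot>\<^bsub>?F\<^esub> free_gen K ?S s)) \<oplus>\<^bsub>tensor_space K V W\<^esub> (?N +>\<^bsub>?F\<^esub> f)"
      by (rule lin_add[OF p F.smult_closed[OF add(1) g] add(3)])
    ultimately show ?case
      using assms(5)[of "?N +>\<^bsub>?F\<^esub> (c \<odot>\<^bsub>?F\<^esub> free_gen K ?S s)" "?N +>\<^bsub>?F\<^esub> f"]
        lin_closed[OF p F.smult_closed[OF add(1) g]] lin_closed[OF p add(3)] add(4)
      by (simp add: tensor_simps)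
  qed
  moreover obtain f where "f \<in> carrier ?F" "X = ?N +>\<^bsub>?F\<^esub> f"
    using X quot_carrier[OF N(1)] by (auto simp: tensor_space_def tensor_simps)
  ultimately show ?thesis by simp
qed

lemma tensor_ext:
  assumes "lin K (tensor K V W) Z f" "lin K (tensor K V W) Z g"
    and "vectorspace K V" "vectorspace K W" "X \<in> carrier (tensor K V W)"
    and "\<And>v w. \<lbrakk>v \<in> carrier V; w \<in> carrier W\<rbrakk>
      \<Longrightarrow> f (pure_tensor K V W v w) = g (pure_tensor K V W v w)"
  shows "f X = g X"
  using assms(3-5)
proof (induction rule: tensor_induct)
  case (add X Y)
  then show ?case by (simp add: lin_add[OF assms(1)] lin_add[OF assms(2)])
qed (rule assms)

text \<open>The universal property\<close>

lemma tensor_lift_ex: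
  assumes b: "bilin K V W Z b"
  shows "\<exists>\<phi>. \<phi> \<in> module_hom K (tensor_space K V W) Z \<and>
     (\<forall>v\<in>carrier V. \<forall>w\<in>carrier W. \<phi> (pure_tensor K V W v w) = b v w)"
proof -
  interpret V: vectorspace K V by (rule bilin_vs[OF b])
  interpret W: vectorspace K W by (rule bilin_vs[OF b])
  interpret Z: vectorspace K Z by (rule bilin_vs[OF b])
  let ?S = "carrier V \<times> carrier W" and ?N = "tensor_null K V W"
  let ?F = "free_space K ?S"
  interpret F: vectorspace K ?F by (rule free_space_vs[OF V.field_axioms])
  note N = tensor_null_subspace[OF bilin_vs(1,2)[OF b]]
  have bc: "b v w \<in> carrier Z" if "v \<in> carrier V" "w \<in> carrier W" for v w
    using bilin_closed[OF b] that .
  obtain \<phi> where \<phi>: "lin K ?F Z \<phi>" "\<And>s. s \<in> ?S \<Longrightarrow> \<phi> (free_gen K ?S s) = case_prod b s"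
    using free_lift[OF bilin_vs(3)[OF b], of ?S "case_prod b"] bc by auto
  have g: "free_gen K ?S (v, w) \<in> carrier ?F" if "v \<in> carrier V" "w \<in> carrier W" for v w
    using that by (intro free_gen_closed[OF V.field_axioms]) auto
  have \<phi>g: "\<phi> (free_gen K ?S (v, w)) = b v w" if "v \<in> carrier V" "w \<in> carrier W" for v w
    using \<phi>(2) that by simp
  have "tensor_relators K V W \<subseteq> {x \<in> carrier ?F. \<phi> x = \<zero>\<^bsub>Z\<^esub>}"
  proof
    fix x assume x: "x \<in> tensor_relators K V W"
    have "\<phi> x = \<zero>\<^bsub>Z\<^esub>"
      using x unfolding tensor_relators_def Let_def
      by (auto simp: lin_minus[OF \<phi>(1)] lin_add[OF \<phi>(1)] lin_smult[OF \<phi>(1)] g \<phi>g bc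
          lin_add[OF bilin_lin1[OF b]] lin_add[OF bilin_lin2[OF b]]
          lin_smult[OF bilin_lin1[OF b]] lin_smult[OF bilin_lin2[OF b]]
          Z.M.minus_eq Z.M.r_neg)
    then show "x \<in> {x \<in> carrier ?F. \<phi> x = \<zero>\<^bsub>Z\<^esub>}" using x N(3) by auto
  qed
  then have "?N \<subseteq> {x \<in> carrier ?F. \<phi> x = \<zero>\<^bsub>Z\<^esub>}"
    unfolding tensor_null_def by (intro span_least lin_kernel_subspace[OF \<phi>(1)])
  then obtain \<psi> where "lin K (tensor_space K V W) Z \<psi>"
      "\<And>x. x \<in> carrier ?F \<Longrightarrow> \<psi> (?N +>\<^bsub>?F\<^esub> x) = \<phi> x"
    using quot_factor[OF N(1) \<phi>(1)] unfolding tensor_space_def by blast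
  then show ?thesis
    using g \<phi>g by (intro exI[of _ \<psi>]) (auto simp: lin_hom pure_tensor_def)
qed

lemma lift_lin: "bilin K V W Z b \<Longrightarrow> lin K (tensor K V W) Z (tensor_lift K V W Z b)"
  and lift_pure: "\<lbrakk>bilin K V W Z b; v \<in> carrier V; w \<in> carrier W\<rbrakk>
    \<Longrightarrow> tensor_lift K V W Z b (pure_tensor K V W v w) = b v w"
proof -
  assume b: "bilin K V W Z b"
  note 1 = someI_ex[OF tensor_lift_ex[OF b], folded tensor_lift_def]
  then have "lin K (tensor_space K V W) Z (tensor_lift K V W Z b)"
    using bilin_vs[OF b] by (simp add: lin_def tensor_space_vs)
  then show "lin K (tensor K V W) Z (tensor_lift K V W Z b)"
    using lin_tensor_space bilin_vs[OF b] by blast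
  show "tensor_lift K V W Z b (pure_tensor K V W v w) = b v w"
    if "v \<in> carrier V" "w \<in> carrier W" using 1 that by auto
qed

text \<open>Bilinearity is not needed: \<^const>\<open>tensor_lift\<close> is a choice whose defining property mentions
  only the values of the form on the carriers.\<close>

lemma lift_cong:
  assumes "\<And>v w. \<lbrakk>v \<in> carrier V; w \<in> carrier W\<rbrakk> \<Longrightarrow> b v w = b' v w" and "X = X'"
  shows "tensor_lift K V W Z b X = tensor_lift K V W Z b' X'"
proof -
  have "(\<lambda>\<phi>. \<phi> \<in> module_hom K (tensor_space K V W) Z \<and>
     (\<forall>v\<in>carrier V. \<forall>w\<in>carrier W. \<phi> (pure_tensor K V W v w) = b v w)) =
     (\<lambda>\<phi>. \<phi> \<in> module_hom K (tensor_space K V W) Z \<and>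
     (\<forall>v\<in>carrier V. \<forall>w\<in>carrier W. \<phi> (pure_tensor K V W v w) = b' v w))"
    using assms(1) by auto
  then show ?thesis unfolding tensor_lift_def assms(2) by simp
qed

lemma lift_closed:
  "\<lbrakk>bilin K V W Z b; X \<in> carrier (tensor K V W)\<rbrakk> \<Longrightarrow> tensor_lift K V W Z b X \<in> carrier Z"
  by (rule lin_closed[OF lift_lin])

text \<open>Linear maps commute with lifts.\<close>

lemma lin_lift:
  assumes \<phi>: "lin K Z Z' \<phi>" and b: "bilin K V W Z b" and X: "X \<in> carrier (tensor K V W)"
  shows "\<phi> (tensor_lift K V W Z b X) = tensor_lift K V W Z' (\<lambda>v w. \<phi> (b v w)) X"
  by (rule tensor_ext[OF lin_comp[OF \<phi> lift_lin[OF b]] lift_lin[OF lin_bilin[OF \<phi> b]]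
        bilin_vs(1,2)[OF b] X])
    (simp add: lift_pure b lin_bilin[OF \<phi> b])

lemma lift_unique:
  assumes "lin K (tensor K V W) Z \<phi>" "bilin K V W Z b" "X \<in> carrier (tensor K V W)"
    and "\<And>v w. \<lbrakk>v \<in> carrier V; w \<in> carrier W\<rbrakk> \<Longrightarrow> \<phi> (pure_tensor K V W v w) = b v w"
  shows "\<phi> X = tensor_lift K V W Z b X"
  by (rule tensor_ext[OF assms(1) lift_lin[OF assms(2)] bilin_vs(1,2)[OF assms(2)] assms(3)])
    (simp add: lift_pure assms)

lemma lin_sum:
  assumes "lin K V W f" "lin K V W g"
  shows "lin K V W (\<lambda>x. f x \<oplus>\<^bsub>W\<^esub> g x)"
proof -
  interpret W: vectorspace K W by (rule lin_vs[OF assms(1)])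
  show ?thesis
    using lin_vs[OF assms(1)] lin_closed[OF assms(1)] lin_closed[OF assms(2)]
    by (intro linI) (auto simp: lin_add[OF assms(1)] lin_add[OF assms(2)] lin_smult[OF assms(1)]
        lin_smult[OF assms(2)] W.smult_r_distr W.M.a_ac)
qed

text \<open>A lift is linear in parameters on which the form depends linearly.\<close>

lemma lift_param_lin:
  assumes "vectorspace K U" "X \<in> carrier (tensor K V W)"
    and b: "\<And>u. u \<in> carrier U \<Longrightarrow> bilin K V W Z (b u)"
    and l: "\<And>v w. \<lbrakk>v \<in> carrier V; w \<in> carrier W\<rbrakk> \<Longrightarrow> lin K U Z (\<lambda>u. b u v w)"
  shows "lin K U Z (\<lambda>u. tensor_lift K V W Z (b u) X)"
proof -
  interpret U: vectorspace K U by fact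
  note b0 = b[OF U.M.zero_closed]
  interpret Z: vectorspace K Z by (rule bilin_vs[OF b0])
  have vs: "vectorspace K V" "vectorspace K W" "vectorspace K Z" by (rule bilin_vs[OF b0])+
  show ?thesis
    using vs(1,2) assms(2)
  proof (induction rule: tensor_induct)
    case (pure v w)
    then show ?case
      using l[OF pure] by (subst lin_cong[where g = "\<lambda>u. b u v w"]) (auto simp: lift_pure b)
  next
    case (add X Y)
    let ?f = "\<lambda>X u. tensor_lift K V W Z (b u) X"
    have "\<And>u. u \<in> carrier U \<Longrightarrow> ?f (X \<oplus>\<^bsub>tensor K V W\<^esub> Y) u = ?f X u \<oplus>\<^bsub>Z\<^esub> ?f Y u"
      by (rule lin_add[OF lift_lin[OF b] add(1,2)])
    moreover have "lin K U Z (\<lambda>u. ?f X u \<oplus>\<^bsub>Z\<^esub> ?f Y u)"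
      by (rule lin_sum[OF add(3,4)])
    ultimately show ?case by (rule iffD2[OF lin_cong])
  qed
qed

lemma lift_param_bilin:
  assumes Y: "Y \<in> carrier (tensor K V' W')" and vs: "vectorspace K V" "vectorspace K W"
    and q: "\<And>x y. \<lbrakk>x \<in> carrier V; y \<in> carrier W\<rbrakk> \<Longrightarrow> bilin K V' W' Z (q x y)"
    and q': "\<And>u v. \<lbrakk>u \<in> carrier V'; v \<in> carrier W'\<rbrakk> \<Longrightarrow> bilin K V W Z (\<lambda>x y. q x y u v)"
  shows "bilin K V W Z (\<lambda>x y. tensor_lift K V' W' Z (q x y) Y)"
proof (rule bilinI[OF vs])
  show "lin K W Z (\<lambda>y. tensor_lift K V' W' Z (q x y) Y)" if "x \<in> carrier V" for x
    by (rule lift_param_lin[OF vs(2) Y q[OF that]]) (auto intro: bilin_lin1[OF q' that])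
  show "lin K V Z (\<lambda>x. tensor_lift K V' W' Z (q x y) Y)" if "y \<in> carrier W" for y
    by (rule lift_param_lin[OF vs(1) Y q[OF _ that]]) (auto intro: bilin_lin2[OF q' that])
qed

text \<open>Two summations over independent tensors can be interchanged.\<close>

lemma lift_swap:
  assumes X: "X \<in> carrier (tensor K V W)" and Y: "Y \<in> carrier (tensor K V' W')"
    and vs: "vectorspace K V" "vectorspace K W" "vectorspace K V'" "vectorspace K W'"
    and q: "\<And>x y. \<lbrakk>x \<in> carrier V; y \<in> carrier W\<rbrakk> \<Longrightarrow> bilin K V' W' Z (q x y)"
    and q': "\<And>u v. \<lbrakk>u \<in> carrier V'; v \<in> carrier W'\<rbrakk> \<Longrightarrow> bilin K V W Z (\<lambda>x y. q x y u v)"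
  shows "tensor_lift K V W Z (\<lambda>x y. tensor_lift K V' W' Z (\<lambda>u v. q x y u v) Y) X
    = tensor_lift K V' W' Z (\<lambda>u v. tensor_lift K V W Z (\<lambda>x y. q x y u v) X) Y"
proof -
  note b = lift_param_bilin[OF Y vs(1,2) q q']
  note b' = lift_param_bilin[OF _ vs(3,4) q' q]
  have T: "vectorspace K (tensor K V W)" by (rule tensor_vs[OF vs(1,2)])
  have l: "lin K (tensor K V W) Z
      (\<lambda>X. tensor_lift K V' W' Z (\<lambda>u v. tensor_lift K V W Z (\<lambda>x y. q x y u v) X) Y)"
    by (rule lift_param_lin[OF T Y b']) (auto intro: lift_lin q')
  show ?thesis
  proof (rule lift_unique[OF l b X, symmetric])
    fix x y assume xy: "x \<in> carrier V" "y \<in> carrier W"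
    show "tensor_lift K V' W' Z
        (\<lambda>u v. tensor_lift K V W Z (\<lambda>x y. q x y u v) (pure_tensor K V W x y)) Y
      = tensor_lift K V' W' Z (\<lambda>u v. q x y u v) Y"
      by (rule lift_cong) (simp_all add: lift_pure[OF q'] xy)
  qed
qed

text \<open>Maps between tensor products, read off through lifts\<close>

lemma tensor_map_bilin:
  assumes "lin K V V' f" "lin K W W' g"
  shows "bilin K V W (tensor K V' W') (\<lambda>v w. pure_tensor K V' W' (f v) (g w))"
  using bilin_compose[OF pure_bilin[OF lin_vs(2)[OF assms(1)] lin_vs(2)[OF assms(2)]] assms] .

lemma tensor_map_lin:
  "\<lbrakk>lin K V V' f; lin K W W' g\<rbrakk>
    \<Longrightarrow> lin K (tensor K V W) (tensor K V' W') (tensor_map K V W V' W' f g)"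
  unfolding tensor_map_def by (intro lift_lin tensor_map_bilin)

lemma lift_tensor_map:
  assumes "lin K V V' f" "lin K W W' g" "bilin K V' W' Z b" "X \<in> carrier (tensor K V W)"
  shows "tensor_lift K V' W' Z b (tensor_map K V W V' W' f g X)
    = tensor_lift K V W Z (\<lambda>v w. b (f v) (g w)) X"
  unfolding tensor_map_def lin_lift[OF lift_lin[OF assms(3)] tensor_map_bilin[OF assms(1,2)] assms(4)]
  by (rule lift_cong)
    (simp_all add: lift_pure[OF assms(3)] lin_closed[OF assms(1)] lin_closed[OF assms(2)])

lemma pure_lin1:
  "\<lbrakk>vectorspace K W; lin K U V f; w \<in> carrier W\<rbrakk>
    \<Longrightarrow> lin K U (tensor K V W) (\<lambda>u. pure_tensor K V W (f u) w)"
  by (rule lin_comp[OF bilin_lin2[OF pure_bilin[OF lin_vs(2)]]])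

lemma pure_lin2:
  "\<lbrakk>vectorspace K V; lin K U W f; v \<in> carrier V\<rbrakk>
    \<Longrightarrow> lin K U (tensor K V W) (\<lambda>u. pure_tensor K V W v (f u))"
  by (rule lin_comp[OF bilin_lin1[OF pure_bilin[OF _ lin_vs(2)]]])

lemma tensor_assoc_props:
  fixes K :: "('k, 'm) ring_scheme"
  assumes vs: "vectorspace K U" "vectorspace K V" "vectorspace K W"
  shows tensor_assoc_lin: "lin K (tensor K (tensor K U V) W) (tensor K U (tensor K V W))
      (tensor_assoc K U V W)"
    and lift_tensor_assoc: "\<And>b Y. \<lbrakk>bilin K U (tensor K V W) Z b;
        Y \<in> carrier (tensor K (tensor K U V) W)\<rbrakk> \<Longrightarrow>
      tensor_lift K U (tensor K V W) Z b (tensor_assoc K U V W Y)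
        = tensor_lift K (tensor K U V) W Z
            (\<lambda>X w. tensor_lift K U V Z (\<lambda>u v. b u (pure_tensor K V W v w)) X) Y"
proof -
  let ?VW = "tensor K V W" and ?UV = "tensor K U V"
  let ?T = "tensor K U ?VW"
  have VW: "vectorspace K ?VW" and UV: "vectorspace K ?UV" by (intro tensor_vs vs)+
  have T: "vectorspace K ?T" by (intro tensor_vs vs VW)
  have inner: "bilin K U V Z (\<lambda>u v. b u (pure_tensor K V W v w))"
    if "bilin K U ?VW Z b" "w \<in> carrier W" for w Z b
    by (rule bilin_compose[OF that(1) lin_id[OF vs(1)] pure_lin1[OF vs(3) lin_id[OF vs(2)] that(2)]])
  have outer: "bilin K ?UV W Z (\<lambda>X w. tensor_lift K U V Z (\<lambda>u v. b u (pure_tensor K V W v w)) X)"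
    if b: "bilin K U ?VW Z b" for Z b
  proof (rule bilinI[OF UV vs(3)])
    show "lin K W Z (\<lambda>w. tensor_lift K U V Z (\<lambda>u v. b u (pure_tensor K V W v w)) X)"
      if "X \<in> carrier ?UV" for X
      by (rule lift_param_lin[OF vs(3) that inner[OF b]])
        (assumption, rule lin_comp[OF bilin_lin1[OF b] pure_lin2[OF vs(2) lin_id[OF vs(3)]]])
    show "lin K ?UV Z (\<lambda>X. tensor_lift K U V Z (\<lambda>u v. b u (pure_tensor K V W v w)) X)"
      if "w \<in> carrier W" for w
      by (rule lift_lin[OF inner[OF b that]])
  qed
  note p = pure_bilin[OF vs(1) VW]
  show "lin K (tensor K ?UV W) ?T (tensor_assoc K U V W)"
    unfolding tensor_assoc_def Let_def by (rule lift_lin[OF outer[OF p]])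
  show "tensor_lift K U ?VW Z b (tensor_assoc K U V W Y) = tensor_lift K ?UV W Z
            (\<lambda>X w. tensor_lift K U V Z (\<lambda>u v. b u (pure_tensor K V W v w)) X) Y"
    if b: "bilin K U ?VW Z b" and Y: "Y \<in> carrier (tensor K ?UV W)" for b Y
  proof -
    have 1: "tensor_lift K U ?VW Z b (tensor_lift K U V ?T
          (\<lambda>u v. pure_tensor K U ?VW u (pure_tensor K V W v w)) X)
        = tensor_lift K U V Z (\<lambda>u v. b u (pure_tensor K V W v w)) X"
      if X: "X \<in> carrier ?UV" and w: "w \<in> carrier W" for X w
      unfolding lin_lift[OF lift_lin[OF b] inner[OF p w] X]
      by (rule lift_cong) (simp_all add: lift_pure[OF b] pure_closed[OF vs(2,3)] w)
    show ?thesis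
      unfolding tensor_assoc_def Let_def lin_lift[OF lift_lin[OF b] outer[OF p] Y]
      by (rule lift_cong) (simp_all add: 1)
  qed
qed

subsection \<open>Separation of tensors by functionals\<close>

text \<open>The sums of \<open>n\<close> pure tensors, on which the induction below runs\<close>

primrec pure_sums :: "('k, 'm) ring_scheme \<Rightarrow> ('k, 'v, 'n) module_scheme
    \<Rightarrow> ('k, 'w, 'p) module_scheme \<Rightarrow> nat \<Rightarrow> ('v \<times> 'w \<Rightarrow> 'k) set set" where
  "pure_sums K V W 0 = {\<zero>\<^bsub>tensor K V W\<^esub>}"
| "pure_sums K V W (Suc n) = {pure_tensor K V W v w \<oplus>\<^bsub>tensor K V W\<^esub> X | v w X.
    v \<in> carrier V \<and> w \<in> carrier W \<and> X \<in> pure_sums K V W n}"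

lemma pure_sums_closed:
  assumes "vectorspace K V" "vectorspace K W"
  shows "pure_sums K V W n \<subseteq> carrier (tensor K V W)"
proof -
  interpret T: vectorspace K "tensor K V W" by (rule tensor_vs[OF assms])
  show ?thesis by (induction n) (auto intro!: pure_closed assms)
qed

lemma pure_sums_SucI:
  "\<lbrakk>v \<in> carrier V; w \<in> carrier W; X \<in> pure_sums K V W n\<rbrakk>
    \<Longrightarrow> pure_tensor K V W v w \<oplus>\<^bsub>tensor K V W\<^esub> X \<in> pure_sums K V W (Suc n)"
  by auto

lemma pure_sums_add:
  assumes "vectorspace K V" "vectorspace K W"
  shows "\<lbrakk>X \<in> pure_sums K V W n; Y \<in> pure_sums K V W m\<rbrakk>
    \<Longrightarrow> X \<oplus>\<^bsub>tensor K V W\<^esub> Y \<in> pure_sums K V W (n + m)"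
proof (induction n arbitrary: X)
  case 0
  interpret T: vectorspace K "tensor K V W" by (rule tensor_vs[OF assms])
  have "Y \<in> carrier (tensor K V W)" using 0 pure_sums_closed[OF assms] by blast
  then show ?case using 0 by simp
next
  case (Suc n)
  interpret T: vectorspace K "tensor K V W" by (rule tensor_vs[OF assms])
  obtain v w Z where Z: "v \<in> carrier V" "w \<in> carrier W" "Z \<in> pure_sums K V W n"
    "X = pure_tensor K V W v w \<oplus>\<^bsub>tensor K V W\<^esub> Z" using Suc.prems by auto
  have "Z \<in> carrier (tensor K V W)" "Y \<in> carrier (tensor K V W)"
    using Z(3) Suc.prems(2) pure_sums_closed[OF assms] by blast+
  then have "X \<oplus>\<^bsub>tensor K V W\<^esub> Y = pure_tensor K V W v w \<oplus>\<^bsub>tensor K V W\<^esub> (Z \<oplus>\<^bsub>tensor K V W\<^esub> Y)"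
    using Z pure_closed[OF assms] by (simp add: T.M.a_assoc)
  then show ?case using pure_sums_SucI[OF Z(1,2) Suc.IH[OF Z(3) Suc.prems(2)]] by simp
qed

lemma tensor_pure_sums:
  assumes "vectorspace K V" "vectorspace K W" "X \<in> carrier (tensor K V W)"
  shows "\<exists>n. X \<in> pure_sums K V W n"
  using assms
proof (induction rule: tensor_induct)
  case (pure v w)
  interpret T: vectorspace K "tensor K V W" by (rule tensor_vs[OF assms(1,2)])
  have "pure_tensor K V W v w \<oplus>\<^bsub>tensor K V W\<^esub> \<zero>\<^bsub>tensor K V W\<^esub> \<in> pure_sums K V W (Suc 0)"
    using pure by auto
  then have "pure_tensor K V W v w \<in> pure_sums K V W (Suc 0)"
    unfolding T.M.r_zero[OF pure_closed[OF assms(1,2) pure]] .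
  then show ?case by blast
next
  case (add X Y)
  then show ?case using pure_sums_add[OF assms(1,2)] by blast
qed

text \<open>The partial evaluation \<open>f \<otimes> id : V \<otimes> W \<rightarrow> W\<close> of a functional \<open>f\<close>\<close>

lemma eval_bilin:
  assumes "lin K V (scalars K) f" "vectorspace K W"
  shows "bilin K V W W (\<lambda>v w. f v \<odot>\<^bsub>W\<^esub> w)"
  by (intro bilinI lin_smult_const lin_smult_var lin_id assms(1))
    (use assms lin_vs(1)[OF assms(1)] lin_closed[OF assms(1)] in auto)

text \<open>A sum of pure tensors keeps its length if \<open>v\<^sub>i\<close> is replaced by \<open>v\<^sub>i + c f(v\<^sub>i) u\<close>.\<close>

lemma pure_sums_shift:
  assumes f: "lin K V (scalars K) f" and W: "vectorspace K W"
    and u: "u \<in> carrier V" and c: "c \<in> carrier K"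
  shows "X \<in> pure_sums K V W n \<Longrightarrow>
    pure_tensor K V W u (c \<odot>\<^bsub>W\<^esub> tensor_lift K V W W (\<lambda>v w. f v \<odot>\<^bsub>W\<^esub> w) X) \<oplus>\<^bsub>tensor K V W\<^esub> X
      \<in> pure_sums K V W n"
proof (induction n arbitrary: X)
  case 0
  have V: "vectorspace K V" by (rule lin_vs[OF f])
  interpret W: vectorspace K W by fact
  interpret T: vectorspace K "tensor K V W" by (rule tensor_vs[OF V W])
  show ?case
    using 0 lin_zero[OF lift_lin[OF eval_bilin[OF f W]]] c
      lin_zero[OF bilin_lin1[OF pure_bilin[OF V W] u]] by simp
next
  case (Suc n)
  have V: "vectorspace K V" by (rule lin_vs[OF f])
  interpret V: vectorspace K V by fact
  interpret W: vectorspace K W by fact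
  interpret T: vectorspace K "tensor K V W" by (rule tensor_vs[OF V W])
  note p = pure_bilin[OF V W] and e = eval_bilin[OF f W]
  let ?p = "pure_tensor K V W" and ?e = "tensor_lift K V W W (\<lambda>v w. f v \<odot>\<^bsub>W\<^esub> w)"
  obtain v w Z where Z: "v \<in> carrier V" "w \<in> carrier W" "Z \<in> pure_sums K V W n"
    "X = ?p v w \<oplus>\<^bsub>tensor K V W\<^esub> Z" using Suc.prems by auto
  have Zc: "Z \<in> carrier (tensor K V W)" using Z(3) pure_sums_closed[OF V W] by blast
  have fv: "f v \<in> carrier K" using lin_closed[OF f Z(1)] by simp
  have eZ: "?e Z \<in> carrier W" by (rule lift_closed[OF e Zc])
  have pc: "?p x y \<in> carrier (tensor K V W)" if "x \<in> carrier V" "y \<in> carrier W" for x y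
    using pure_closed[OF V W] that .
  have "?e X = f v \<odot>\<^bsub>W\<^esub> w \<oplus>\<^bsub>W\<^esub> ?e Z"
    using lin_add[OF lift_lin[OF e] pc[OF Z(1,2)] Zc] lift_pure[OF e Z(1,2)] Z(4) by simp
  then have "?p u (c \<odot>\<^bsub>W\<^esub> ?e X) = ?p u ((c \<otimes>\<^bsub>K\<^esub> f v) \<odot>\<^bsub>W\<^esub> w \<oplus>\<^bsub>W\<^esub> c \<odot>\<^bsub>W\<^esub> ?e Z)"
    using c fv eZ Z(2) by (simp add: W.smult_r_distr W.smult_assoc1)
  also have "\<dots> = ?p u ((c \<otimes>\<^bsub>K\<^esub> f v) \<odot>\<^bsub>W\<^esub> w) \<oplus>\<^bsub>tensor K V W\<^esub> ?p u (c \<odot>\<^bsub>W\<^esub> ?e Z)"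
    using c fv eZ Z(2) by (intro lin_add[OF bilin_lin1[OF p u]]) auto
  also have "?p u ((c \<otimes>\<^bsub>K\<^esub> f v) \<odot>\<^bsub>W\<^esub> w) = ?p ((c \<otimes>\<^bsub>K\<^esub> f v) \<odot>\<^bsub>V\<^esub> u) w"
    using c fv u Z(2) lin_smult[OF bilin_lin1[OF p u]] lin_smult[OF bilin_lin2[OF p Z(2)]] by simp
  finally have "?p u (c \<odot>\<^bsub>W\<^esub> ?e X) \<oplus>\<^bsub>tensor K V W\<^esub> X
      = (?p ((c \<otimes>\<^bsub>K\<^esub> f v) \<odot>\<^bsub>V\<^esub> u) w \<oplus>\<^bsub>tensor K V W\<^esub> ?p v w)
        \<oplus>\<^bsub>tensor K V W\<^esub> (?p u (c \<odot>\<^bsub>W\<^esub> ?e Z) \<oplus>\<^bsub>tensor K V W\<^esub> Z)"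
    using pc c fv u Z eZ Zc by (simp add: T.M.a_ac)
  also have "?p ((c \<otimes>\<^bsub>K\<^esub> f v) \<odot>\<^bsub>V\<^esub> u) w \<oplus>\<^bsub>tensor K V W\<^esub> ?p v w
      = ?p ((c \<otimes>\<^bsub>K\<^esub> f v) \<odot>\<^bsub>V\<^esub> u \<oplus>\<^bsub>V\<^esub> v) w"
    using c fv u Z lin_add[OF bilin_lin2[OF p Z(2)]] by simp
  finally show ?case
    using pure_sums_SucI[OF _ Z(2) Suc.IH[OF Z(3)], of "(c \<otimes>\<^bsub>K\<^esub> f v) \<odot>\<^bsub>V\<^esub> u \<oplus>\<^bsub>V\<^esub> v"] c fv u Z(1)
    by simp
qed

text \<open>An element of \<open>V \<otimes> W\<close> is zero if \<open>f \<otimes> id\<close> kills it for all \<open>f\<close> in a family of functionals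
  that separates the points of \<open>V\<close>: in a sum of pure tensors \<open>v\<^sub>i \<otimes> w\<^sub>i\<close>, a functional with
  \<open>f v\<^sub>n \<noteq> 0\<close> expresses \<open>w\<^sub>n\<close> by the other \<open>w\<^sub>i\<close>, which shortens the sum.\<close>

lemma tensor_separation_zero:
  assumes V: "vectorspace K V" and W: "vectorspace K W"
    and F: "\<And>f. f \<in> F \<Longrightarrow> lin K V (scalars K) f"
    and sep: "\<And>v. \<lbrakk>v \<in> carrier V; \<And>f. f \<in> F \<Longrightarrow> f v = \<zero>\<^bsub>K\<^esub>\<rbrakk> \<Longrightarrow> v = \<zero>\<^bsub>V\<^esub>"
  shows "\<lbrakk>X \<in> pure_sums K V W n;
      \<And>f. f \<in> F \<Longrightarrow> tensor_lift K V W W (\<lambda>v w. f v \<odot>\<^bsub>W\<^esub> w) X = \<zero>\<^bsub>W\<^esub>\<rbrakk>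
    \<Longrightarrow> X = \<zero>\<^bsub>tensor K V W\<^esub>"
proof (induction n arbitrary: X)
  case 0
  then show ?case by simp
next
  case (Suc n)
  interpret V: vectorspace K V by fact
  interpret W: vectorspace K W by fact
  interpret T: vectorspace K "tensor K V W" by (rule tensor_vs[OF V W])
  note p = pure_bilin[OF V W]
  let ?p = "pure_tensor K V W" and ?e = "\<lambda>f. tensor_lift K V W W (\<lambda>v w. f v \<odot>\<^bsub>W\<^esub> w)"
  obtain v w Z where Z: "v \<in> carrier V" "w \<in> carrier W" "Z \<in> pure_sums K V W n"
    "X = ?p v w \<oplus>\<^bsub>tensor K V W\<^esub> Z" using Suc.prems(1) by auto
  have Zc: "Z \<in> carrier (tensor K V W)" using Z(3) pure_sums_closed[OF V W] by blast
  have "X \<in> pure_sums K V W n"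
  proof (cases "v = \<zero>\<^bsub>V\<^esub>")
    case True
    then have "?p v w = \<zero>\<^bsub>tensor K V W\<^esub>" using lin_zero[OF bilin_lin2[OF p Z(2)]] by simp
    then show ?thesis using Z Zc by simp
  next
    case False
    then obtain f where f: "f \<in> F" "f v \<noteq> \<zero>\<^bsub>K\<^esub>" using sep[OF Z(1)] by blast
    note fl = F[OF f(1)] and e = eval_bilin[OF F[OF f(1)] W]
    have fv: "f v \<in> carrier K" using lin_closed[OF fl Z(1)] by simp
    have eZ: "?e f Z \<in> carrier W" by (rule lift_closed[OF e Zc])
    define d where "d = inv\<^bsub>K\<^esub> f v"
    have d: "d \<in> carrier K" "d \<otimes>\<^bsub>K\<^esub> f v = \<one>\<^bsub>K\<^esub>"
      using V.field_Units fv f(2) by (auto simp: d_def)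
    have "f v \<odot>\<^bsub>W\<^esub> w \<oplus>\<^bsub>W\<^esub> ?e f Z = \<zero>\<^bsub>W\<^esub>"
      using Suc.prems(2)[OF f(1)] lin_add[OF lift_lin[OF e] pure_closed[OF V W Z(1,2)] Zc]
        lift_pure[OF e Z(1,2)] Z(4) by simp
    then have "f v \<odot>\<^bsub>W\<^esub> w = \<ominus>\<^bsub>W\<^esub> ?e f Z"
      using fv Z(2) eZ by (metis W.M.minus_equality W.smult_closed)
    then have "d \<odot>\<^bsub>W\<^esub> (f v \<odot>\<^bsub>W\<^esub> w) = (\<ominus>\<^bsub>K\<^esub> d) \<odot>\<^bsub>W\<^esub> ?e f Z"
      using d(1) eZ by (simp add: W.smult_l_minus W.smult_r_minus)
    then have "w = (\<ominus>\<^bsub>K\<^esub> d) \<odot>\<^bsub>W\<^esub> ?e f Z"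
      using d fv Z(2) by (simp add: W.smult_assoc1[symmetric])
    then show ?thesis
      using pure_sums_shift[OF fl W Z(1) _ Z(3), of "\<ominus>\<^bsub>K\<^esub> d"] d(1) Z(4) by simp
  qed
  then show ?case using Suc.IH Suc.prems(2) by blast
qed

text \<open>Consequently two elements of \<open>V \<otimes> W\<close> are equal if they have the same image under \<open>f \<otimes> id\<close> for
  all \<open>f\<close> in the separating family.\<close>

lemma tensor_separation:
  assumes V: "vectorspace K V" and W: "vectorspace K W"
    and F: "\<And>f. f \<in> F \<Longrightarrow> lin K V (scalars K) f"
    and sep: "\<And>v. \<lbrakk>v \<in> carrier V; \<And>f. f \<in> F \<Longrightarrow> f v = \<zero>\<^bsub>K\<^esub>\<rbrakk> \<Longrightarrow> v = \<zero>\<^bsub>V\<^esub>"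
    and XY: "X \<in> carrier (tensor K V W)" "Y \<in> carrier (tensor K V W)"
    and eq: "\<And>f. f \<in> F \<Longrightarrow> tensor_lift K V W W (\<lambda>v w. f v \<odot>\<^bsub>W\<^esub> w) X
      = tensor_lift K V W W (\<lambda>v w. f v \<odot>\<^bsub>W\<^esub> w) Y"
  shows "X = Y"
proof -
  interpret W: vectorspace K W by fact
  interpret T: vectorspace K "tensor K V W" by (rule tensor_vs[OF V W])
  have XY': "X \<ominus>\<^bsub>tensor K V W\<^esub> Y \<in> carrier (tensor K V W)" using XY by simp
  have "tensor_lift K V W W (\<lambda>v w. f v \<odot>\<^bsub>W\<^esub> w) (X \<ominus>\<^bsub>tensor K V W\<^esub> Y) = \<zero>\<^bsub>W\<^esub>" if "f \<in> F" for f
    using lift_closed[OF eval_bilin[OF F[OF that] W] XY(2)]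
    by (simp add: lin_minus[OF lift_lin[OF eval_bilin[OF F[OF that] W]] XY] eq[OF that]
        W.M.minus_eq W.M.r_neg)
  moreover obtain n where "X \<ominus>\<^bsub>tensor K V W\<^esub> Y \<in> pure_sums K V W n"
    using tensor_pure_sums[OF V W XY'] by blast
  ultimately have "X \<ominus>\<^bsub>tensor K V W\<^esub> Y = \<zero>\<^bsub>tensor K V W\<^esub>"
    using tensor_separation_zero[OF V W F sep] by blast
  then show ?thesis by (rule T.M.minus_zero_eq[OF _ XY])
qed

section \<open>Algebras and tensor products of algebras\<close>

lemma alg_vs: "nonunital_algebra K B \<Longrightarrow> vectorspace K B"
  by (simp add: nonunital_algebra_def)

lemma lin_mult1:
  assumes "nonunital_algebra K B" "lin K V B f" "b \<in> carrier B"
  shows "lin K V B (\<lambda>x. f x \<otimes>\<^bsub>B\<^esub> b)"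
proof -
  interpret B: nonunital_algebra K B by fact
  show ?thesis
    using lin_vs[OF assms(2)] lin_closed[OF assms(2)] assms(3)
    by (intro linI) (auto simp: lin_add[OF assms(2)] lin_smult[OF assms(2)]
        B.mult_closed B.mult_add_left B.mult_smult_left)
qed

lemma lin_mult2:
  assumes "nonunital_algebra K B" "lin K V B f" "b \<in> carrier B"
  shows "lin K V B (\<lambda>x. b \<otimes>\<^bsub>B\<^esub> f x)"
proof -
  interpret B: nonunital_algebra K B by fact
  show ?thesis
    using lin_vs[OF assms(2)] lin_closed[OF assms(2)] assms(3)
    by (intro linI) (auto simp: lin_add[OF assms(2)] lin_smult[OF assms(2)]
        B.mult_closed B.mult_add_right B.mult_smult_right)
qed

lemma lin_scal1:
  "\<lbrakk>lin K V (scalars K) s; c \<in> carrier K\<rbrakk> \<Longrightarrow> lin K V (scalars K) (\<lambda>x. s x \<otimes>\<^bsub>K\<^esub> c)"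
  using lin_smult_var[of K V s "scalars K" c] lin_vs(2)[of K V "scalars K" s] by simp

lemma lin_scal2:
  "\<lbrakk>lin K V (scalars K) s; c \<in> carrier K\<rbrakk> \<Longrightarrow> lin K V (scalars K) (\<lambda>x. c \<otimes>\<^bsub>K\<^esub> s x)"
  using lin_smult_const[of K V "scalars K" s c] by simp

lemma lift_comp_lin:
  "\<lbrakk>lin K U (tensor K V W) F; bilin K V W Z b\<rbrakk> \<Longrightarrow> lin K U Z (\<lambda>u. tensor_lift K V W Z b (F u))"
  by (rule lin_comp[OF lift_lin])

text \<open>Rewriting with these rules settles most questions of (bi)linearity and of membership.\<close>

lemmas lin_rules = lin_id lin_mult1 lin_mult2 lin_scal1 lin_scal2 lin_smult_const lin_smult_var
  pure_lin1 pure_lin2 lift_param_lin lift_comp_lin bilinI tensor_vs lift_closed pure_closed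

text \<open>A factor can be moved into a lift.\<close>

lemma lift_mult_right:
  "\<lbrakk>nonunital_algebra K B; bilin K V W B b; X \<in> carrier (tensor K V W); z \<in> carrier B\<rbrakk>
    \<Longrightarrow> tensor_lift K V W B b X \<otimes>\<^bsub>B\<^esub> z = tensor_lift K V W B (\<lambda>v w. b v w \<otimes>\<^bsub>B\<^esub> z) X"
  by (rule lin_lift[of K B B "\<lambda>x. x \<otimes>\<^bsub>B\<^esub> z"]) (simp_all add: lin_mult1 lin_id alg_vs)

lemma lift_mult_left:
  "\<lbrakk>nonunital_algebra K B; bilin K V W B b; X \<in> carrier (tensor K V W); z \<in> carrier B\<rbrakk>
    \<Longrightarrow> z \<otimes>\<^bsub>B\<^esub> tensor_lift K V W B b X = tensor_lift K V W B (\<lambda>v w. z \<otimes>\<^bsub>B\<^esub> b v w) X"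
  by (rule lin_lift[of K B B "\<lambda>x. z \<otimes>\<^bsub>B\<^esub> x"]) (simp_all add: lin_mult2 lin_id alg_vs)

lemma lift_smult_left:
  "\<lbrakk>bilin K V W Z b; X \<in> carrier (tensor K V W); c \<in> carrier K\<rbrakk>
    \<Longrightarrow> c \<odot>\<^bsub>Z\<^esub> tensor_lift K V W Z b X = tensor_lift K V W Z (\<lambda>v w. c \<odot>\<^bsub>Z\<^esub> b v w) X"
  by (rule lin_lift[of K Z Z "\<lambda>x. c \<odot>\<^bsub>Z\<^esub> x"]) (simp_all add: lin_smult_const lin_id bilin_vs(3))

lemma lift_smult_right:
  "\<lbrakk>bilin K V W (scalars K) s; X \<in> carrier (tensor K V W); vectorspace K Z; z \<in> carrier Z\<rbrakk>
    \<Longrightarrow> tensor_lift K V W (scalars K) s X \<odot>\<^bsub>Z\<^esub> z = tensor_lift K V W Z (\<lambda>v w. s v w \<odot>\<^bsub>Z\<^esub> z) X"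
  by (rule lin_lift[of K "scalars K" Z "\<lambda>x. x \<odot>\<^bsub>Z\<^esub> z"])
    (simp_all add: lin_smult_var lin_id scalars_vs[OF vs_field])

lemma lift_scal_left:
  "\<lbrakk>bilin K V W (scalars K) b; X \<in> carrier (tensor K V W); c \<in> carrier K\<rbrakk> \<Longrightarrow>
    c \<otimes>\<^bsub>K\<^esub> tensor_lift K V W (scalars K) b X = tensor_lift K V W (scalars K) (\<lambda>v w. c \<otimes>\<^bsub>K\<^esub> b v w) X"
  using lift_smult_left[of K V W "scalars K"] by simp

lemma lift_scal_right:
  "\<lbrakk>bilin K V W (scalars K) b; X \<in> carrier (tensor K V W); c \<in> carrier K\<rbrakk> \<Longrightarrow>
    tensor_lift K V W (scalars K) b X \<otimes>\<^bsub>K\<^esub> c = tensor_lift K V W (scalars K) (\<lambda>v w. b v w \<otimes>\<^bsub>K\<^esub> c) X"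
  using lift_smult_right[of K V W b X "scalars K"] bilin_vs(3)[of K V W "scalars K" b] by simp

lemmas lift_push = lift_mult_right lift_mult_left lift_smult_left lift_smult_right lift_scal_left
  lift_scal_right

lemma lift_closed_scalars:
  "\<lbrakk>bilin K V W (scalars K) b; X \<in> carrier (tensor K V W)\<rbrakk>
    \<Longrightarrow> tensor_lift K V W (scalars K) b X \<in> carrier K"
  using lift_closed[of K V W "scalars K"] by simp

text \<open>Lifts along an associativity isomorphism\<close>

lemma lift_bilin_right:
  assumes vs: "vectorspace K U" "vectorspace K V" "vectorspace K W"
    and t1: "\<And>w. w \<in> carrier W \<Longrightarrow> bilin K U V Z (\<lambda>u v. t u v w)"
    and t2: "\<And>u. u \<in> carrier U \<Longrightarrow> bilin K V W Z (\<lambda>v w. t u v w)"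
  shows "bilin K U (tensor K V W) Z (\<lambda>u Y. tensor_lift K V W Z (\<lambda>v w. t u v w) Y)"
proof (rule bilinI[OF vs(1) tensor_vs[OF vs(2,3)]])
  show "lin K (tensor K V W) Z (\<lambda>Y. tensor_lift K V W Z (t u) Y)" if "u \<in> carrier U" for u
    by (rule lift_lin[OF t2[OF that]])
  show "lin K U Z (\<lambda>u. tensor_lift K V W Z (t u) Y)" if Y: "Y \<in> carrier (tensor K V W)" for Y
    by (rule lift_param_lin[OF vs(1) Y t2]) (assumption, rule bilin_lin2[OF t1])
qed

lemma lift_bilin_left:
  assumes vs: "vectorspace K U" "vectorspace K V" "vectorspace K W"
    and t1: "\<And>w. w \<in> carrier W \<Longrightarrow> bilin K U V Z (\<lambda>u v. t u v w)"
    and t2: "\<And>u. u \<in> carrier U \<Longrightarrow> bilin K V W Z (\<lambda>v w. t u v w)"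
  shows "bilin K (tensor K U V) W Z (\<lambda>Y w. tensor_lift K U V Z (\<lambda>u v. t u v w) Y)"
proof (rule bilinI[OF tensor_vs[OF vs(1,2)] vs(3)])
  show "lin K (tensor K U V) Z (\<lambda>Y. tensor_lift K U V Z (\<lambda>u v. t u v w) Y)"
    if "w \<in> carrier W" for w by (rule lift_lin[OF t1[OF that]])
  show "lin K W Z (\<lambda>w. tensor_lift K U V Z (\<lambda>u v. t u v w) Y)"
    if Y: "Y \<in> carrier (tensor K U V)" for Y
    by (rule lift_param_lin[OF vs(3) Y t1]) (assumption, rule bilin_lin1[OF t2])
qed

lemma lift_assoc:
  assumes vs: "vectorspace K U" "vectorspace K V" "vectorspace K W"
    and X: "X \<in> carrier (tensor K (tensor K U V) W)"
    and t1: "\<And>w. w \<in> carrier W \<Longrightarrow> bilin K U V Z (\<lambda>u v. t u v w)"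
    and t2: "\<And>u. u \<in> carrier U \<Longrightarrow> bilin K V W Z (\<lambda>v w. t u v w)"
  shows "tensor_lift K U (tensor K V W) Z (\<lambda>u Y. tensor_lift K V W Z (\<lambda>v w. t u v w) Y)
      (tensor_assoc K U V W X)
    = tensor_lift K (tensor K U V) W Z (\<lambda>Y w. tensor_lift K U V Z (\<lambda>u v. t u v w) Y) X"
proof -
  have b: "bilin K U (tensor K V W) Z (\<lambda>u Y. tensor_lift K V W Z (\<lambda>v w. t u v w) Y)"
    by (rule lift_bilin_right[OF vs t1 t2])
  show ?thesis
    unfolding lift_tensor_assoc[OF vs b X] by (intro lift_cong refl) (simp add: lift_pure[OF t2])
qed

text \<open>The product on \<^const>\<open>tensor\<close> is defined by lifts with values in \<^const>\<open>tensor_space\<close>, which has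
  the same linear structure.\<close>

lemma tensor_lift_space:
  fixes K :: "('a, 'm) ring_scheme" and V :: "('a, 'd, 'n) module_scheme"
    and W :: "('a, 'e, 'p) module_scheme"
  shows "tensor_lift K V W (tensor_space K V' W') = tensor_lift K V W (tensor K V' W')"
proof
  have "module_hom K X (tensor_space K V' W') = module_hom K X (tensor K V' W')"
    for X :: "('a, ('d \<times> 'e \<Rightarrow> 'a) set) module"
    by (simp only: module_hom_def tensor_simps(1-4))
  then show "tensor_lift K V W (tensor_space K V' W') b = tensor_lift K V W (tensor K V' W') b" for b
    unfolding tensor_lift_def by presburger
qed

context
  fixes K :: "('k, 'm) ring_scheme" and V :: "('k, 'v, 'n) module_scheme"
    and W :: "('k, 'w, 'p) module_scheme"
  assumes V: "nonunital_algebra K V" and W: "nonunital_algebra K W"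
begin

interpretation V: nonunital_algebra K V by (rule V)
interpretation W: nonunital_algebra K W by (rule W)

lemma tensor_mult_eq:
  "X \<otimes>\<^bsub>tensor K V W\<^esub> Y = tensor_lift K V W (tensor K V W) (\<lambda>v w.
     tensor_lift K V W (tensor K V W)
       (\<lambda>v' w'. pure_tensor K V W (v \<otimes>\<^bsub>V\<^esub> v') (w \<otimes>\<^bsub>W\<^esub> w')) Y) X"
  unfolding tensor_lift_space[symmetric] by (simp add: tensor_def Let_def)

lemma tensor_mult_inner:
  "\<lbrakk>bilin K V W Z b; v \<in> carrier V; w \<in> carrier W\<rbrakk>
    \<Longrightarrow> bilin K V W Z (\<lambda>v' w'. b (v \<otimes>\<^bsub>V\<^esub> v') (w \<otimes>\<^bsub>W\<^esub> w'))"
  by (rule bilin_compose[of K V W Z b, OF _ lin_mult2[OF V lin_id[OF alg_vs[OF V]]]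
        lin_mult2[OF W lin_id[OF alg_vs[OF W]]]])

lemma tensor_mult_inner':
  "\<lbrakk>bilin K V W Z b; v \<in> carrier V; w \<in> carrier W\<rbrakk>
    \<Longrightarrow> bilin K V W Z (\<lambda>v' w'. b (v' \<otimes>\<^bsub>V\<^esub> v) (w' \<otimes>\<^bsub>W\<^esub> w))"
  by (rule bilin_compose[of K V W Z b, OF _ lin_mult1[OF V lin_id[OF alg_vs[OF V]]]
        lin_mult1[OF W lin_id[OF alg_vs[OF W]]]])

lemma tensor_mult_outer:
  "\<lbrakk>bilin K V W Z b; Y \<in> carrier (tensor K V W)\<rbrakk> \<Longrightarrow> bilin K V W Z
    (\<lambda>v w. tensor_lift K V W Z (\<lambda>v' w'. b (v \<otimes>\<^bsub>V\<^esub> v') (w \<otimes>\<^bsub>W\<^esub> w')) Y)"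
  by (rule lift_param_bilin[OF _ alg_vs[OF V] alg_vs[OF W] tensor_mult_inner tensor_mult_inner'])

lemma tensor_mult_closed:
  "\<lbrakk>X \<in> carrier (tensor K V W); Y \<in> carrier (tensor K V W)\<rbrakk>
    \<Longrightarrow> X \<otimes>\<^bsub>tensor K V W\<^esub> Y \<in> carrier (tensor K V W)"
  unfolding tensor_mult_eq
  by (rule lift_closed[OF tensor_mult_outer[OF pure_bilin[OF alg_vs[OF V] alg_vs[OF W]]]])

lemma lift_tensor_mult:
  assumes b: "bilin K V W Z b" and X: "X \<in> carrier (tensor K V W)"
    and Y: "Y \<in> carrier (tensor K V W)"
  shows "tensor_lift K V W Z b (X \<otimes>\<^bsub>tensor K V W\<^esub> Y) = tensor_lift K V W Z
    (\<lambda>v w. tensor_lift K V W Z (\<lambda>v' w'. b (v \<otimes>\<^bsub>V\<^esub> v') (w \<otimes>\<^bsub>W\<^esub> w')) Y) X"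
proof -
  note p = pure_bilin[OF alg_vs[OF V] alg_vs[OF W]]
  have "tensor_lift K V W Z b (tensor_lift K V W (tensor K V W)
        (\<lambda>v' w'. pure_tensor K V W (v \<otimes>\<^bsub>V\<^esub> v') (w \<otimes>\<^bsub>W\<^esub> w')) Y)
      = tensor_lift K V W Z (\<lambda>v' w'. b (v \<otimes>\<^bsub>V\<^esub> v') (w \<otimes>\<^bsub>W\<^esub> w')) Y"
    if "v \<in> carrier V" "w \<in> carrier W" for v w
    unfolding lin_lift[OF lift_lin[OF b] tensor_mult_inner[OF p that] Y]
    by (rule lift_cong) (simp_all add: lift_pure[OF b] V.mult_closed W.mult_closed that)
  then show ?thesis
    unfolding tensor_mult_eq lin_lift[OF lift_lin[OF b] tensor_mult_outer[OF p Y] X]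
    by (rule lift_cong) simp_all
qed

lemma tensor_mult_pure1:
  assumes "v \<in> carrier V" "w \<in> carrier W" "Y \<in> carrier (tensor K V W)"
  shows "pure_tensor K V W v w \<otimes>\<^bsub>tensor K V W\<^esub> Y = tensor_lift K V W (tensor K V W)
       (\<lambda>v' w'. pure_tensor K V W (v \<otimes>\<^bsub>V\<^esub> v') (w \<otimes>\<^bsub>W\<^esub> w')) Y"
  unfolding tensor_mult_eq
  by (rule lift_pure[OF tensor_mult_outer[OF pure_bilin[OF alg_vs[OF V] alg_vs[OF W]]]]) fact+

lemma tensor_mult_pure:
  assumes "v \<in> carrier V" "w \<in> carrier W" "v' \<in> carrier V" "w' \<in> carrier W"
  shows "pure_tensor K V W v w \<otimes>\<^bsub>tensor K V W\<^esub> pure_tensor K V W v' w'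
    = pure_tensor K V W (v \<otimes>\<^bsub>V\<^esub> v') (w \<otimes>\<^bsub>W\<^esub> w')"
  unfolding tensor_mult_pure1[OF assms(1,2) pure_closed[OF alg_vs[OF V] alg_vs[OF W] assms(3,4)]]
  by (rule lift_pure[OF tensor_mult_inner[OF pure_bilin[OF alg_vs[OF V] alg_vs[OF W]] assms(1,2)]
        assms(3,4)])

lemma tensor_mult_bilin:
  "bilin K (tensor K V W) (tensor K V W) (tensor K V W) (\<lambda>X Y. X \<otimes>\<^bsub>tensor K V W\<^esub> Y)"
proof (rule bilinI)
  let ?T = "tensor K V W"
  note vs = alg_vs[OF V] alg_vs[OF W]
  note p = pure_bilin[OF vs]
  show T: "vectorspace K ?T" "vectorspace K ?T" by (rule tensor_vs[OF vs])+
  show "lin K ?T ?T (\<lambda>X. X \<otimes>\<^bsub>?T\<^esub> Y)" if "Y \<in> carrier ?T" for Y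
    unfolding tensor_mult_eq by (rule lift_lin[OF tensor_mult_outer[OF p that]])
  show "lin K ?T ?T (\<lambda>Y. X \<otimes>\<^bsub>?T\<^esub> Y)" if "X \<in> carrier ?T" for X
    unfolding tensor_mult_eq
    by (rule lift_param_lin[OF T(1) that tensor_mult_outer[OF p]])
      (assumption, rule lift_lin[OF tensor_mult_inner[OF p]])
qed

lemma tensor_algebra: "nonunital_algebra K (tensor K V W)"
proof -
  let ?T = "tensor K V W" and ?p = "pure_tensor K V W"
  note vs = alg_vs[OF V] alg_vs[OF W]
  note b = tensor_mult_bilin and p = pure_bilin[OF vs]
  note l1 = bilin_lin1[OF b] and l2 = bilin_lin2[OF b]
  have T: "vectorspace K ?T" by (rule tensor_vs[OF vs])
  have assoc: "(X \<otimes>\<^bsub>?T\<^esub> Y) \<otimes>\<^bsub>?T\<^esub> Z = X \<otimes>\<^bsub>?T\<^esub> (Y \<otimes>\<^bsub>?T\<^esub> Z)"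
    if X: "X \<in> carrier ?T" and Y: "Y \<in> carrier ?T" and Z: "Z \<in> carrier ?T" for X Y Z
  proof -
    have 1: "(?p a b \<otimes>\<^bsub>?T\<^esub> ?p c d) \<otimes>\<^bsub>?T\<^esub> Z = ?p a b \<otimes>\<^bsub>?T\<^esub> (?p c d \<otimes>\<^bsub>?T\<^esub> Z)"
      if "a \<in> carrier V" "b \<in> carrier W" "c \<in> carrier V" "d \<in> carrier W" for a b c d
    proof (rule tensor_ext[OF l1 lin_comp[OF l1 l1] vs Z])
      show "(?p a b \<otimes>\<^bsub>?T\<^esub> ?p c d) \<otimes>\<^bsub>?T\<^esub> ?p v w = ?p a b \<otimes>\<^bsub>?T\<^esub> (?p c d \<otimes>\<^bsub>?T\<^esub> ?p v w)"
        if "v \<in> carrier V" "w \<in> carrier W" for v w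
        using that \<open>a \<in> _\<close> \<open>b \<in> _\<close> \<open>c \<in> _\<close> \<open>d \<in> _\<close>
        by (simp add: tensor_mult_pure V.mult_closed W.mult_closed V.mult_assoc W.mult_assoc)
    qed (use that in \<open>auto intro!: tensor_mult_closed pure_closed vs\<close>)
    have 2: "(?p a b \<otimes>\<^bsub>?T\<^esub> Y) \<otimes>\<^bsub>?T\<^esub> Z = ?p a b \<otimes>\<^bsub>?T\<^esub> (Y \<otimes>\<^bsub>?T\<^esub> Z)"
      if "a \<in> carrier V" "b \<in> carrier W" for a b
    proof -
      have pc: "?p a b \<in> carrier ?T" using that by (intro pure_closed vs)
      show ?thesis
        by (rule tensor_ext[OF lin_comp[OF l2[OF Z] l1[OF pc]] lin_comp[OF l1[OF pc] l2[OF Z]] vs Y])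
          (rule 1[OF that])
    qed
    show ?thesis
      by (rule tensor_ext[OF lin_comp[OF l2[OF Z] l2[OF Y]] l2[OF tensor_mult_closed[OF Y Z]] vs X])
        (rule 2)
  qed
  show ?thesis
  proof (rule nonunital_algebra.intro[OF T], rule nonunital_algebra_axioms.intro)
    fix X Y Z assume X: "X \<in> carrier ?T" and Y: "Y \<in> carrier ?T"
    show "X \<otimes>\<^bsub>?T\<^esub> Y \<in> carrier ?T" by (rule tensor_mult_closed[OF X Y])
    assume Z: "Z \<in> carrier ?T"
    show "X \<otimes>\<^bsub>?T\<^esub> Y \<otimes>\<^bsub>?T\<^esub> Z = X \<otimes>\<^bsub>?T\<^esub> (Y \<otimes>\<^bsub>?T\<^esub> Z)" by (rule assoc[OF X Y Z])
    show "(X \<oplus>\<^bsub>?T\<^esub> Y) \<otimes>\<^bsub>?T\<^esub> Z = X \<otimes>\<^bsub>?T\<^esub> Z \<oplus>\<^bsub>?T\<^esub> Y \<otimes>\<^bsub>?T\<^esub> Z"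
      by (rule lin_add[OF l2[OF Z] X Y])
    show "X \<otimes>\<^bsub>?T\<^esub> (Y \<oplus>\<^bsub>?T\<^esub> Z) = X \<otimes>\<^bsub>?T\<^esub> Y \<oplus>\<^bsub>?T\<^esub> X \<otimes>\<^bsub>?T\<^esub> Z"
      by (rule lin_add[OF l1[OF X] Y Z])
  next
    fix c X Y assume c: "c \<in> carrier K" and X: "X \<in> carrier ?T" and Y: "Y \<in> carrier ?T"
    show "c \<odot>\<^bsub>?T\<^esub> X \<otimes>\<^bsub>?T\<^esub> Y = c \<odot>\<^bsub>?T\<^esub> (X \<otimes>\<^bsub>?T\<^esub> Y)"
      by (rule lin_smult[OF l2[OF Y] c X])
    show "X \<otimes>\<^bsub>?T\<^esub> (c \<odot>\<^bsub>?T\<^esub> Y) = c \<odot>\<^bsub>?T\<^esub> (X \<otimes>\<^bsub>?T\<^esub> Y)"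
      by (rule lin_smult[OF l1[OF X] c Y])
  qed
qed

end

lemma tensor_space_cong:
  assumes "carrier V = carrier V'" "add V = add V'" "smult V = smult V'"
    and "carrier W = carrier W'" "add W = add W'" "smult W = smult W'"
  shows "tensor_space K V W = tensor_space K V' W'" "pure_tensor K V W = pure_tensor K V' W'"
    "tensor_lift K V W Z b = tensor_lift K V' W' Z b"
proof -
  have "tensor_relators K V W = tensor_relators K V' W'"
    unfolding tensor_relators_def assms by simp
  then have n: "tensor_null K V W = tensor_null K V' W'"
    by (simp add: tensor_null_def assms)
  then show s: "tensor_space K V W = tensor_space K V' W'"
    by (simp add: tensor_space_def assms)
  show p: "pure_tensor K V W = pure_tensor K V' W'"
    by (intro ext) (simp add: pure_tensor_def n assms)
  show "tensor_lift K V W Z b = tensor_lift K V' W' Z b"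
    by (simp add: tensor_lift_def s p assms)
qed

section \<open>Sweedler calculus in a Hopf algebra\<close>

text \<open>For a bilinear \<open>b\<close>, the term \<open>tensor_lift K H H Z b (comult H h)\<close> stands for \<open>b(h\<^sub>1, h\<^sub>2)\<close>.\<close>

context hopf_algebra
begin

lemma vsH [simp]: "vectorspace K H"
  by (rule vectorspace_axioms)

lemma vsK [simp]: "vectorspace K (scalars K)"
  by (rule scalars_vs[OF field_axioms])

lemma algH [simp]: "nonunital_algebra K H"
  by (rule nonunital_algebra_axioms)

lemma vsHH [simp]: "vectorspace K (tensor K H H)"
  by (simp add: tensor_vs)

lemma comult_lin: "lin K H (tensor K H H) (comult H)"
  by (simp add: lin_def comult_linear)

lemma comult_closed [simp]: "h \<in> carrier H \<Longrightarrow> comult H h \<in> carrier (tensor K H H)"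
  by (rule lin_closed[OF comult_lin])

lemma counit_lin: "lin K H (scalars K) (counit H)"
  by (simp add: lin_def counit_linear)

lemma counit_closed [simp]: "h \<in> carrier H \<Longrightarrow> counit H h \<in> carrier K"
  using lin_closed[OF counit_lin] by simp

lemma antipode_lin: "lin K H H (antipode H)"
  by (simp add: lin_def antipode_linear)

lemma antipode_closed [simp]: "h \<in> carrier H \<Longrightarrow> antipode H h \<in> carrier H"
  by (rule lin_closed[OF antipode_lin])

lemma counit_mult: "\<lbrakk>x \<in> carrier H; y \<in> carrier H\<rbrakk> \<Longrightarrow> counit H (x \<otimes> y) = counit H x \<otimes>\<^bsub>K\<^esub> counit H y"
  and counit_one: "counit H \<one> = \<one>\<^bsub>K\<^esub>"
  by (rule ring_hom_mult[OF counit_ring_hom], assumption+) (rule ring_hom_one[OF counit_ring_hom])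

lemma comult_mult: "\<lbrakk>x \<in> carrier H; y \<in> carrier H\<rbrakk>
    \<Longrightarrow> comult H (x \<otimes> y) = comult H x \<otimes>\<^bsub>tensor K H H\<^esub> comult H y"
  and comult_one: "comult H \<one> = pure_tensor K H H \<one> \<one>"
  by (rule ring_hom_mult[OF comult_ring_hom], assumption+)
    (rule ring_hom_one[OF comult_ring_hom, unfolded tensor_one])

lemma sw_mult: "\<lbrakk>bilin K H H Z b; x \<in> carrier H; y \<in> carrier H\<rbrakk>
  \<Longrightarrow> tensor_lift K H H Z b (comult H (x \<otimes> y)) = tensor_lift K H H Z
    (\<lambda>v w. tensor_lift K H H Z (\<lambda>v' w'. b (v \<otimes> v') (w \<otimes> w')) (comult H y)) (comult H x)"
  unfolding comult_mult by (rule lift_tensor_mult) simp_all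

lemma sw_one: "bilin K H H Z b \<Longrightarrow> tensor_lift K H H Z b (comult H \<one>) = b \<one> \<one>"
  by (simp add: comult_one lift_pure unit_closed)

text \<open>\<open>h\<^sub>1\<^sub>1 \<otimes> h\<^sub>1\<^sub>2 \<otimes> h\<^sub>2 = h\<^sub>1 \<otimes> h\<^sub>2\<^sub>1 \<otimes> h\<^sub>2\<^sub>2\<close>, applied to a trilinear map\<close>

lemma sw_coassoc:
  assumes h: "h \<in> carrier H"
    and t1: "\<And>w. w \<in> carrier H \<Longrightarrow> bilin K H H Z (\<lambda>u v. t u v w)"
    and t2: "\<And>u. u \<in> carrier H \<Longrightarrow> bilin K H H Z (\<lambda>v w. t u v w)"
  shows "tensor_lift K H H Z (\<lambda>x w. tensor_lift K H H Z (\<lambda>u v. t u v w) (comult H x)) (comult H h)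
    = tensor_lift K H H Z (\<lambda>u x. tensor_lift K H H Z (\<lambda>v w. t u v w) (comult H x)) (comult H h)"
proof -
  let ?HH = "tensor K H H"
  have b1: "bilin K ?HH H Z (\<lambda>Y w. tensor_lift K H H Z (\<lambda>u v. t u v w) Y)"
    by (rule lift_bilin_left[OF vsH vsH vsH t1 t2])
  have b2: "bilin K H ?HH Z (\<lambda>u Y. tensor_lift K H H Z (\<lambda>v w. t u v w) Y)"
    by (rule lift_bilin_right[OF vsH vsH vsH t1 t2])
  let ?X = "tensor_map K H H ?HH H (comult H) id (comult H h)"
  have i: "lin K H H id" using lin_id[OF vsH] by (simp add: id_def)
  have X: "?X \<in> carrier (tensor K ?HH H)"
    by (rule lin_closed[OF tensor_map_lin[OF comult_lin i] comult_closed[OF h]])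
  have "tensor_lift K H ?HH Z (\<lambda>u Y. tensor_lift K H H Z (\<lambda>v w. t u v w) Y) (tensor_assoc K H H H ?X)
      = tensor_lift K H H Z (\<lambda>x w. tensor_lift K H H Z (\<lambda>u v. t u v w) (comult H x)) (comult H h)"
    using lift_assoc[OF vsH vsH vsH X, of Z t] t1 t2
      lift_tensor_map[OF comult_lin i b1 comult_closed[OF h]] by simp
  moreover have "tensor_lift K H ?HH Z (\<lambda>u Y. tensor_lift K H H Z (\<lambda>v w. t u v w) Y)
      (tensor_map K H H H ?HH id (comult H) (comult H h))
      = tensor_lift K H H Z (\<lambda>u x. tensor_lift K H H Z (\<lambda>v w. t u v w) (comult H x)) (comult H h)"
    unfolding lift_tensor_map[OF i comult_lin b2 comult_closed[OF h]] by simp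
  ultimately show ?thesis by (simp only: coassoc[OF h])
qed

text \<open>\<open>\<epsilon>(h\<^sub>1) \<phi>(h\<^sub>2) = \<phi>(h) = \<epsilon>(h\<^sub>2) \<phi>(h\<^sub>1)\<close>\<close>

lemma sw_counit1:
  assumes "lin K H Z \<phi>" "h \<in> carrier H"
  shows "tensor_lift K H H Z (\<lambda>x y. counit H x \<odot>\<^bsub>Z\<^esub> \<phi> y) (comult H h) = \<phi> h"
proof -
  have b: "bilin K H H H (\<lambda>x y. counit H x \<odot> y)" by (rule eval_bilin[OF counit_lin vsH])
  have "\<phi> h = tensor_lift K H H Z (\<lambda>x y. \<phi> (counit H x \<odot> y)) (comult H h)"
    using lin_lift[OF assms(1) b comult_closed[OF assms(2)]] counit_left[OF assms(2)] by simp
  also have "\<dots> = tensor_lift K H H Z (\<lambda>x y. counit H x \<odot>\<^bsub>Z\<^esub> \<phi> y) (comult H h)"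
    by (rule lift_cong) (simp_all add: lin_smult[OF assms(1)])
  finally show ?thesis by simp
qed

lemma sw_counit2:
  assumes "lin K H Z \<phi>" "h \<in> carrier H"
  shows "tensor_lift K H H Z (\<lambda>x y. counit H y \<odot>\<^bsub>Z\<^esub> \<phi> x) (comult H h) = \<phi> h"
proof -
  have b: "bilin K H H H (\<lambda>x y. counit H y \<odot> x)"
    by (intro bilinI vsH lin_smult_var lin_smult_const lin_id counit_lin counit_closed)
  have "\<phi> h = tensor_lift K H H Z (\<lambda>x y. \<phi> (counit H y \<odot> x)) (comult H h)"
    using lin_lift[OF assms(1) b comult_closed[OF assms(2)]] counit_right[OF assms(2)] by simp
  also have "\<dots> = tensor_lift K H H Z (\<lambda>x y. counit H y \<odot>\<^bsub>Z\<^esub> \<phi> x) (comult H h)"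
    by (rule lift_cong) (simp_all add: lin_smult[OF assms(1)])
  finally show ?thesis by simp
qed

subsection \<open>The antipode\<close>

text \<open>These rules let \<open>simp\<close> prove that terms are linear in one variable, bilinear, or members of a
  carrier.\<close>

lemmas hopf_lin [simp] = lin_comp[OF comult_lin] lin_comp[OF counit_lin] lin_comp[OF antipode_lin]
  comult_lin counit_lin antipode_lin
lemmas [simp] = lin_rules mult_closed unit_closed

text \<open>If \<open>p(y\<^sub>1) y\<^sub>2 = q(y)\<close> for all \<open>y\<close>, then \<open>p(y) = q(y\<^sub>1) S(y\<^sub>2)\<close>.\<close>

lemma right_cancel:
  assumes p: "lin K H H p" and q: "\<And>y. y \<in> carrier H \<Longrightarrow>
      tensor_lift K H H H (\<lambda>y1 y2. p y1 \<otimes> y2) (comult H y) = q y"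
    and y: "y \<in> carrier H"
  shows "p y = tensor_lift K H H H (\<lambda>y1 y2. q y1 \<otimes> antipode H y2) (comult H y)"
proof -
  note [simp] = lin_comp[OF p] lin_closed[OF p] p
  have "tensor_lift K H H H (\<lambda>y1 y2. q y1 \<otimes> antipode H y2) (comult H y)
    = tensor_lift K H H H (\<lambda>y1 y2. tensor_lift K H H H (\<lambda>u v. p u \<otimes> v) (comult H y1)
        \<otimes> antipode H y2) (comult H y)"
    by (intro lift_cong refl) (simp add: q)
  also have "\<dots> = tensor_lift K H H H (\<lambda>y1 y2. tensor_lift K H H H
        (\<lambda>u v. p u \<otimes> (v \<otimes> antipode H y2)) (comult H y1)) (comult H y)"
    by (simp add: lift_push mult_assoc cong: lift_cong)
  also have "\<dots> = tensor_lift K H H H (\<lambda>u y1. tensor_lift K H H H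
        (\<lambda>v w. p u \<otimes> (v \<otimes> antipode H w)) (comult H y1)) (comult H y)"
    by (rule sw_coassoc) (simp_all add: y)
  also have "\<dots> = tensor_lift K H H H (\<lambda>u y1. counit H y1 \<odot> p u) (comult H y)"
    by (simp add: lift_mult_left[symmetric] antipode_right mult_smult_right unit_right
        cong: lift_cong)
  also have "\<dots> = p y" by (rule sw_counit2[OF p y])
  finally show ?thesis by simp
qed

text \<open>The antipode reverses products. Both steps cancel a factor on the right: from
  \<open>S(x\<^sub>1y\<^sub>1)x\<^sub>2y\<^sub>2 = \<epsilon>(x)\<epsilon>(y)1\<close> one gets \<open>S(x\<^sub>1y)x\<^sub>2 = \<epsilon>(x)S(y)\<close>, and then \<open>S(xy) = S(y)S(x)\<close>.\<close>

lemma antipode_mult_aux: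
  assumes x: "x \<in> carrier H" and y: "y \<in> carrier H"
  shows "tensor_lift K H H H (\<lambda>x1 x2. antipode H (x1 \<otimes> y) \<otimes> x2) (comult H x)
    = counit H x \<odot> antipode H y"
proof -
  let ?p = "\<lambda>y. tensor_lift K H H H (\<lambda>x1 x2. antipode H (x1 \<otimes> y) \<otimes> x2) (comult H x)"
  have "?p y = tensor_lift K H H H
      (\<lambda>y1 y2. ((counit H x \<otimes>\<^bsub>K\<^esub> counit H y1) \<odot> \<one>) \<otimes> antipode H y2) (comult H y)"
  proof (rule right_cancel[OF _ _ y])
    show "lin K H H ?p" using x by simp
    fix y assume y: "y \<in> carrier H"
    have "tensor_lift K H H H (\<lambda>y1 y2. ?p y1 \<otimes> y2) (comult H y)
      = tensor_lift K H H H (\<lambda>y1 y2. tensor_lift K H H H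
          (\<lambda>x1 x2. antipode H (x1 \<otimes> y1) \<otimes> (x2 \<otimes> y2)) (comult H x)) (comult H y)"
      using x by (simp add: lift_push mult_assoc cong: lift_cong)
    also have "\<dots> = tensor_lift K H H H (\<lambda>x1 x2. tensor_lift K H H H
          (\<lambda>y1 y2. antipode H (x1 \<otimes> y1) \<otimes> (x2 \<otimes> y2)) (comult H y)) (comult H x)"
      by (rule lift_swap) (simp_all add: x y)
    also have "\<dots> = tensor_lift K H H H (\<lambda>u v. antipode H u \<otimes> v) (comult H (x \<otimes> y))"
      by (rule sw_mult[symmetric]) (simp_all add: x y)
    also have "\<dots> = (counit H x \<otimes>\<^bsub>K\<^esub> counit H y) \<odot> \<one>"
      using x y by (simp add: antipode_left counit_mult)
    finally show "tensor_lift K H H H (\<lambda>y1 y2. ?p y1 \<otimes> y2) (comult H y)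
      = (counit H x \<otimes>\<^bsub>K\<^esub> counit H y) \<odot> \<one>" .
  qed
  also have "\<dots> = tensor_lift K H H H (\<lambda>y1 y2. counit H y1 \<odot> (counit H x \<odot> antipode H y2)) (comult H y)"
    using x by (simp add: mult_smult_left unit_left smult_assoc1[symmetric] m_comm cong: lift_cong)
  also have "\<dots> = counit H x \<odot> antipode H y"
    by (rule sw_counit1[OF _ y]) (simp add: x)
  finally show ?thesis .
qed

lemma antipode_mult:
  assumes x: "x \<in> carrier H" and y: "y \<in> carrier H"
  shows "antipode H (x \<otimes> y) = antipode H y \<otimes> antipode H x"
proof -
  have "antipode H (x \<otimes> y)
    = tensor_lift K H H H (\<lambda>x1 x2. (counit H x1 \<odot> antipode H y) \<otimes> antipode H x2) (comult H x)"
    by (rule right_cancel[OF _ antipode_mult_aux[OF _ y] x]) (simp_all add: y)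
  also have "\<dots> = tensor_lift K H H H (\<lambda>x1 x2. counit H x1 \<odot> (antipode H y \<otimes> antipode H x2)) (comult H x)"
    using y by (simp add: mult_smult_left cong: lift_cong)
  also have "\<dots> = antipode H y \<otimes> antipode H x"
    by (rule sw_counit1[OF _ x]) (simp add: y)
  finally show ?thesis .
qed

end

section \<open>Subspaces of finite codimension\<close>

lemma basis_coords:
  assumes V: "vectorspace K V" and fd: "vectorspace.fin_dim K V"
  shows "\<exists>B c. finite B \<and> B \<subseteq> carrier V \<and> (\<forall>b\<in>B. lin K V (scalars K) (c b)) \<and>
    (\<forall>v\<in>carrier V. (\<Oplus>\<^bsub>V\<^esub>b\<in>B. c b v \<odot>\<^bsub>V\<^esub> b) = v)"
proof -
  interpret V: vectorspace K V by fact
  obtain B where B: "finite B" "V.basis B" using V.finite_basis_exists[OF fd] by blast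
  have BV: "B \<subseteq> carrier V" using B(2) by (simp add: V.basis_def)
  define r where "r v = (THE a. a \<in> B \<rightarrow>\<^sub>E carrier K \<and> V.lincomb a B = v)" for v
  have ex1: "\<exists>!a. a \<in> B \<rightarrow>\<^sub>E carrier K \<and> V.lincomb a B = v" if "v \<in> carrier V" for v
    using V.basis_criterion[OF B(1) BV] B(2) that by blast
  have r: "r v \<in> B \<rightarrow>\<^sub>E carrier K" "V.lincomb (r v) B = v" if "v \<in> carrier V" for v
    using theI'[OF ex1[OF that]] unfolding r_def by blast+
  have rb: "r v b \<in> carrier K" if "v \<in> carrier V" "b \<in> B" for v b
    using r(1)[OF that(1)] that(2) by auto
  have eq: "r v = a" if "v \<in> carrier V" "a \<in> B \<rightarrow>\<^sub>E carrier K" "V.lincomb a B = v" for v a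
    using ex1[OF that(1)] r[OF that(1)] that by blast
  have "lin K V (scalars K) (\<lambda>v. r v b)" if b: "b \<in> B" for b
  proof (rule linI[OF V scalars_vs[OF V.field_axioms]])
    fix x y assume x: "x \<in> carrier V" and y: "y \<in> carrier V"
    have "V.lincomb (\<lambda>b. r x b \<oplus>\<^bsub>K\<^esub> r y b) B = x \<oplus>\<^bsub>V\<^esub> y"
      using V.lincomb_sum[OF B(1) BV, of "r x" "r y"] r x y by auto
    moreover have "V.lincomb (\<lambda>b\<in>B. r x b \<oplus>\<^bsub>K\<^esub> r y b) B = V.lincomb (\<lambda>b. r x b \<oplus>\<^bsub>K\<^esub> r y b) B"
      using rb[OF x] rb[OF y] by (intro V.lincomb_cong BV) auto
    ultimately have "r (x \<oplus>\<^bsub>V\<^esub> y) = (\<lambda>b\<in>B. r x b \<oplus>\<^bsub>K\<^esub> r y b)"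
      using x y rb[OF x] rb[OF y] by (intro eq) auto
    then show "r (x \<oplus>\<^bsub>V\<^esub> y) b = r x b \<oplus>\<^bsub>scalars K\<^esub> r y b" using b by simp
  next
    fix k x assume k: "k \<in> carrier K" and x: "x \<in> carrier V"
    have "V.lincomb (\<lambda>b. k \<otimes>\<^bsub>K\<^esub> r x b) B = k \<odot>\<^bsub>V\<^esub> x"
      using V.lincomb_smult[OF BV _ k, of "r x"] r x by auto
    moreover have "V.lincomb (\<lambda>b\<in>B. k \<otimes>\<^bsub>K\<^esub> r x b) B = V.lincomb (\<lambda>b. k \<otimes>\<^bsub>K\<^esub> r x b) B"
      using rb[OF x] k by (intro V.lincomb_cong BV) auto
    ultimately have "r (k \<odot>\<^bsub>V\<^esub> x) = (\<lambda>b\<in>B. k \<otimes>\<^bsub>K\<^esub> r x b)"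
      using x k rb[OF x] by (intro eq) auto
    then show "r (k \<odot>\<^bsub>V\<^esub> x) b = k \<odot>\<^bsub>scalars K\<^esub> r x b" using b by simp
  qed (use rb b in auto)
  then show ?thesis
    using B(1) BV r(2)
    by (intro exI[of _ B] exI[of _ "\<lambda>b v. r v b"]) (auto simp: V.lincomb_def)
qed

lemma lin_finsum:
  assumes "lin K V W f" "finite B" "\<And>b. b \<in> B \<Longrightarrow> g b \<in> carrier V"
  shows "f (\<Oplus>\<^bsub>V\<^esub>b\<in>B. g b) = (\<Oplus>\<^bsub>W\<^esub>b\<in>B. f (g b))"
  using assms(2,3)
proof (induction B rule: finite_induct)
  case empty
  interpret V: vectorspace K V by (rule lin_vs[OF assms(1)])
  interpret W: vectorspace K W by (rule lin_vs[OF assms(1)])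
  show ?case using lin_zero[OF assms(1)] by simp
next
  case (insert b B)
  interpret V: vectorspace K V by (rule lin_vs[OF assms(1)])
  interpret W: vectorspace K W by (rule lin_vs[OF assms(1)])
  have g: "g \<in> B \<rightarrow> carrier V" and fg: "(\<lambda>b. f (g b)) \<in> B \<rightarrow> carrier W"
    using insert.prems lin_closed[OF assms(1)] by auto
  have "f (\<Oplus>\<^bsub>V\<^esub>b\<in>insert b B. g b) = f (g b \<oplus>\<^bsub>V\<^esub> (\<Oplus>\<^bsub>V\<^esub>b\<in>B. g b))"
    using insert.hyps g insert.prems[of b] by simp
  also have "\<dots> = f (g b) \<oplus>\<^bsub>W\<^esub> f (\<Oplus>\<^bsub>V\<^esub>b\<in>B. g b)"
    using g insert.prems[of b] by (intro lin_add[OF assms(1)]) simp_all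
  also have "f (\<Oplus>\<^bsub>V\<^esub>b\<in>B. g b) = (\<Oplus>\<^bsub>W\<^esub>b\<in>B. f (g b))"
    using insert.IH insert.prems by simp
  also have "f (g b) \<oplus>\<^bsub>W\<^esub> (\<Oplus>\<^bsub>W\<^esub>b\<in>B. f (g b)) = (\<Oplus>\<^bsub>W\<^esub>b\<in>insert b B. f (g b))"
    using insert.hyps fg insert.prems[of b] lin_closed[OF assms(1)] by simp
  finally show ?case .
qed

text \<open>Coordinates modulo a subspace \<open>U\<close> of finite codimension: functionals \<open>c\<^sub>b\<close> that vanish on \<open>U\<close>
  and vectors \<open>r\<^sub>b\<close> with \<open>v - \<Sum>c\<^sub>b(v) r\<^sub>b \<in> U\<close>\<close>

lemma quot_coords:
  fixes V :: "('k, 'v, 'n) module_scheme"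
  assumes U: "subspace K U V" and fd: "vectorspace.fin_dim K (quot_space V U)"
  shows "\<exists>(B :: 'v set set) c r. finite B \<and> (\<forall>b\<in>B. lin K V (scalars K) (c b) \<and> r b \<in> carrier V \<and>
      (\<forall>u\<in>U. c b u = \<zero>\<^bsub>K\<^esub>)) \<and> (\<forall>v\<in>carrier V. v \<ominus>\<^bsub>V\<^esub> (\<Oplus>\<^bsub>V\<^esub>b\<in>B. c b v \<odot>\<^bsub>V\<^esub> r b) \<in> U)"
proof -
  interpret V: vectorspace K V by (rule subspaceD(1)[OF U])
  let ?Q = "quot_space V U" and ?\<pi> = "\<lambda>x. U +>\<^bsub>V\<^esub> x"
  note p = quot_proj[OF U]
  interpret Q: vectorspace K ?Q by (rule lin_vs[OF p])
  obtain B c where "finite B \<and> B \<subseteq> carrier ?Q \<and> (\<forall>b\<in>B. lin K ?Q (scalars K) (c b)) \<and>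
      (\<forall>q\<in>carrier ?Q. (\<Oplus>\<^bsub>?Q\<^esub>b\<in>B. c b q \<odot>\<^bsub>?Q\<^esub> b) = q)"
    using basis_coords[OF lin_vs(2)[OF p] fd] by (elim exE)
  then have B: "finite B" "B \<subseteq> carrier ?Q" "\<And>b. b \<in> B \<Longrightarrow> lin K ?Q (scalars K) (c b)"
      "\<And>q. q \<in> carrier ?Q \<Longrightarrow> (\<Oplus>\<^bsub>?Q\<^esub>b\<in>B. c b q \<odot>\<^bsub>?Q\<^esub> b) = q"
    by simp_all
  have "\<exists>x\<in>carrier V. ?\<pi> x = b" if "b \<in> B" for b
    using that B(2) by (auto simp: quot_carrier[OF U])
  then obtain r where r: "\<And>b. b \<in> B \<Longrightarrow> r b \<in> carrier V" "\<And>b. b \<in> B \<Longrightarrow> ?\<pi> (r b) = b" by metis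
  have cl: "lin K V (scalars K) (\<lambda>v. c b (?\<pi> v))" if "b \<in> B" for b
    by (rule lin_comp[OF B(3)[OF that] p])
  have cc: "c b (?\<pi> v) \<in> carrier K" if "b \<in> B" "v \<in> carrier V" for b v
    using lin_closed[OF cl[OF that(1)] that(2)] by simp
  have "c b (?\<pi> u) = \<zero>\<^bsub>K\<^esub>" if "b \<in> B" "u \<in> U" for b u
  proof -
    have u: "u \<in> carrier V" using that(2) subspaceD(2)[OF U] by auto
    have "?\<pi> u = ?\<pi> \<zero>\<^bsub>V\<^esub>"
      using that(2) u subspaceD(3,4)[OF U] subspace_neg[OF U] by (simp add: quot_eq_iff[OF U] V.M.minus_eq)
    then show ?thesis using lin_zero[OF cl[OF that(1)]] by simp
  qed
  moreover have "v \<ominus>\<^bsub>V\<^esub> (\<Oplus>\<^bsub>V\<^esub>b\<in>B. c b (?\<pi> v) \<odot>\<^bsub>V\<^esub> r b) \<in> U" if v: "v \<in> carrier V" for v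
  proof -
    have t: "c b (?\<pi> v) \<odot>\<^bsub>V\<^esub> r b \<in> carrier V" if "b \<in> B" for b using cc r that v by simp
    have "?\<pi> (\<Oplus>\<^bsub>V\<^esub>b\<in>B. c b (?\<pi> v) \<odot>\<^bsub>V\<^esub> r b) = (\<Oplus>\<^bsub>?Q\<^esub>b\<in>B. ?\<pi> (c b (?\<pi> v) \<odot>\<^bsub>V\<^esub> r b))"
      by (rule lin_finsum[OF p B(1) t])
    also have "\<dots> = (\<Oplus>\<^bsub>?Q\<^esub>b\<in>B. c b (?\<pi> v) \<odot>\<^bsub>?Q\<^esub> b)"
      by (rule Q.M.finsum_cong')
        (use B(2) cc v r lin_smult[OF p] in \<open>auto intro!: Q.smult_closed\<close>)
    also have "\<dots> = ?\<pi> v" by (rule B(4)[OF lin_closed[OF p v]])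
    finally show ?thesis using v t by (subst quot_eq_iff[OF U, symmetric]) auto
  qed
  ultimately show ?thesis
    using B(1) cl r(1) by (intro exI[of _ B] exI[of _ "\<lambda>b v. c b (?\<pi> v)"] exI[of _ r]) auto
qed

text \<open>The common kernel of finitely many functionals and the span of a suitable finite set \<open>E\<close> together
  make up the whole space.\<close>

lemma common_kernel_cofinite:
  assumes V: "vectorspace K V" and "finite Q"
  shows "(\<And>q. q \<in> Q \<Longrightarrow> lin K V (scalars K) q) \<Longrightarrow> \<exists>E. finite E \<and> E \<subseteq> carrier V \<and>
    (\<forall>v\<in>carrier V. \<exists>x\<in>module.span K V E. \<forall>q\<in>Q. q (v \<ominus>\<^bsub>V\<^esub> x) = \<zero>\<^bsub>K\<^esub>)"
  using assms(2)
proof (induction Q rule: finite_induct)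
  case empty
  have "\<zero>\<^bsub>V\<^esub> \<in> module.span K V {}" using subspaceD(3)[OF span_subspace(1)[OF V]] by auto
  then show ?case by auto
next
  case (insert q Q)
  interpret V: vectorspace K V by fact
  have q: "lin K V (scalars K) q" and Q: "\<And>p. p \<in> Q \<Longrightarrow> lin K V (scalars K) p"
    using insert.prems by auto
  have lc: "p v \<in> carrier K" if "p \<in> insert q Q" "v \<in> carrier V" for p v
    using lin_closed[OF insert.prems[OF that(1)] that(2)] by simp
  obtain E where E: "finite E" "E \<subseteq> carrier V"
      "\<And>v. v \<in> carrier V \<Longrightarrow> \<exists>x\<in>V.span E. \<forall>q\<in>Q. q (v \<ominus>\<^bsub>V\<^esub> x) = \<zero>\<^bsub>K\<^esub>"
    using insert.IH[OF Q] by blast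
  have sE: "V.span E \<subseteq> carrier V" by (rule subspaceD(2)[OF span_subspace(1)[OF V E(2)]])
  show ?case
  proof (cases "\<exists>e\<in>carrier V. (\<forall>p\<in>Q. p e = \<zero>\<^bsub>K\<^esub>) \<and> q e \<noteq> \<zero>\<^bsub>K\<^esub>")
    case False
    \<comment> \<open>\<open>q\<close> vanishes wherever all of \<open>Q\<close> does\<close>
    have "\<exists>x\<in>V.span E. \<forall>p\<in>insert q Q. p (v \<ominus>\<^bsub>V\<^esub> x) = \<zero>\<^bsub>K\<^esub>" if v: "v \<in> carrier V" for v
    proof -
      obtain x where x: "x \<in> V.span E" "\<forall>q\<in>Q. q (v \<ominus>\<^bsub>V\<^esub> x) = \<zero>\<^bsub>K\<^esub>" using E(3)[OF v] by blast
      then have "v \<ominus>\<^bsub>V\<^esub> x \<in> carrier V" using v sE by blast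
      then show ?thesis using False x by blast
    qed
    then show ?thesis using E(1,2) by blast
  next
    case True
    then obtain e where e: "e \<in> carrier V" "\<And>p. p \<in> Q \<Longrightarrow> p e = \<zero>\<^bsub>K\<^esub>" "q e \<noteq> \<zero>\<^bsub>K\<^esub>" by blast
    have E': "insert e E \<subseteq> carrier V" using E(2) e(1) by simp
    note S = subspaceD[OF span_subspace(1)[OF V E']]
    have "\<exists>x\<in>V.span (insert e E). \<forall>p\<in>insert q Q. p (v \<ominus>\<^bsub>V\<^esub> x) = \<zero>\<^bsub>K\<^esub>" if v: "v \<in> carrier V" for v
    proof -
      obtain x where x: "x \<in> V.span E" "\<And>p. p \<in> Q \<Longrightarrow> p (v \<ominus>\<^bsub>V\<^esub> x) = \<zero>\<^bsub>K\<^esub>" using E(3)[OF v] by blast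
      have xc: "x \<in> carrier V" using x sE by auto
      \<comment> \<open>subtracting \<open>t e\<close> kills the value of \<open>q\<close> and leaves those of \<open>Q\<close> unchanged\<close>
      define t where "t = q (v \<ominus>\<^bsub>V\<^esub> x) \<otimes>\<^bsub>K\<^esub> inv\<^bsub>K\<^esub> q e"
      have qe: "q e \<in> Units K" using lc[of q e] e by (simp add: V.field_Units)
      have t: "t \<in> carrier K" "t \<otimes>\<^bsub>K\<^esub> q e = q (v \<ominus>\<^bsub>V\<^esub> x)"
        using lc[of q "v \<ominus>\<^bsub>V\<^esub> x"] qe v xc lc[of q e] e(1) by (auto simp: t_def V.R.m_assoc)
      have "x \<in> V.span (insert e E)" using x(1) V.span_is_monotone[of E "insert e E"] by auto
      moreover have "e \<in> V.span (insert e E)" using span_subspace(2)[OF V E'] by simp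
      ultimately have "x \<oplus>\<^bsub>V\<^esub> t \<odot>\<^bsub>V\<^esub> e \<in> V.span (insert e E)" using S(4,5) t(1) by blast
      moreover have "p (v \<ominus>\<^bsub>V\<^esub> (x \<oplus>\<^bsub>V\<^esub> t \<odot>\<^bsub>V\<^esub> e)) = \<zero>\<^bsub>K\<^esub>" if p: "p \<in> insert q Q" for p
      proof -
        have "v \<ominus>\<^bsub>V\<^esub> (x \<oplus>\<^bsub>V\<^esub> t \<odot>\<^bsub>V\<^esub> e) = (v \<ominus>\<^bsub>V\<^esub> x) \<ominus>\<^bsub>V\<^esub> t \<odot>\<^bsub>V\<^esub> e"
          using v xc t(1) e(1) by (simp add: V.M.minus_eq V.M.minus_add V.M.a_assoc)
        then have "p (v \<ominus>\<^bsub>V\<^esub> (x \<oplus>\<^bsub>V\<^esub> t \<odot>\<^bsub>V\<^esub> e)) = p (v \<ominus>\<^bsub>V\<^esub> x) \<ominus>\<^bsub>scalars K\<^esub> t \<otimes>\<^bsub>K\<^esub> p e"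
          using v xc t(1) e(1) lin_minus[OF insert.prems[OF p]] lin_smult[OF insert.prems[OF p]]
          by simp
        also have "\<dots> = \<zero>\<^bsub>K\<^esub>"
        proof -
          interpret S: vectorspace K "scalars K" by (rule scalars_vs[OF V.field_axioms])
          show ?thesis
          proof (cases "p = q")
            case True
            then show ?thesis using t(2) lc[OF p, of "v \<ominus>\<^bsub>V\<^esub> x"] v xc S.M.r_neg[of "q (v \<ominus>\<^bsub>V\<^esub> x)"]
              by (simp add: S.M.minus_eq)
          next
            case False
            then have "p \<in> Q" using p by simp
            then have "p (v \<ominus>\<^bsub>V\<^esub> x) = \<zero>\<^bsub>K\<^esub>" "t \<otimes>\<^bsub>K\<^esub> p e = \<zero>\<^bsub>K\<^esub>"
              using x(2)[of p] e(2)[of p] t(1) by auto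
            then show ?thesis using S.M.r_neg[of "\<zero>\<^bsub>K\<^esub>"] by (simp add: S.M.minus_eq)
          qed
        qed
        finally show ?thesis .
      qed
      ultimately show ?thesis by blast
    qed
    then show ?thesis using E(1) E' by (intro exI[of _ "insert e E"]) auto
  qed
qed

lemma quot_fin_dim:
  assumes U: "subspace K U V" and E: "finite E" "E \<subseteq> carrier V"
    and span: "\<And>v. v \<in> carrier V \<Longrightarrow> \<exists>x\<in>module.span K V E. v \<ominus>\<^bsub>V\<^esub> x \<in> U"
  shows "vectorspace.fin_dim K (quot_space V U)"
proof -
  note p = quot_proj[OF U] and V = subspaceD(1)[OF U]
  interpret Q: vectorspace K "quot_space V U" by (rule lin_vs[OF p])
  let ?A = "(\<lambda>x. U +>\<^bsub>V\<^esub> x) ` E"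
  have A: "?A \<subseteq> carrier (quot_space V U)" using E(2) by (auto simp: quot_carrier[OF U])
  have sE: "module.span K V E \<subseteq> carrier V" by (rule subspaceD(2)[OF span_subspace(1)[OF V E(2)]])
  have "carrier (quot_space V U) \<subseteq> Q.span ?A"
  proof
    fix q assume "q \<in> carrier (quot_space V U)"
    then obtain v where v: "v \<in> carrier V" "q = U +>\<^bsub>V\<^esub> v" by (auto simp: quot_carrier[OF U])
    then obtain x where x: "x \<in> module.span K V E" "v \<ominus>\<^bsub>V\<^esub> x \<in> U" using span by blast
    then have "q = U +>\<^bsub>V\<^esub> x" using v sE quot_eq_iff[OF U v(1), of x] by auto
    then show "q \<in> Q.span ?A" using x(1) span_image[OF p E(2)] by auto
  qed
  then have "Q.span ?A = carrier (quot_space V U)" using Q.span_is_subset2[OF A] by auto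
  then show ?thesis using E(1) A unfolding Q.fin_dim_def by blast
qed

section \<open>The finite dual as a vector space\<close>

context hopf_algebra
begin

text \<open>The finite dual \<open>H\<^sup>0\<close>\<close>

abbreviation D where "D \<equiv> finite_dual K H"

lemma finite_dual_simps:
  "carrier D = finite_dual_carrier K H"
  "f \<oplus>\<^bsub>D\<^esub> g = (\<lambda>h\<in>carrier H. f h \<oplus>\<^bsub>K\<^esub> g h)"
  "c \<odot>\<^bsub>D\<^esub> f = (\<lambda>h\<in>carrier H. c \<otimes>\<^bsub>K\<^esub> f h)"
  "\<zero>\<^bsub>D\<^esub> = (\<lambda>h\<in>carrier H. \<zero>\<^bsub>K\<^esub>)"
  "f \<otimes>\<^bsub>D\<^esub> g = (\<lambda>h\<in>carrier H.
        tensor_lift K H H (scalars K) (\<lambda>x y. f x \<otimes>\<^bsub>K\<^esub> g y) (comult H h))"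
  "\<one>\<^bsub>D\<^esub> = (\<lambda>h\<in>carrier H. counit H h)"
  "counit D f = f \<one>"
  "antipode D f = (\<lambda>h\<in>carrier H. f (antipode H h))"
  by (simp_all add: finite_dual_def finite_dual_algebra_def Let_def module.defs hopf.defs
      R.func_space_def)

lemma ringH: "ring H"
proof (rule ringI)
  show "abelian_group H" by (rule M.abelian_group_axioms)
  show "Group.monoid H" by (rule monoidI) (simp_all add: mult_assoc unit_left unit_right)
qed (simp_all add: mult_add_left mult_add_right)

lemma ideal_subspace:
  assumes "ideal I H" shows "subspace K I H"
proof -
  interpret I: ideal I H by fact
  have Ic: "x \<in> carrier H" if "x \<in> I" for x using that by (rule I.a_Hcarr)
  show ?thesis
  proof (rule subspaceI[OF vsH])
    fix c x assume c: "c \<in> carrier K" and x: "x \<in> I"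
    have "(c \<odot> \<one>) \<otimes> x = c \<odot> x" using c Ic[OF x] by (simp add: mult_smult_left unit_left)
    then show "c \<odot> x \<in> I" using I.I_l_closed[OF x, of "c \<odot> \<one>"] c by simp
  qed (use Ic in \<open>auto intro: I.a_closed I.zero_closed\<close>)
qed

text \<open>Finitely many functionals \<open>q\<close> control a form \<open>\<beta>(h, k)\<close> on the right if \<open>\<beta>(h, k) = 0\<close> for all
  \<open>h\<close> as soon as \<open>q(k) = 0\<close> for all \<open>q\<close>. A linear functional \<open>f\<close> belongs to the finite dual if and only
  if the form \<open>f(hk)\<close> is controlled in this sense, and this is easier to verify than the
  existence of an ideal. The ideal in question is \<open>{x. f(HxH) = 0}\<close>.\<close>

definition controls :: "('h \<Rightarrow> 'k) set \<Rightarrow> ('h \<Rightarrow> 'h \<Rightarrow> 'k) \<Rightarrow> bool" where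
  "controls Q \<beta> \<longleftrightarrow> finite Q \<and> (\<forall>q\<in>Q. lin K H (scalars K) q) \<and>
    (\<forall>k\<in>carrier H. (\<forall>q\<in>Q. q k = \<zero>\<^bsub>K\<^esub>) \<longrightarrow> (\<forall>h\<in>carrier H. \<beta> h k = \<zero>\<^bsub>K\<^esub>))"

lemma finite_dual_controls:
  assumes I: "ideal I H" and fd: "vectorspace.fin_dim K (quot_space H I)"
    and f: "\<And>x. x \<in> I \<Longrightarrow> f x = \<zero>\<^bsub>K\<^esub>"
  shows "\<exists>Q. controls Q (\<lambda>h k. f (h \<otimes> k))"
proof -
  interpret I: ideal I H by fact
  obtain B :: "'h set set" and c r where Bc: "finite B \<and> (\<forall>b\<in>B. lin K H (scalars K) (c b) \<and> r b \<in> carrier H \<and>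
      (\<forall>u\<in>I. c b u = \<zero>\<^bsub>K\<^esub>)) \<and> (\<forall>v\<in>carrier H. v \<ominus> (\<Oplus>b\<in>B. c b v \<odot> r b) \<in> I)"
    using quot_coords[OF ideal_subspace[OF I] fd] by (elim exE)
  have "k \<in> I" if k: "k \<in> carrier H" and ck: "\<forall>q\<in>c ` B. q k = \<zero>\<^bsub>K\<^esub>" for k
  proof -
    have "(\<Oplus>b\<in>B. c b k \<odot> r b) = (\<Oplus>b\<in>B. \<zero>)"
      by (rule M.finsum_cong') (use Bc ck in auto)
    moreover have "k \<ominus> (\<Oplus>b\<in>B. c b k \<odot> r b) \<in> I" using Bc k by blast
    ultimately have "k \<ominus> \<zero> \<in> I" using k by simp
    then show ?thesis using k by (simp add: M.minus_eq)
  qed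
  then have "f (h \<otimes> k) = \<zero>\<^bsub>K\<^esub>"
    if "k \<in> carrier H" "\<forall>q\<in>c ` B. q k = \<zero>\<^bsub>K\<^esub>" "h \<in> carrier H" for h k
    using that by (intro f I.I_l_closed)
  then have "controls (c ` B) (\<lambda>h k. f (h \<otimes> k))"
    using Bc unfolding controls_def by blast
  then show ?thesis by blast
qed

lemma controls_finite_dual:
  assumes f: "lin K H (scalars K) f" and Q: "controls Q (\<lambda>h k. f (h \<otimes> k))"
  shows "\<exists>I. ideal I H \<and> vectorspace.fin_dim K (quot_space H I) \<and> (\<forall>x\<in>I. f x = \<zero>\<^bsub>K\<^esub>)"
proof -
  note [simp] = lin_comp[OF f] f lin_closed[OF f, simplified]
  have Qf: "finite Q" and Ql: "\<And>q. q \<in> Q \<Longrightarrow> lin K H (scalars K) q"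
    and Q0: "\<And>h k. \<lbrakk>k \<in> carrier H; \<And>q. q \<in> Q \<Longrightarrow> q k = \<zero>\<^bsub>K\<^esub>; h \<in> carrier H\<rbrakk> \<Longrightarrow> f (h \<otimes> k) = \<zero>\<^bsub>K\<^esub>"
    using Q unfolding controls_def by blast+
  define I where "I = {x \<in> carrier H. \<forall>a\<in>carrier H. \<forall>b\<in>carrier H. f (a \<otimes> (x \<otimes> b)) = \<zero>\<^bsub>K\<^esub>}"
  have lz1: "\<phi> (x \<oplus> y) = \<zero>\<^bsub>K\<^esub>"
    if "lin K H (scalars K) \<phi>" "x \<in> carrier H" "y \<in> carrier H" "\<phi> x = \<zero>\<^bsub>K\<^esub>" "\<phi> y = \<zero>\<^bsub>K\<^esub>" for \<phi> x y
    using lin_add[OF that(1-3)] that(4,5) by simp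
  have lz2: "\<phi> (c \<odot> x) = \<zero>\<^bsub>K\<^esub>"
    if "lin K H (scalars K) \<phi>" "x \<in> carrier H" "\<phi> x = \<zero>\<^bsub>K\<^esub>" "c \<in> carrier K" for \<phi> x c
    using lin_smult[OF that(1,4,2)] that(3,4) by simp
  have fl: "lin K H (scalars K) (\<lambda>x. f (a \<otimes> (x \<otimes> b)))" if "a \<in> carrier H" "b \<in> carrier H" for a b
    using that by simp
  have Is: "subspace K I H"
  proof (rule subspaceI[OF vsH])
    show "\<zero> \<in> I" using lin_zero[OF fl] by (simp add: I_def)
    show "x \<oplus> y \<in> I" if "x \<in> I" "y \<in> I" for x y
      using that lz1[OF fl] by (simp add: I_def)
    show "c \<odot> x \<in> I" if "c \<in> carrier K" "x \<in> I" for c x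
      using that lz2[OF fl] by (simp add: I_def)
  qed (auto simp: I_def)
  have "ideal I H"
  proof (rule idealI[OF ringH])
    show "subgroup I (add_monoid H)"
      by (rule M.add.subgroupI)
        (use subspaceD[OF Is] subspace_neg[OF Is] in \<open>auto simp: a_inv_def[symmetric]\<close>)
    fix x y assume x: "x \<in> I" and y: "y \<in> carrier H"
    have xc: "x \<in> carrier H" using x by (simp add: I_def)
    have x0: "f (a \<otimes> (x \<otimes> b)) = \<zero>\<^bsub>K\<^esub>" if "a \<in> carrier H" "b \<in> carrier H" for a b
      using x that by (simp add: I_def)
    have "f (a \<otimes> ((y \<otimes> x) \<otimes> b)) = f ((a \<otimes> y) \<otimes> (x \<otimes> b))"
        "f (a \<otimes> ((x \<otimes> y) \<otimes> b)) = f (a \<otimes> (x \<otimes> (y \<otimes> b)))" if "a \<in> carrier H" "b \<in> carrier H" for a b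
      using that xc y by (simp_all add: mult_assoc)
    then show "y \<otimes> x \<in> I" "x \<otimes> y \<in> I" using xc y x0 by (simp_all add: I_def)
  qed
  moreover have "f x = \<zero>\<^bsub>K\<^esub>" if "x \<in> I" for x
  proof -
    have "x \<in> carrier H" "f (\<one> \<otimes> (x \<otimes> \<one>)) = \<zero>\<^bsub>K\<^esub>" using that by (simp_all add: I_def)
    then show ?thesis by (simp add: unit_left unit_right)
  qed
  moreover have "vectorspace.fin_dim K (quot_space H I)"
  proof -
    obtain E where E: "finite E" "E \<subseteq> carrier H"
        "\<And>v. v \<in> carrier H \<Longrightarrow> \<exists>x\<in>span E. \<forall>q\<in>Q. q (v \<ominus> x) = \<zero>\<^bsub>K\<^esub>"
      using common_kernel_cofinite[OF vsH Qf Ql] by blast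
    have sE: "x \<in> carrier H" if "x \<in> span E" for x
      using that subspaceD(2)[OF span_subspace(1)[OF vsH E(2)]] by blast
    \<comment> \<open>\<open>H\<close> is spanned by \<open>E\<close> and the common kernel of \<open>Q\<close>. Hence \<open>x\<close> is in \<open>I\<close> if \<open>q(xe) = 0\<close> for all
      \<open>q \<in> Q\<close>, \<open>e \<in> E\<close>, and these are again finitely many conditions.\<close>
    define R where "R = (\<lambda>(q, e) x. q (x \<otimes> e)) ` (Q \<times> E)"
    have Rf: "finite R" using Qf E(1) by (simp add: R_def)
    have Rl: "lin K H (scalars K) q" if q: "q \<in> R" for q
    proof -
      obtain q' e where "q' \<in> Q" "e \<in> E" "q = (\<lambda>x. q' (x \<otimes> e))" using q by (auto simp: R_def)
      then show ?thesis using lin_comp[OF Ql, of q' H "\<lambda>x. x \<otimes> e"] E(2) by auto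
    qed
    obtain E' where E': "finite E'" "E' \<subseteq> carrier H"
        "\<And>v. v \<in> carrier H \<Longrightarrow> \<exists>x\<in>span E'. \<forall>q\<in>R. q (v \<ominus> x) = \<zero>\<^bsub>K\<^esub>"
      using common_kernel_cofinite[OF vsH Rf Rl] by blast
    have sE': "x \<in> carrier H" if "x \<in> span E'" for x
      using that subspaceD(2)[OF span_subspace(1)[OF vsH E'(2)]] by blast
    have key: "x \<in> I" if x: "x \<in> carrier H" and x0: "\<And>q e. \<lbrakk>q \<in> Q; e \<in> E\<rbrakk> \<Longrightarrow> q (x \<otimes> e) = \<zero>\<^bsub>K\<^esub>" for x
    proof -
      have "f (a \<otimes> (x \<otimes> b)) = \<zero>\<^bsub>K\<^esub>" if a: "a \<in> carrier H" and b: "b \<in> carrier H" for a b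
      proof -
        obtain y where y: "y \<in> span E" "\<And>q. q \<in> Q \<Longrightarrow> q (b \<ominus> y) = \<zero>\<^bsub>K\<^esub>" using E(3)[OF b] by blast
        note yc = sE[OF y(1)]
        have l: "lin K H (scalars K) (\<lambda>y. f (a \<otimes> (x \<otimes> y)))" using a x by simp
        have ker: "subspace K {y \<in> carrier H. f (a \<otimes> (x \<otimes> y)) = \<zero>\<^bsub>scalars K\<^esub>} H"
          by (rule lin_kernel_subspace[OF l])
        have "f (a \<otimes> (x \<otimes> e)) = \<zero>\<^bsub>K\<^esub>" if e: "e \<in> E" for e
        proof (rule Q0)
          show "q (x \<otimes> e) = \<zero>\<^bsub>K\<^esub>" if "q \<in> Q" for q using x0 that e by blast
        qed (use a x e E(2) in auto)
        then have "E \<subseteq> {y \<in> carrier H. f (a \<otimes> (x \<otimes> y)) = \<zero>\<^bsub>scalars K\<^esub>}"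
          using E(2) by auto
        then have "span E \<subseteq> {y \<in> carrier H. f (a \<otimes> (x \<otimes> y)) = \<zero>\<^bsub>scalars K\<^esub>}"
          by (rule span_least[OF ker])
        then have 1: "f (a \<otimes> (x \<otimes> y)) = \<zero>\<^bsub>K\<^esub>" using y(1) by auto
        have "f ((a \<otimes> x) \<otimes> (b \<ominus> y)) = \<zero>\<^bsub>K\<^esub>" using y(2) a b x yc by (intro Q0) auto
        then have 2: "f (a \<otimes> (x \<otimes> (b \<ominus> y))) = \<zero>\<^bsub>K\<^esub>" using a b x yc by (simp add: mult_assoc)
        have "b = (b \<ominus> y) \<oplus> y" using b yc by (simp add: M.minus_eq M.a_assoc M.l_neg)
        then show ?thesis
          using lz1[OF l M.minus_closed[OF b yc] yc 2 1] by simp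
      qed
      then show ?thesis using x by (simp add: I_def)
    qed
    show ?thesis
    proof (rule quot_fin_dim[OF Is E'(1,2)])
      fix v assume v: "v \<in> carrier H"
      obtain x where x: "x \<in> span E'" "\<And>q. q \<in> R \<Longrightarrow> q (v \<ominus> x) = \<zero>\<^bsub>K\<^esub>" using E'(3)[OF v] by blast
      have "q ((v \<ominus> x) \<otimes> e) = \<zero>\<^bsub>K\<^esub>" if "q \<in> Q" "e \<in> E" for q e
      proof -
        have "(\<lambda>x. q (x \<otimes> e)) \<in> R" using that unfolding R_def by force
        then show ?thesis using x(2) by blast
      qed
      then have "v \<ominus> x \<in> I" using v sE'[OF x(1)] by (intro key) simp_all
      then show "\<exists>x\<in>span E'. v \<ominus> x \<in> I" using x(1) by blast
    qed
  qed
  ultimately show ?thesis by blast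
qed

lemma finite_dual_iff:
  "f \<in> carrier D \<longleftrightarrow> f \<in> extensional (carrier H) \<and> lin K H (scalars K) f \<and>
    (\<exists>Q. controls Q (\<lambda>h k. f (h \<otimes> k)))"
  using finite_dual_controls[of _ f] controls_finite_dual[of f]
  by (auto simp: finite_dual_simps finite_dual_carrier_def lin_def)

lemma finite_dualI:
  "\<lbrakk>f \<in> extensional (carrier H); lin K H (scalars K) f; controls Q (\<lambda>h k. f (h \<otimes> k))\<rbrakk> \<Longrightarrow> f \<in> carrier D"
  by (auto simp: finite_dual_iff)

lemma finite_dual_lin: "f \<in> carrier D \<Longrightarrow> lin K H (scalars K) f"
  by (simp add: finite_dual_iff)

lemma finite_dual_closed [simp]: "\<lbrakk>f \<in> carrier D; h \<in> carrier H\<rbrakk> \<Longrightarrow> f h \<in> carrier K"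
  using lin_closed[OF finite_dual_lin] by simp

lemma finite_dual_eqI:
  assumes "f \<in> carrier D" "g \<in> carrier D" "\<And>h. h \<in> carrier H \<Longrightarrow> f h = g h"
  shows "f = g"
  by (rule extensionalityI[of _ "carrier H"]) (use assms in \<open>auto simp: finite_dual_iff\<close>)

lemma controls_add:
  "\<lbrakk>controls Q \<beta>; controls Q' \<beta>'; \<And>h k. \<lbrakk>h \<in> carrier H; k \<in> carrier H\<rbrakk> \<Longrightarrow> \<gamma> h k = \<beta> h k \<oplus>\<^bsub>K\<^esub> \<beta>' h k\<rbrakk>
    \<Longrightarrow> controls (Q \<union> Q') \<gamma>"
  unfolding controls_def by auto

lemma restrict_lin:
  "lin K H (scalars K) f \<Longrightarrow> lin K H (scalars K) (\<lambda>h\<in>carrier H. f h)"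
  by (rule iffD2[OF lin_cong]) simp

lemma ext_add_closed: "\<lbrakk>f \<in> carrier D; g \<in> carrier D\<rbrakk> \<Longrightarrow> f \<oplus>\<^bsub>D\<^esub> g \<in> carrier D"
proof -
  assume f: "f \<in> carrier D" and g: "g \<in> carrier D"
  obtain Q Q' where Q: "controls Q (\<lambda>h k. f (h \<otimes> k))" "controls Q' (\<lambda>h k. g (h \<otimes> k))"
    using f g by (auto simp: finite_dual_iff)
  have "controls (Q \<union> Q') (\<lambda>h k. (f \<oplus>\<^bsub>D\<^esub> g) (h \<otimes> k))"
    by (rule controls_add[OF Q]) (simp add: finite_dual_simps)
  moreover have "lin K H (scalars K) (f \<oplus>\<^bsub>D\<^esub> g)"
    using lin_sum[OF finite_dual_lin[OF f] finite_dual_lin[OF g]]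
    by (simp add: finite_dual_simps restrict_lin)
  ultimately show ?thesis by - (rule finite_dualI, simp add: finite_dual_simps(2), assumption+)
qed

lemma ext_smult_closed: "\<lbrakk>c \<in> carrier K; f \<in> carrier D\<rbrakk> \<Longrightarrow> c \<odot>\<^bsub>D\<^esub> f \<in> carrier D"
proof -
  assume c: "c \<in> carrier K" and f: "f \<in> carrier D"
  obtain Q where Q: "controls Q (\<lambda>h k. f (h \<otimes> k))" using f by (auto simp: finite_dual_iff)
  then have "controls Q (\<lambda>h k. (c \<odot>\<^bsub>D\<^esub> f) (h \<otimes> k))"
    using c by (auto simp: controls_def finite_dual_simps)
  moreover have "lin K H (scalars K) (c \<odot>\<^bsub>D\<^esub> f)"
    using lin_scal2[OF finite_dual_lin[OF f] c] by (simp add: finite_dual_simps restrict_lin)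
  ultimately show ?thesis by - (rule finite_dualI, simp add: finite_dual_simps(3), assumption+)
qed

lemma zero_lin: "lin K H (scalars K) (\<lambda>h. \<zero>\<^bsub>K\<^esub>)"
  by (rule linI) simp_all

lemma ext_zero_closed: "\<zero>\<^bsub>D\<^esub> \<in> carrier D"
proof -
  have "controls {} (\<lambda>h k. \<zero>\<^bsub>D\<^esub> (h \<otimes> k))"
    by (simp add: controls_def finite_dual_simps)
  moreover have "lin K H (scalars K) \<zero>\<^bsub>D\<^esub>"
    using restrict_lin[OF zero_lin] by (simp add: finite_dual_simps(4))
  ultimately show ?thesis by - (rule finite_dualI, simp add: finite_dual_simps(4), assumption+)
qed

lemma finite_dual_vs [simp]: "vectorspace K D"
proof (rule vs_criteria[OF field_axioms])
  have c: "f h \<in> carrier K" if "f \<in> carrier D" "h \<in> carrier H" for f h using that by simp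
  have e: "f \<in> extensional (carrier H)" if "f \<in> carrier D" for f using that by (simp add: finite_dual_iff)
  have r: "(\<lambda>h\<in>carrier H. f h) = f" if "f \<in> carrier D" for f
    using e[OF that] by (rule extensional_restrict)
  note s = finite_dual_simps(2-4)
  show "\<forall>v\<in>carrier D. \<exists>neg_v\<in>carrier D. v \<oplus>\<^bsub>D\<^esub> neg_v = \<zero>\<^bsub>D\<^esub>"
  proof
    fix v assume v: "v \<in> carrier D"
    have "v \<oplus>\<^bsub>D\<^esub> ((\<ominus>\<^bsub>K\<^esub> \<one>\<^bsub>K\<^esub>) \<odot>\<^bsub>D\<^esub> v) = \<zero>\<^bsub>D\<^esub>"
      using c[OF v] by (auto simp: s R.l_minus R.r_neg intro!: restrict_ext)
    then show "\<exists>neg_v\<in>carrier D. v \<oplus>\<^bsub>D\<^esub> neg_v = \<zero>\<^bsub>D\<^esub>"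
      using ext_smult_closed[OF _ v, of "\<ominus>\<^bsub>K\<^esub> \<one>\<^bsub>K\<^esub>"] by auto
  qed
  show "\<forall>v\<in>carrier D. v \<oplus>\<^bsub>D\<^esub> \<zero>\<^bsub>D\<^esub> = v"
    using c r by (auto simp: s cong: restrict_cong)
  show "\<forall>v\<in>carrier D. \<one>\<^bsub>K\<^esub> \<odot>\<^bsub>D\<^esub> v = v"
    using c r by (auto simp: s cong: restrict_cong)
qed (use ext_add_closed ext_smult_closed ext_zero_closed in
  \<open>auto simp: finite_dual_simps(2,3) R.a_ac R.m_assoc R.l_distr R.r_distr intro!: restrict_ext\<close>)

lemma finite_dual_ops [simp]:
  assumes "h \<in> carrier H"
  shows "(f \<oplus>\<^bsub>D\<^esub> g) h = f h \<oplus>\<^bsub>K\<^esub> g h" "(c \<odot>\<^bsub>D\<^esub> f) h = c \<otimes>\<^bsub>K\<^esub> f h" "\<zero>\<^bsub>D\<^esub> h = \<zero>\<^bsub>K\<^esub>"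
    "(f \<otimes>\<^bsub>D\<^esub> g) h = tensor_lift K H H (scalars K) (\<lambda>x y. f x \<otimes>\<^bsub>K\<^esub> g y) (comult H h)"
    "\<one>\<^bsub>D\<^esub> h = counit H h" "antipode D f h = f (antipode H h)"
  using assms by (simp_all add: finite_dual_simps)

lemma eval_lin [simp]: "h \<in> carrier H \<Longrightarrow> lin K D (scalars K) (\<lambda>f. f h)"
  by (rule linI) simp_all

section \<open>The finite dual as a Hopf algebra\<close>

lemmas [simp] = lift_closed_scalars

lemma finite_dual_comp_lin [simp]:
  "\<lbrakk>f \<in> carrier D; lin K V H g\<rbrakk> \<Longrightarrow> lin K V (scalars K) (\<lambda>x. f (g x))"
  by (rule lin_comp[OF finite_dual_lin])

lemmas [simp] = finite_dual_lin

text \<open>Evaluation of \<open>D \<otimes> D\<close> at a pair of points. An element of \<open>D \<otimes> D\<close> is determined by these values,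
  so that identities in \<open>D \<otimes> D\<close> and \<open>D \<otimes> D \<otimes> D\<close> reduce to identities between functions on \<open>H\<close>.\<close>

abbreviation ev2 where "ev2 h k \<equiv> tensor_lift K D D (scalars K) (\<lambda>f1 f2. f1 h \<otimes>\<^bsub>K\<^esub> f2 k)"

lemma ev2_lin: "\<lbrakk>h \<in> carrier H; k \<in> carrier H\<rbrakk> \<Longrightarrow> lin K (tensor K D D) (scalars K) (ev2 h k)"
  by (rule lift_lin) simp

lemma ev2_pure: "\<lbrakk>h \<in> carrier H; k \<in> carrier H; p \<in> carrier D; q \<in> carrier D\<rbrakk>
    \<Longrightarrow> ev2 h k (pure_tensor K D D p q) = p h \<otimes>\<^bsub>K\<^esub> q k"
  by (rule lift_pure) simp_all

lemma finite_dual_separation: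
  assumes W: "vectorspace K W" and XY: "X \<in> carrier (tensor K D W)" "Y \<in> carrier (tensor K D W)"
    and eq: "\<And>h. h \<in> carrier H \<Longrightarrow> tensor_lift K D W W (\<lambda>f w. f h \<odot>\<^bsub>W\<^esub> w) X
      = tensor_lift K D W W (\<lambda>f w. f h \<odot>\<^bsub>W\<^esub> w) Y"
  shows "X = Y"
proof (rule tensor_separation[OF finite_dual_vs W _ _ XY])
  let ?F = "(\<lambda>h f. f h) ` carrier H"
  show "lin K D (scalars K) e" if "e \<in> ?F" for e using that by auto
  show "f = \<zero>\<^bsub>D\<^esub>" if f: "f \<in> carrier D" and 0: "\<And>e. e \<in> ?F \<Longrightarrow> e f = \<zero>\<^bsub>K\<^esub>" for f
    by (rule finite_dual_eqI[OF f ext_zero_closed]) (use 0 in auto)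
  show "tensor_lift K D W W (\<lambda>f w. e f \<odot>\<^bsub>W\<^esub> w) X = tensor_lift K D W W (\<lambda>f w. e f \<odot>\<^bsub>W\<^esub> w) Y"
    if "e \<in> ?F" for e using that eq by auto
qed

lemma DD_eqI:
  assumes XY: "X \<in> carrier (tensor K D D)" "Y \<in> carrier (tensor K D D)"
    and eq: "\<And>h k. \<lbrakk>h \<in> carrier H; k \<in> carrier H\<rbrakk> \<Longrightarrow> ev2 h k X = ev2 h k Y"
  shows "X = Y"
proof (rule finite_dual_separation[OF finite_dual_vs XY])
  fix h assume h: "h \<in> carrier H"
  have b: "bilin K D D D (\<lambda>f1 f2. f1 h \<odot>\<^bsub>D\<^esub> f2)" using h by simp
  have e: "tensor_lift K D D D (\<lambda>f1 f2. f1 h \<odot>\<^bsub>D\<^esub> f2) T k = ev2 h k T"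
    if "k \<in> carrier H" "T \<in> carrier (tensor K D D)" for k T
    using lin_lift[OF eval_lin[OF that(1)] b that(2)] that(1) by simp
  show "tensor_lift K D D D (\<lambda>f1 f2. f1 h \<odot>\<^bsub>D\<^esub> f2) X = tensor_lift K D D D (\<lambda>f1 f2. f1 h \<odot>\<^bsub>D\<^esub> f2) Y"
    by (rule finite_dual_eqI[OF lift_closed[OF b XY(1)] lift_closed[OF b XY(2)]]) (simp add: e XY eq h)
qed

lemma DDD_eqI:
  assumes XY: "X \<in> carrier (tensor K D (tensor K D D))" "Y \<in> carrier (tensor K D (tensor K D D))"
    and eq: "\<And>h k l. \<lbrakk>h \<in> carrier H; k \<in> carrier H; l \<in> carrier H\<rbrakk>
      \<Longrightarrow> tensor_lift K D (tensor K D D) (scalars K) (\<lambda>f T. f h \<otimes>\<^bsub>K\<^esub> ev2 k l T) X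
        = tensor_lift K D (tensor K D D) (scalars K) (\<lambda>f T. f h \<otimes>\<^bsub>K\<^esub> ev2 k l T) Y"
  shows "X = Y"
proof (rule finite_dual_separation[OF _ XY])
  let ?DD = "tensor K D D"
  show DD: "vectorspace K ?DD" by simp
  fix h assume h: "h \<in> carrier H"
  have b: "bilin K D ?DD ?DD (\<lambda>f T. f h \<odot>\<^bsub>?DD\<^esub> T)" using h by simp
  have e: "ev2 k l (tensor_lift K D ?DD ?DD (\<lambda>f T. f h \<odot>\<^bsub>?DD\<^esub> T) Z)
      = tensor_lift K D ?DD (scalars K) (\<lambda>f T. f h \<otimes>\<^bsub>K\<^esub> ev2 k l T) Z"
    if "k \<in> carrier H" "l \<in> carrier H" "Z \<in> carrier (tensor K D ?DD)" for k l Z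
    unfolding lin_lift[OF ev2_lin[OF that(1,2)] b that(3)]
    by (rule lift_cong) (simp_all add: lin_smult[OF ev2_lin] h that)
  show "tensor_lift K D ?DD ?DD (\<lambda>f T. f h \<odot>\<^bsub>?DD\<^esub> T) X
      = tensor_lift K D ?DD ?DD (\<lambda>f T. f h \<odot>\<^bsub>?DD\<^esub> T) Y"
    by (rule DD_eqI[OF lift_closed[OF b XY(1)] lift_closed[OF b XY(2)]]) (simp add: e XY eq h)
qed

text \<open>The functionals \<open>c\<^sub>b\<close> that give coordinates modulo a cofinite ideal \<open>I\<close> with \<open>f(I) = 0\<close> vanish
  on \<open>I\<close>, and so do the functionals \<open>f(r\<^sub>b -)\<close>; hence \<open>\<Sum> c\<^sub>b \<otimes> f(r\<^sub>b -)\<close> lies in \<open>D \<otimes> D\<close>.\<close>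

lemma finite_dual_comult_ex:
  assumes f: "f \<in> carrier D"
  shows "\<exists>T\<in>carrier (tensor K D D). \<forall>h\<in>carrier H. \<forall>k\<in>carrier H. f (h \<otimes> k) = ev2 h k T"
proof -
  obtain I where I: "ideal I H" and fd: "vectorspace.fin_dim K (quot_space H I)"
    and f0: "\<And>x. x \<in> I \<Longrightarrow> f x = \<zero>\<^bsub>K\<^esub>"
    using f by (auto simp: finite_dual_simps(1) finite_dual_carrier_def)
  interpret I: ideal I H by fact
  obtain B :: "'h set set" and c r where Bc: "finite B \<and> (\<forall>b\<in>B. lin K H (scalars K) (c b) \<and> r b \<in> carrier H \<and>
      (\<forall>u\<in>I. c b u = \<zero>\<^bsub>K\<^esub>)) \<and> (\<forall>v\<in>carrier H. v \<ominus> (\<Oplus>b\<in>B. c b v \<odot> r b) \<in> I)"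
    using quot_coords[OF ideal_subspace[OF I] fd] by (elim exE)
  have B: "finite B" and cl: "\<And>b. b \<in> B \<Longrightarrow> lin K H (scalars K) (c b)"
    and r: "\<And>b. b \<in> B \<Longrightarrow> r b \<in> carrier H" and c0: "\<And>b u. \<lbrakk>b \<in> B; u \<in> I\<rbrakk> \<Longrightarrow> c b u = \<zero>\<^bsub>K\<^esub>"
    and cr: "\<And>v. v \<in> carrier H \<Longrightarrow> v \<ominus> (\<Oplus>b\<in>B. c b v \<odot> r b) \<in> I"
    using Bc by simp_all
  have cc: "c b h \<in> carrier K" if "b \<in> B" "h \<in> carrier H" for b h
    using lin_closed[OF cl[OF that(1)] that(2)] by simp
  have inD: "(\<lambda>h\<in>carrier H. g h) \<in> carrier D"
    if g: "lin K H (scalars K) g" "\<And>u. u \<in> I \<Longrightarrow> g u = \<zero>\<^bsub>K\<^esub>" for g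
    unfolding finite_dual_simps(1) finite_dual_carrier_def
    using I fd restrict_lin[OF g(1)] g(2) I.a_Hcarr by (auto simp: lin_def)
  let ?c = "\<lambda>b. \<lambda>h\<in>carrier H. c b h" and ?g = "\<lambda>b. \<lambda>k\<in>carrier H. f (r b \<otimes> k)"
  have c: "?c b \<in> carrier D" if "b \<in> B" for b
    by (rule inD) (use that cl c0 in auto)
  have g: "?g b \<in> carrier D" if b: "b \<in> B" for b
  proof (rule inD)
    show "lin K H (scalars K) (\<lambda>k. f (r b \<otimes> k))" using f r[OF b] by simp
    show "f (r b \<otimes> u) = \<zero>\<^bsub>K\<^esub>" if "u \<in> I" for u using f0 I.I_l_closed[OF that r[OF b]] by simp
  qed
  let ?T = "\<Oplus>\<^bsub>tensor K D D\<^esub>b\<in>B. pure_tensor K D D (?c b) (?g b)"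
  interpret DD: vectorspace K "tensor K D D" by simp
  interpret KK: vectorspace K "scalars K" by simp
  have p: "pure_tensor K D D (?c b) (?g b) \<in> carrier (tensor K D D)" if "b \<in> B" for b
    by (rule pure_closed[OF finite_dual_vs finite_dual_vs c[OF that] g[OF that]])
  have "f (h \<otimes> k) = ev2 h k ?T" if h: "h \<in> carrier H" and k: "k \<in> carrier H" for h k
  proof -
    let ?s = "\<Oplus>b\<in>B. c b h \<odot> r b"
    have t: "c b h \<odot> r b \<in> carrier H" if "b \<in> B" for b using cc r h that by simp
    have s: "?s \<in> carrier H" using t by (intro M.finsum_closed) auto
    have l: "lin K H (scalars K) (\<lambda>x. f (x \<otimes> k))"
      by (rule finite_dual_comp_lin[OF f lin_mult1[OF algH lin_id[OF vsH] k]])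
    have "f ((h \<ominus> ?s) \<otimes> k) = \<zero>\<^bsub>K\<^esub>" by (rule f0[OF I.I_r_closed[OF cr[OF h] k]])
    then have "f (h \<otimes> k) \<ominus>\<^bsub>scalars K\<^esub> f (?s \<otimes> k) = \<zero>\<^bsub>K\<^esub>" using lin_minus[OF l h s] by simp
    then have "f (h \<otimes> k) = f (?s \<otimes> k)"
      using KK.M.minus_zero_eq[of "f (h \<otimes> k)" "f (?s \<otimes> k)"] f h k s by simp
    also have "\<dots> = (\<Oplus>\<^bsub>scalars K\<^esub>b\<in>B. f (c b h \<odot> r b \<otimes> k))"
      by (rule lin_finsum[OF l B t])
    also have "\<dots> = (\<Oplus>\<^bsub>scalars K\<^esub>b\<in>B. ev2 h k (pure_tensor K D D (?c b) (?g b)))"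
    proof (rule KK.M.finsum_cong')
      fix b assume b: "b \<in> B"
      show "f (c b h \<odot> r b \<otimes> k) = ev2 h k (pure_tensor K D D (?c b) (?g b))"
        using lin_smult[OF l cc[OF b h] r[OF b]] h k by (simp add: ev2_pure[OF h k c[OF b] g[OF b]])
    qed (use p h k in auto)
    also have "\<dots> = ev2 h k ?T" by (rule lin_finsum[OF ev2_lin[OF h k] B p, symmetric])
    finally show ?thesis .
  qed
  moreover have "?T \<in> carrier (tensor K D D)" using p by (intro DD.M.finsum_closed) auto
  ultimately show ?thesis by blast
qed

text \<open>The definition of the comultiplication uses the tensor square of the underlying algebra instead
  of that of \<open>D\<close>; both have the same linear structure.\<close>

lemma finite_dual_comult_def:
  "comult D f = (THE T. T \<in> carrier (tensor K D D) \<and>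
     (\<forall>h\<in>carrier H. \<forall>k\<in>carrier H. f (h \<otimes> k) = ev2 h k T))"
proof -
  let ?A = "finite_dual_algebra K H"
  have 1: "carrier ?A = carrier D" "add ?A = add D" "smult ?A = smult D"
    by (simp_all add: finite_dual_def Let_def module.defs hopf.defs)
  note 2 = tensor_space_cong[OF 1 1]
  have "comult D f = (THE T. T \<in> carrier (tensor K ?A ?A) \<and> (\<forall>h\<in>carrier H. \<forall>k\<in>carrier H.
      f (h \<otimes> k) = tensor_lift K ?A ?A (scalars K) (\<lambda>f1 f2. f1 h \<otimes>\<^bsub>K\<^esub> f2 k) T))"
    by (simp add: finite_dual_def Let_def module.defs hopf.defs)
  then show ?thesis by (simp only: 2 tensor_simps(1))
qed

lemma finite_dual_comult:
  assumes f: "f \<in> carrier D"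
  shows finite_dual_comult_closed: "comult D f \<in> carrier (tensor K D D)"
    and ev2_comult: "\<And>h k. \<lbrakk>h \<in> carrier H; k \<in> carrier H\<rbrakk> \<Longrightarrow> ev2 h k (comult D f) = f (h \<otimes> k)"
proof -
  have "\<exists>!T. T \<in> carrier (tensor K D D) \<and> (\<forall>h\<in>carrier H. \<forall>k\<in>carrier H. f (h \<otimes> k) = ev2 h k T)"
  proof (rule ex_ex1I)
    show "\<exists>T. T \<in> carrier (tensor K D D) \<and> (\<forall>h\<in>carrier H. \<forall>k\<in>carrier H. f (h \<otimes> k) = ev2 h k T)"
      using finite_dual_comult_ex[OF f] by blast
  qed (rule DD_eqI, simp_all)
  from theI'[OF this, folded finite_dual_comult_def]
  have *: "comult D f \<in> carrier (tensor K D D) \<and>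
    (\<forall>h\<in>carrier H. \<forall>k\<in>carrier H. f (h \<otimes> k) = ev2 h k (comult D f))" .
  show "comult D f \<in> carrier (tensor K D D)" using * by blast
  show "ev2 h k (comult D f) = f (h \<otimes> k)" if "h \<in> carrier H" "k \<in> carrier H" for h k
    using * that by simp
qed

subsection \<open>The algebra structure\<close>

lemma finite_dual_mult_lin:
  "\<lbrakk>f \<in> carrier D; g \<in> carrier D\<rbrakk> \<Longrightarrow> lin K H (scalars K) (f \<otimes>\<^bsub>D\<^esub> g)"
  unfolding finite_dual_simps(5) by (rule restrict_lin) simp

lemma controls_single:
  assumes "lin K H (scalars K) q" "\<And>h k. \<lbrakk>h \<in> carrier H; k \<in> carrier H; q k = \<zero>\<^bsub>K\<^esub>\<rbrakk> \<Longrightarrow> \<beta> h k = \<zero>\<^bsub>K\<^esub>"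
  shows "controls {q} \<beta>"
  using assms by (auto simp: controls_def)

lemma controls_ev2:
  assumes T: "T \<in> carrier (tensor K D D)"
  shows "\<exists>P. controls P (\<lambda>h k. ev2 k h T)"
  using finite_dual_vs finite_dual_vs T
proof (induction rule: tensor_induct)
  case (pure p q)
  have "controls {p} (\<lambda>h k. ev2 k h (pure_tensor K D D p q))"
    using pure by (intro controls_single) (simp_all add: ev2_pure)
  then show ?case by blast
next
  case (add X Y)
  obtain P Q where "controls P (\<lambda>h k. ev2 k h X)" "controls Q (\<lambda>h k. ev2 k h Y)"
    using add(3,4) by blast
  then have "controls (P \<union> Q) (\<lambda>h k. ev2 k h (X \<oplus>\<^bsub>tensor K D D\<^esub> Y))"
    by (rule controls_add) (simp add: lin_add[OF ev2_lin] add(1,2))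
  then show ?case by blast
qed

text \<open>The form \<open>(h, k) \<mapsto> X(h\<^sub>1, k\<^sub>1) Y(h\<^sub>2, k\<^sub>2)\<close> for \<open>X\<close>, \<open>Y\<close> in \<open>D \<otimes> D\<close>. For pure tensors it is
  \<open>(p * p')(h) (q * q')(k)\<close>.\<close>

definition conv2 where
  "conv2 h k X Y = tensor_lift K H H (scalars K) (\<lambda>h1 h2. tensor_lift K H H (scalars K)
     (\<lambda>k1 k2. ev2 h1 k1 X \<otimes>\<^bsub>K\<^esub> ev2 h2 k2 Y) (comult H k)) (comult H h)"

lemma conv2_lin1: "\<lbrakk>h \<in> carrier H; k \<in> carrier H; Y \<in> carrier (tensor K D D)\<rbrakk>
    \<Longrightarrow> lin K (tensor K D D) (scalars K) (\<lambda>X. conv2 h k X Y)"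
  unfolding conv2_def by simp

lemma conv2_lin2: "\<lbrakk>h \<in> carrier H; k \<in> carrier H; X \<in> carrier (tensor K D D)\<rbrakk>
    \<Longrightarrow> lin K (tensor K D D) (scalars K) (\<lambda>Y. conv2 h k X Y)"
  unfolding conv2_def by simp

lemma conv2_pure:
  assumes h: "h \<in> carrier H" and k: "k \<in> carrier H"
    and D: "p \<in> carrier D" "q \<in> carrier D" "p' \<in> carrier D" "q' \<in> carrier D"
  shows "conv2 h k (pure_tensor K D D p q) (pure_tensor K D D p' q')
    = (p \<otimes>\<^bsub>D\<^esub> p') h \<otimes>\<^bsub>K\<^esub> (q \<otimes>\<^bsub>D\<^esub> q') k"
proof -
  have "(p \<otimes>\<^bsub>D\<^esub> p') h \<otimes>\<^bsub>K\<^esub> (q \<otimes>\<^bsub>D\<^esub> q') k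
    = tensor_lift K H H (scalars K) (\<lambda>h1 h2. (p h1 \<otimes>\<^bsub>K\<^esub> p' h2) \<otimes>\<^bsub>K\<^esub>
        tensor_lift K H H (scalars K) (\<lambda>k1 k2. q k1 \<otimes>\<^bsub>K\<^esub> q' k2) (comult H k)) (comult H h)"
    using h k D by (simp add: lift_scal_right cong: lift_cong)
  also have "\<dots> = tensor_lift K H H (scalars K) (\<lambda>h1 h2. tensor_lift K H H (scalars K)
     (\<lambda>k1 k2. (p h1 \<otimes>\<^bsub>K\<^esub> p' h2) \<otimes>\<^bsub>K\<^esub> (q k1 \<otimes>\<^bsub>K\<^esub> q' k2)) (comult H k)) (comult H h)"
    using h k D by (simp add: lift_scal_left cong: lift_cong)
  also have "\<dots> = tensor_lift K H H (scalars K) (\<lambda>h1 h2. tensor_lift K H H (scalars K)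
     (\<lambda>k1 k2. (p h1 \<otimes>\<^bsub>K\<^esub> q k1) \<otimes>\<^bsub>K\<^esub> (p' h2 \<otimes>\<^bsub>K\<^esub> q' k2)) (comult H k)) (comult H h)"
    using D by (intro lift_cong refl) (simp add: R.m_ac)
  finally show ?thesis using D by (simp add: conv2_def ev2_pure cong: lift_cong)
qed

lemma conv2_comult:
  assumes f: "f \<in> carrier D" and g: "g \<in> carrier D" and h: "h \<in> carrier H" and k: "k \<in> carrier H"
  shows "conv2 h k (comult D f) (comult D g) = (f \<otimes>\<^bsub>D\<^esub> g) (h \<otimes> k)"
proof -
  have "bilin K H H (scalars K) (\<lambda>x y. f x \<otimes>\<^bsub>K\<^esub> g y)" using f g by simp
  from sw_mult[OF this h k] show ?thesis
    using f g h k by (simp add: conv2_def ev2_comult cong: lift_cong)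
qed

lemma controls_conv2:
  assumes X: "X \<in> carrier (tensor K D D)" and Y: "Y \<in> carrier (tensor K D D)"
  shows "\<exists>P. controls P (\<lambda>h k. conv2 h k X Y)"
  using finite_dual_vs finite_dual_vs X
proof (induction rule: tensor_induct)
  case (pure p q)
  show ?case
    using finite_dual_vs finite_dual_vs Y
  proof (induction rule: tensor_induct)
    case (pure p' q')
    have 0: "(p \<otimes>\<^bsub>D\<^esub> p') h \<in> carrier K" if "h \<in> carrier H" for h
      using lin_closed[OF finite_dual_mult_lin[OF \<open>p \<in> carrier D\<close> pure(1)] that] by simp
    have "controls {q \<otimes>\<^bsub>D\<^esub> q'} (\<lambda>h k. conv2 h k (pure_tensor K D D p q) (pure_tensor K D D p' q'))"
      using pure \<open>p \<in> carrier D\<close> \<open>q \<in> carrier D\<close> 0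
      by (intro controls_single finite_dual_mult_lin) (simp_all add: conv2_pure del: finite_dual_ops(4))
    then show ?case by blast
  next
    case (add Z Z')
    obtain P Q where "controls P (\<lambda>h k. conv2 h k (pure_tensor K D D p q) Z)"
        "controls Q (\<lambda>h k. conv2 h k (pure_tensor K D D p q) Z')" using add(3,4) by blast
    then have "controls (P \<union> Q) (\<lambda>h k. conv2 h k (pure_tensor K D D p q) (Z \<oplus>\<^bsub>tensor K D D\<^esub> Z'))"
      by (rule controls_add) (simp add: lin_add[OF conv2_lin2] pure add(1,2))
    then show ?case by blast
  qed
next
  case (add Z Z')
  obtain P Q where "controls P (\<lambda>h k. conv2 h k Z Y)" "controls Q (\<lambda>h k. conv2 h k Z' Y)"
    using add(3,4) by blast
  then have "controls (P \<union> Q) (\<lambda>h k. conv2 h k (Z \<oplus>\<^bsub>tensor K D D\<^esub> Z') Y)"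
    by (rule controls_add) (simp add: lin_add[OF conv2_lin1] Y add(1,2))
  then show ?case by blast
qed

text \<open>\<open>f * g\<close> is in \<open>D\<close> because \<open>(f * g)(hk) = f\<^sub>1(h\<^sub>1) f\<^sub>2(k\<^sub>1) g\<^sub>1(h\<^sub>2) g\<^sub>2(k\<^sub>2)\<close>, a form controlled by the
  finitely many functionals \<open>f\<^sub>2 * g\<^sub>2\<close>.\<close>

lemma finite_dual_mult_closed:
  assumes f: "f \<in> carrier D" and g: "g \<in> carrier D"
  shows "f \<otimes>\<^bsub>D\<^esub> g \<in> carrier D"
proof -
  obtain P where "controls P (\<lambda>h k. conv2 h k (comult D f) (comult D g))"
    using controls_conv2[OF finite_dual_comult_closed[OF f] finite_dual_comult_closed[OF g]] by blast
  then have "controls P (\<lambda>h k. (f \<otimes>\<^bsub>D\<^esub> g) (h \<otimes> k))"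
    using f g by (simp add: controls_def conv2_comult del: finite_dual_ops(4))
  then show ?thesis
    by (intro finite_dualI[OF _ finite_dual_mult_lin[OF f g]]) (simp add: finite_dual_simps(5))
qed

lemma finite_dual_one_closed: "\<one>\<^bsub>D\<^esub> \<in> carrier D"
proof (rule finite_dualI)
  show "lin K H (scalars K) \<one>\<^bsub>D\<^esub>" unfolding finite_dual_simps(6) by (rule restrict_lin) simp
  show "controls {counit H} (\<lambda>h k. \<one>\<^bsub>D\<^esub> (h \<otimes> k))"
    by (rule controls_single) (simp_all add: counit_mult)
qed (simp add: finite_dual_simps(6))

text \<open>\<open>f(S(hk)) = f(S(k)S(h)) = f\<^sub>1(S(k)) f\<^sub>2(S(h))\<close> is controlled by the finitely many functionals
  \<open>f\<^sub>1 \<circ> S\<close>.\<close>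

lemma finite_dual_antipode_closed:
  assumes f: "f \<in> carrier D"
  shows "antipode D f \<in> carrier D"
proof -
  have l: "lin K H (scalars K) (antipode D f)"
    unfolding finite_dual_simps(8) using f by (intro restrict_lin) simp
  obtain P where P: "controls P (\<lambda>h k. ev2 k h (comult D f))"
    using controls_ev2[OF finite_dual_comult_closed[OF f]] by blast
  have "controls ((\<lambda>p k. p (antipode H k)) ` P) (\<lambda>h k. antipode D f (h \<otimes> k))"
    unfolding controls_def
  proof (intro conjI ballI impI)
    show "finite ((\<lambda>p k. p (antipode H k)) ` P)" using P by (simp add: controls_def)
    show "lin K H (scalars K) q" if "q \<in> (\<lambda>p k. p (antipode H k)) ` P" for q
      using that P lin_comp[OF _ antipode_lin] by (auto simp: controls_def)
    fix k h assume k: "k \<in> carrier H" and h: "h \<in> carrier H"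
      and 0: "\<forall>q\<in>(\<lambda>p k. p (antipode H k)) ` P. q k = \<zero>\<^bsub>K\<^esub>"
    have "antipode D f (h \<otimes> k) = ev2 (antipode H k) (antipode H h) (comult D f)"
      using h k f by (simp add: antipode_mult ev2_comult)
    also have "\<dots> = \<zero>\<^bsub>K\<^esub>" using P 0 h k by (simp add: controls_def)
    finally show "antipode D f (h \<otimes> k) = \<zero>\<^bsub>K\<^esub>" .
  qed
  then show ?thesis by (intro finite_dualI[OF _ l]) (simp add: finite_dual_simps(8))
qed

lemma finite_dual_algebra: "unital_algebra K D"
proof (intro unital_algebra.intro nonunital_algebra.intro nonunital_algebra_axioms.intro
    unital_algebra_axioms.intro finite_dual_vs finite_dual_mult_closed finite_dual_one_closed)
  note c = finite_dual_mult_closed ext_add_closed ext_smult_closed finite_dual_one_closed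
  interpret D: vectorspace K D by simp
  interpret KK: vectorspace K "scalars K" by simp
  show "(f \<otimes>\<^bsub>D\<^esub> g) \<otimes>\<^bsub>D\<^esub> k = f \<otimes>\<^bsub>D\<^esub> (g \<otimes>\<^bsub>D\<^esub> k)"
    if f: "f \<in> carrier D" and g: "g \<in> carrier D" and k: "k \<in> carrier D" for f g k
  proof (rule finite_dual_eqI)
    fix h assume h: "h \<in> carrier H"
    have "tensor_lift K H H (scalars K) (\<lambda>x w. tensor_lift K H H (scalars K)
        (\<lambda>u v. (f u \<otimes>\<^bsub>K\<^esub> g v) \<otimes>\<^bsub>K\<^esub> k w) (comult H x)) (comult H h)
      = tensor_lift K H H (scalars K) (\<lambda>u x. tensor_lift K H H (scalars K)
        (\<lambda>v w. (f u \<otimes>\<^bsub>K\<^esub> g v) \<otimes>\<^bsub>K\<^esub> k w) (comult H x)) (comult H h)"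
      by (rule sw_coassoc[OF h]) (use f g k in simp_all)
    then show "((f \<otimes>\<^bsub>D\<^esub> g) \<otimes>\<^bsub>D\<^esub> k) h = (f \<otimes>\<^bsub>D\<^esub> (g \<otimes>\<^bsub>D\<^esub> k)) h"
      using h f g k by (simp add: lift_push R.m_assoc cong: lift_cong)
  qed (intro c f g k)+
  fix f assume f: "f \<in> carrier D"
  show "\<one>\<^bsub>D\<^esub> \<otimes>\<^bsub>D\<^esub> f = f"
    using sw_counit1[OF finite_dual_lin[OF f]]
    by (intro finite_dual_eqI c f) (simp add: cong: lift_cong)
  show "f \<otimes>\<^bsub>D\<^esub> \<one>\<^bsub>D\<^esub> = f"
    using sw_counit2[OF finite_dual_lin[OF f]]
    by (intro finite_dual_eqI c f) (simp add: f R.m_comm cong: lift_cong)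
next
  note c = finite_dual_mult_closed ext_add_closed ext_smult_closed
  have 1: "lin K D (scalars K) (\<lambda>f. (f \<otimes>\<^bsub>D\<^esub> g) h)" "lin K D (scalars K) (\<lambda>f. (g \<otimes>\<^bsub>D\<^esub> f) h)"
    if "g \<in> carrier D" "h \<in> carrier H" for g h
    using that by simp_all
  fix f g assume f: "f \<in> carrier D" and g: "g \<in> carrier D"
  show "(f \<oplus>\<^bsub>D\<^esub> g) \<otimes>\<^bsub>D\<^esub> k = (f \<otimes>\<^bsub>D\<^esub> k) \<oplus>\<^bsub>D\<^esub> (g \<otimes>\<^bsub>D\<^esub> k)" if k: "k \<in> carrier D" for k
    using lin_add[OF 1(1)[OF k] f g]
    by (intro finite_dual_eqI c f g k) (simp del: finite_dual_ops(4))
  show "k \<otimes>\<^bsub>D\<^esub> (f \<oplus>\<^bsub>D\<^esub> g) = (k \<otimes>\<^bsub>D\<^esub> f) \<oplus>\<^bsub>D\<^esub> (k \<otimes>\<^bsub>D\<^esub> g)" if k: "k \<in> carrier D" for k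
    using lin_add[OF 1(2)[OF k] f g]
    by (intro finite_dual_eqI c f g k) (simp del: finite_dual_ops(4))
  fix k assume k: "k \<in> carrier K"
  show "(k \<odot>\<^bsub>D\<^esub> f) \<otimes>\<^bsub>D\<^esub> g = k \<odot>\<^bsub>D\<^esub> (f \<otimes>\<^bsub>D\<^esub> g)"
    using lin_smult[OF 1(1)[OF g] k f]
    by (intro finite_dual_eqI c f g k) (simp del: finite_dual_ops(4))
  show "f \<otimes>\<^bsub>D\<^esub> (k \<odot>\<^bsub>D\<^esub> g) = k \<odot>\<^bsub>D\<^esub> (f \<otimes>\<^bsub>D\<^esub> g)"
    using lin_smult[OF 1(2)[OF f] k g]
    by (intro finite_dual_eqI c f g k) (simp del: finite_dual_ops(4))
qed

subsection \<open>The Hopf algebra axioms\<close>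

lemma finite_dual_nonunital [simp]: "nonunital_algebra K D"
  using finite_dual_algebra by (rule unital_algebra.axioms(1))

lemmas [simp] = finite_dual_comult_closed ev2_comult finite_dual_mult_closed finite_dual_one_closed
  finite_dual_antipode_closed ext_add_closed ext_smult_closed ext_zero_closed

lemma finite_dual_comult_lin: "lin K D (tensor K D D) (comult D)"
proof (rule linI)
  interpret DD: vectorspace K "tensor K D D" by simp
  show "comult D (f \<oplus>\<^bsub>D\<^esub> g) = comult D f \<oplus>\<^bsub>tensor K D D\<^esub> comult D g"
    if "f \<in> carrier D" "g \<in> carrier D" for f g
    by (rule DD_eqI) (use that in \<open>simp_all add: lin_add[OF ev2_lin]\<close>)
  show "comult D (c \<odot>\<^bsub>D\<^esub> f) = c \<odot>\<^bsub>tensor K D D\<^esub> comult D f"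
    if "c \<in> carrier K" "f \<in> carrier D" for c f
    by (rule DD_eqI) (use that in \<open>simp_all add: lin_smult[OF ev2_lin]\<close>)
qed simp_all

lemma ev2_mult:
  assumes h: "h \<in> carrier H" and k: "k \<in> carrier H"
    and X: "X \<in> carrier (tensor K D D)" and Y: "Y \<in> carrier (tensor K D D)"
  shows "ev2 h k (X \<otimes>\<^bsub>tensor K D D\<^esub> Y) = conv2 h k X Y"
proof -
  note b = tensor_mult_bilin[OF finite_dual_nonunital finite_dual_nonunital]
  note pm = tensor_mult_pure[OF finite_dual_nonunital finite_dual_nonunital]
  have 1: "ev2 h k (pure_tensor K D D p q \<otimes>\<^bsub>tensor K D D\<^esub> Y) = conv2 h k (pure_tensor K D D p q) Y"
    if p: "p \<in> carrier D" and q: "q \<in> carrier D" for p q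
  proof (rule tensor_ext[OF lin_comp[OF ev2_lin[OF h k] bilin_lin1[OF b]] conv2_lin2[OF h k]
        finite_dual_vs finite_dual_vs Y])
    fix v w assume "v \<in> carrier D" "w \<in> carrier D"
    then show "ev2 h k (pure_tensor K D D p q \<otimes>\<^bsub>tensor K D D\<^esub> pure_tensor K D D v w)
        = conv2 h k (pure_tensor K D D p q) (pure_tensor K D D v w)"
      using p q h k by (simp add: pm ev2_pure conv2_pure del: finite_dual_ops(4))
  qed (use p q in simp_all)
  show ?thesis
    by (rule tensor_ext[OF lin_comp[OF ev2_lin[OF h k] bilin_lin2[OF b Y]] conv2_lin1[OF h k Y]
          finite_dual_vs finite_dual_vs X]) (rule 1)
qed

lemma finite_dual_comult_mult:
  assumes "f \<in> carrier D" "g \<in> carrier D"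
  shows "comult D (f \<otimes>\<^bsub>D\<^esub> g) = comult D f \<otimes>\<^bsub>tensor K D D\<^esub> comult D g"
proof (rule DD_eqI)
  show "comult D f \<otimes>\<^bsub>tensor K D D\<^esub> comult D g \<in> carrier (tensor K D D)"
    using assms by (intro tensor_mult_closed) simp_all
qed (use assms in \<open>simp_all add: ev2_mult conv2_comult del: finite_dual_ops(4)\<close>)

lemma finite_dual_coassoc:
  assumes f: "f \<in> carrier D"
  shows "tensor_assoc K D D D (tensor_map K D D (tensor K D D) D (comult D) id (comult D f))
        = tensor_map K D D D (tensor K D D) id (comult D) (comult D f)"
proof (rule DDD_eqI)
  let ?DD = "tensor K D D"
  have i: "lin K D D id" using lin_id[OF finite_dual_vs] by (simp add: id_def)
  note c = finite_dual_comult_lin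
  have X: "tensor_map K D D ?DD D (comult D) id (comult D f) \<in> carrier (tensor K ?DD D)"
    using f by (intro lin_closed[OF tensor_map_lin[OF c i]]) simp
  show "tensor_assoc K D D D (tensor_map K D D ?DD D (comult D) id (comult D f))
      \<in> carrier (tensor K D ?DD)"
    by (rule lin_closed[OF tensor_assoc_lin X]) simp_all
  show "tensor_map K D D D ?DD id (comult D) (comult D f) \<in> carrier (tensor K D ?DD)"
    using f by (intro lin_closed[OF tensor_map_lin[OF i c]]) simp
  fix h k l assume h: "h \<in> carrier H" and k: "k \<in> carrier H" and l: "l \<in> carrier H"
  have b: "bilin K D ?DD (scalars K) (\<lambda>f T. f h \<otimes>\<^bsub>K\<^esub> ev2 k l T)" using h k l by simp
  have b': "bilin K ?DD D (scalars K) (\<lambda>T f. ev2 h k T \<otimes>\<^bsub>K\<^esub> f l)" using h k l by simp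
  have "tensor_lift K D ?DD (scalars K) (\<lambda>f T. f h \<otimes>\<^bsub>K\<^esub> ev2 k l T)
      (tensor_assoc K D D D (tensor_map K D D ?DD D (comult D) id (comult D f)))
    = tensor_lift K ?DD D (scalars K) (\<lambda>T f. ev2 h k T \<otimes>\<^bsub>K\<^esub> f l)
      (tensor_map K D D ?DD D (comult D) id (comult D f))"
    unfolding lift_tensor_assoc[OF finite_dual_vs finite_dual_vs finite_dual_vs b X]
    by (rule lift_cong) (simp_all add: ev2_pure k l h R.m_assoc lift_scal_right cong: lift_cong)
  also have "\<dots> = ev2 (h \<otimes> k) l (comult D f)"
    using f h k l by (simp add: lift_tensor_map[OF c i b'] cong: lift_cong)
  also have "\<dots> = f (h \<otimes> (k \<otimes> l))" using f h k l by (simp add: mult_assoc)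
  also have "\<dots> = ev2 h (k \<otimes> l) (comult D f)" using f h k l by simp
  also have "\<dots> = tensor_lift K D ?DD (scalars K) (\<lambda>f T. f h \<otimes>\<^bsub>K\<^esub> ev2 k l T)
      (tensor_map K D D D ?DD id (comult D) (comult D f))"
    using f h k l by (simp add: lift_tensor_map[OF i c b] cong: lift_cong del: ev2_comult)
      (simp cong: lift_cong)
  finally show "tensor_lift K D ?DD (scalars K) (\<lambda>f T. f h \<otimes>\<^bsub>K\<^esub> ev2 k l T)
      (tensor_assoc K D D D (tensor_map K D D ?DD D (comult D) id (comult D f)))
    = tensor_lift K D ?DD (scalars K) (\<lambda>f T. f h \<otimes>\<^bsub>K\<^esub> ev2 k l T)
      (tensor_map K D D D ?DD id (comult D) (comult D f))" .
qed

lemma finite_dual_counit: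
  assumes f: "f \<in> carrier D"
  shows "tensor_lift K D D D (\<lambda>x y. counit D x \<odot>\<^bsub>D\<^esub> y) (comult D f) = f"
    and "tensor_lift K D D D (\<lambda>x y. counit D y \<odot>\<^bsub>D\<^esub> x) (comult D f) = f"
proof -
  have b: "bilin K D D D (\<lambda>x y. x \<one> \<odot>\<^bsub>D\<^esub> y)" "bilin K D D D (\<lambda>x y. y \<one> \<odot>\<^bsub>D\<^esub> x)"
    by simp_all
  have "tensor_lift K D D D (\<lambda>x y. x \<one> \<odot>\<^bsub>D\<^esub> y) (comult D f) h = ev2 \<one> h (comult D f)"
    if h: "h \<in> carrier H" for h
    unfolding lin_lift[OF eval_lin[OF h] b(1) finite_dual_comult_closed[OF f]]
    using h by (simp cong: lift_cong del: ev2_comult)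
  moreover have "tensor_lift K D D D (\<lambda>x y. y \<one> \<odot>\<^bsub>D\<^esub> x) (comult D f) h = ev2 h \<one> (comult D f)"
    if h: "h \<in> carrier H" for h
    unfolding lin_lift[OF eval_lin[OF h] b(2) finite_dual_comult_closed[OF f]]
    using h by (simp cong: lift_cong del: ev2_comult add: R.m_comm)
  ultimately show "tensor_lift K D D D (\<lambda>x y. counit D x \<odot>\<^bsub>D\<^esub> y) (comult D f) = f"
    and "tensor_lift K D D D (\<lambda>x y. counit D y \<odot>\<^bsub>D\<^esub> x) (comult D f) = f"
    unfolding finite_dual_simps(7)
    using f by (auto intro!: finite_dual_eqI lift_closed[OF b(1)] lift_closed[OF b(2)]
        simp: unit_left unit_right)
qed

lemma finite_dual_antipode_lin: "lin K D D (antipode D)"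
  by (rule linI) (auto intro!: finite_dual_eqI)

lemma finite_dual_antipode:
  assumes f: "f \<in> carrier D"
  shows "tensor_lift K D D D (\<lambda>x y. antipode D x \<otimes>\<^bsub>D\<^esub> y) (comult D f) = counit D f \<odot>\<^bsub>D\<^esub> \<one>\<^bsub>D\<^esub>"
    and "tensor_lift K D D D (\<lambda>x y. x \<otimes>\<^bsub>D\<^esub> antipode D y) (comult D f) = counit D f \<odot>\<^bsub>D\<^esub> \<one>\<^bsub>D\<^esub>"
proof -
  note l = lin_comp[OF finite_dual_antipode_lin]
  have b: "bilin K D D D (\<lambda>x y. antipode D x \<otimes>\<^bsub>D\<^esub> y)" "bilin K D D D (\<lambda>x y. x \<otimes>\<^bsub>D\<^esub> antipode D y)"
    by (simp_all add: l)
  have 1: "tensor_lift K D D D (\<lambda>x y. antipode D x \<otimes>\<^bsub>D\<^esub> y) (comult D f) h = f \<one> \<otimes>\<^bsub>K\<^esub> counit H h"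
    if h: "h \<in> carrier H" for h
  proof -
    have "tensor_lift K D D D (\<lambda>x y. antipode D x \<otimes>\<^bsub>D\<^esub> y) (comult D f) h
      = tensor_lift K D D (scalars K) (\<lambda>x y. tensor_lift K H H (scalars K)
          (\<lambda>h1 h2. x (antipode H h1) \<otimes>\<^bsub>K\<^esub> y h2) (comult H h)) (comult D f)"
      using h f by (simp add: lin_lift[OF eval_lin[OF h] b(1)] cong: lift_cong)
    also have "\<dots> = tensor_lift K H H (scalars K)
        (\<lambda>h1 h2. ev2 (antipode H h1) h2 (comult D f)) (comult H h)"
      by (rule lift_swap) (use h f in simp_all)
    also have "\<dots> = tensor_lift K H H (scalars K) (\<lambda>h1 h2. f (antipode H h1 \<otimes> h2)) (comult H h)"
      using f by (simp cong: lift_cong)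
    also have "\<dots> = f (tensor_lift K H H H (\<lambda>h1 h2. antipode H h1 \<otimes> h2) (comult H h))"
      by (rule lin_lift[OF finite_dual_lin[OF f], symmetric]) (use h in simp_all)
    also have "\<dots> = f \<one> \<otimes>\<^bsub>K\<^esub> counit H h"
      using f h lin_smult[OF finite_dual_lin[OF f] counit_closed[OF h] unit_closed]
      by (simp add: antipode_left R.m_comm)
    finally show ?thesis .
  qed
  have 2: "tensor_lift K D D D (\<lambda>x y. x \<otimes>\<^bsub>D\<^esub> antipode D y) (comult D f) h = f \<one> \<otimes>\<^bsub>K\<^esub> counit H h"
    if h: "h \<in> carrier H" for h
  proof -
    have "tensor_lift K D D D (\<lambda>x y. x \<otimes>\<^bsub>D\<^esub> antipode D y) (comult D f) h
      = tensor_lift K D D (scalars K) (\<lambda>x y. tensor_lift K H H (scalars K)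
          (\<lambda>h1 h2. x h1 \<otimes>\<^bsub>K\<^esub> y (antipode H h2)) (comult H h)) (comult D f)"
      using h f by (simp add: lin_lift[OF eval_lin[OF h] b(2)] cong: lift_cong)
    also have "\<dots> = tensor_lift K H H (scalars K)
        (\<lambda>h1 h2. ev2 h1 (antipode H h2) (comult D f)) (comult H h)"
      by (rule lift_swap) (use h f in simp_all)
    also have "\<dots> = tensor_lift K H H (scalars K) (\<lambda>h1 h2. f (h1 \<otimes> antipode H h2)) (comult H h)"
      using f by (simp cong: lift_cong)
    also have "\<dots> = f (tensor_lift K H H H (\<lambda>h1 h2. h1 \<otimes> antipode H h2) (comult H h))"
      by (rule lin_lift[OF finite_dual_lin[OF f], symmetric]) (use h in simp_all)
    also have "\<dots> = f \<one> \<otimes>\<^bsub>K\<^esub> counit H h"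
      using f h lin_smult[OF finite_dual_lin[OF f] counit_closed[OF h] unit_closed]
      by (simp add: antipode_right R.m_comm)
    finally show ?thesis .
  qed
  show "tensor_lift K D D D (\<lambda>x y. antipode D x \<otimes>\<^bsub>D\<^esub> y) (comult D f) = counit D f \<odot>\<^bsub>D\<^esub> \<one>\<^bsub>D\<^esub>"
    by (rule finite_dual_eqI) (use f b in \<open>simp_all add: 1 finite_dual_simps(7)\<close>)
  show "tensor_lift K D D D (\<lambda>x y. x \<otimes>\<^bsub>D\<^esub> antipode D y) (comult D f) = counit D f \<odot>\<^bsub>D\<^esub> \<one>\<^bsub>D\<^esub>"
    by (rule finite_dual_eqI) (use f b in \<open>simp_all add: 2 finite_dual_simps(7)\<close>)
qed

lemma finite_dual_hopf: "hopf_algebra K D"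
proof (intro hopf_algebra.intro finite_dual_algebra hopf_algebra_axioms.intro)
  show "comult D \<in> module_hom K D (tensor K D D)" by (rule lin_hom[OF finite_dual_comult_lin])
  show "comult D \<in> ring_hom D (tensor K D D)"
  proof (rule ring_hom_memI)
    fix f g assume f: "f \<in> carrier D" and g: "g \<in> carrier D"
    show "comult D f \<in> carrier (tensor K D D)" using f by simp
    show "comult D (f \<otimes>\<^bsub>D\<^esub> g) = comult D f \<otimes>\<^bsub>tensor K D D\<^esub> comult D g"
      by (rule finite_dual_comult_mult[OF f g])
    show "comult D (f \<oplus>\<^bsub>D\<^esub> g) = comult D f \<oplus>\<^bsub>tensor K D D\<^esub> comult D g"
      by (rule lin_add[OF finite_dual_comult_lin f g])
  next
    show "comult D \<one>\<^bsub>D\<^esub> = \<one>\<^bsub>tensor K D D\<^esub>"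
      by (rule DD_eqI) (simp_all add: ev2_pure counit_mult)
  qed
  show "counit D \<in> module_hom K D (scalars K)"
    using lin_hom[OF eval_lin[OF unit_closed]] by (simp add: finite_dual_simps(7)[abs_def])
  show "counit D \<in> ring_hom D K"
    by (rule ring_hom_memI) (simp_all add: finite_dual_simps(7) sw_one counit_one)
  show "antipode D \<in> module_hom K D D" by (rule lin_hom[OF finite_dual_antipode_lin])
qed (rule finite_dual_coassoc finite_dual_counit finite_dual_antipode; assumption)+

end

section \<open>Bimodule algebras\<close>

lemma lift_in_subspace:
  assumes b: "bilin K V W Z b" and U: "subspace K U Z" and X: "X \<in> carrier (tensor K V W)"
    and bU: "\<And>v w. \<lbrakk>v \<in> carrier V; w \<in> carrier W\<rbrakk> \<Longrightarrow> b v w \<in> U"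
  shows "tensor_lift K V W Z b X \<in> U"
  using bilin_vs(1,2)[OF b] X
proof (induction rule: tensor_induct)
  case (pure v w)
  then show ?case using bU by (simp add: lift_pure[OF b])
next
  case (add X Y)
  then show ?case using subspaceD(4)[OF U] by (simp add: lin_add[OF lift_lin[OF b]])
qed

lemma subspace_inclusion: "subspace K U V \<Longrightarrow> lin K (V\<lparr>carrier := U\<rparr>) V (\<lambda>x. x)"
  using subspaceD[of K U V] by (intro linI subspace_sub_vs) auto

lemma lin_into_subspace:
  assumes f: "lin K V W f" and U: "subspace K U W" and fU: "\<And>x. x \<in> carrier V \<Longrightarrow> f x \<in> U"
  shows "lin K V (W\<lparr>carrier := U\<rparr>) f"
  using f lin_vs(1)[OF f] fU subspace_sub_vs[OF U]
  by (intro linI) (auto simp: lin_add[OF f] lin_smult[OF f])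

lemma lin_from_subspace:
  "\<lbrakk>lin K V W f; subspace K U V\<rbrakk> \<Longrightarrow> lin K (V\<lparr>carrier := U\<rparr>) W f"
  by (rule lin_comp[OF _ subspace_inclusion])

lemma lift_subspace:
  assumes b: "bilin K V W Z b" and U: "subspace K U Z" and X: "X \<in> carrier (tensor K V W)"
    and bU: "\<And>v w. \<lbrakk>v \<in> carrier V; w \<in> carrier W\<rbrakk> \<Longrightarrow> b v w \<in> U"
  shows "tensor_lift K V W (Z\<lparr>carrier := U\<rparr>) b X = tensor_lift K V W Z b X"
proof -
  have b': "bilin K V W (Z\<lparr>carrier := U\<rparr>) b"
    using bU by (intro bilinI bilin_vs(1,2)[OF b] lin_into_subspace U bilin_lin1[OF b] bilin_lin2[OF b])
  show ?thesis using lin_lift[OF subspace_inclusion[OF U] b' X] .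
qed

context bimodule_algebra
begin

lemma vsB [simp]: "vectorspace K B" and algB [simp]: "nonunital_algebra K B"
  by (simp_all add: B.vectorspace_axioms B.nonunital_algebra_axioms)

lemma lact_lin: "h \<in> carrier L \<Longrightarrow> lin K B B (lact h)"
  by (simp add: lin_def lact_linear)

lemma lact_lin': "b \<in> carrier B \<Longrightarrow> lin K L B (\<lambda>h. lact h b)"
  by (simp add: lin_def lact_linear')

lemma ract_lin: "h \<in> carrier L \<Longrightarrow> lin K B B (\<lambda>b. ract b h)"
  by (simp add: lin_def ract_linear)

lemma ract_lin': "b \<in> carrier B \<Longrightarrow> lin K L B (ract b)"
  by (simp add: lin_def ract_linear')

lemma lact_closed [simp]: "\<lbrakk>h \<in> carrier L; b \<in> carrier B\<rbrakk> \<Longrightarrow> lact h b \<in> carrier B"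
  by (rule lin_closed[OF lact_lin])

lemma ract_closed [simp]: "\<lbrakk>h \<in> carrier L; b \<in> carrier B\<rbrakk> \<Longrightarrow> ract b h \<in> carrier B"
  by (rule lin_closed[OF ract_lin])

lemma act_lin_comp [simp]:
  "\<lbrakk>lin K V B f; h \<in> carrier L\<rbrakk> \<Longrightarrow> lin K V B (\<lambda>x. lact h (f x))"
  "\<lbrakk>lin K V L g; b \<in> carrier B\<rbrakk> \<Longrightarrow> lin K V B (\<lambda>x. lact (g x) b)"
  "\<lbrakk>lin K V B f; h \<in> carrier L\<rbrakk> \<Longrightarrow> lin K V B (\<lambda>x. ract (f x) h)"
  "\<lbrakk>lin K V L g; b \<in> carrier B\<rbrakk> \<Longrightarrow> lin K V B (\<lambda>x. ract b (g x))"
  by (rule lin_comp[OF lact_lin] lin_comp[OF lact_lin'] lin_comp[OF ract_lin] lin_comp[OF ract_lin'];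
      assumption)+

text \<open>\<open>(f \<triangleright> x) y = f\<^sub>1 \<triangleright> (x (S(f\<^sub>2) \<triangleright> y))\<close>\<close>

lemma smash_left:
  assumes f: "f \<in> carrier L" and x: "x \<in> carrier B" and y: "y \<in> carrier B"
  shows "lact f x \<otimes>\<^bsub>B\<^esub> y
    = tensor_lift K L L B (\<lambda>f1 f2. lact f1 (x \<otimes>\<^bsub>B\<^esub> lact (antipode L f2) y)) (comult L f)"
proof -
  have "tensor_lift K L L B (\<lambda>f1 f2. lact f1 (x \<otimes>\<^bsub>B\<^esub> lact (antipode L f2) y)) (comult L f)
    = tensor_lift K L L B (\<lambda>f1 w. tensor_lift K L L B
        (\<lambda>u v. lact u x \<otimes>\<^bsub>B\<^esub> lact (v \<otimes>\<^bsub>L\<^esub> antipode L w) y) (comult L f1)) (comult L f)"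
    using x y by (simp add: lact_algebra lact_mult cong: lift_cong)
  also have "\<dots> = tensor_lift K L L B (\<lambda>u f1. tensor_lift K L L B
        (\<lambda>v w. lact u x \<otimes>\<^bsub>B\<^esub> lact (v \<otimes>\<^bsub>L\<^esub> antipode L w) y) (comult L f1)) (comult L f)"
    by (rule L.sw_coassoc) (use f x y in simp_all)
  also have "\<dots> = tensor_lift K L L B (\<lambda>u f1. lact u x \<otimes>\<^bsub>B\<^esub> lact (tensor_lift K L L L
        (\<lambda>v w. v \<otimes>\<^bsub>L\<^esub> antipode L w) (comult L f1)) y) (comult L f)"
    using x y by (simp add: lin_lift[OF lact_lin'] lift_mult_left cong: lift_cong)
  also have "\<dots> = tensor_lift K L L B (\<lambda>u f1. counit L f1 \<odot>\<^bsub>B\<^esub> (lact u x \<otimes>\<^bsub>B\<^esub> y)) (comult L f)"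
    using x y by (simp add: L.antipode_right lin_smult[OF lact_lin'] lact_one B.mult_smult_right
        cong: lift_cong)
  also have "\<dots> = lact f x \<otimes>\<^bsub>B\<^esub> y"
    by (rule L.sw_counit2[OF _ f]) (use x y in simp)
  finally show ?thesis by simp
qed

text \<open>\<open>x (y \<triangleleft> g) = ((x \<triangleleft> S(g\<^sub>1)) y) \<triangleleft> g\<^sub>2\<close>\<close>

lemma smash_right:
  assumes g: "g \<in> carrier L" and x: "x \<in> carrier B" and y: "y \<in> carrier B"
  shows "x \<otimes>\<^bsub>B\<^esub> ract y g
    = tensor_lift K L L B (\<lambda>g1 g2. ract (ract x (antipode L g1) \<otimes>\<^bsub>B\<^esub> y) g2) (comult L g)"
proof -
  have "tensor_lift K L L B (\<lambda>g1 g2. ract (ract x (antipode L g1) \<otimes>\<^bsub>B\<^esub> y) g2) (comult L g)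
    = tensor_lift K L L B (\<lambda>u g2. tensor_lift K L L B
        (\<lambda>v w. ract x (antipode L u \<otimes>\<^bsub>L\<^esub> v) \<otimes>\<^bsub>B\<^esub> ract y w) (comult L g2)) (comult L g)"
    using x y by (simp add: ract_algebra ract_mult cong: lift_cong)
  also have "\<dots> = tensor_lift K L L B (\<lambda>g1 w. tensor_lift K L L B
        (\<lambda>u v. ract x (antipode L u \<otimes>\<^bsub>L\<^esub> v) \<otimes>\<^bsub>B\<^esub> ract y w) (comult L g1)) (comult L g)"
    by (rule L.sw_coassoc[symmetric]) (use g x y in simp_all)
  also have "\<dots> = tensor_lift K L L B (\<lambda>g1 w. ract x (tensor_lift K L L L
        (\<lambda>u v. antipode L u \<otimes>\<^bsub>L\<^esub> v) (comult L g1)) \<otimes>\<^bsub>B\<^esub> ract y w) (comult L g)"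
    using x y by (simp add: lin_lift[OF ract_lin'] lift_mult_right cong: lift_cong)
  also have "\<dots> = tensor_lift K L L B (\<lambda>g1 w. counit L g1 \<odot>\<^bsub>B\<^esub> (x \<otimes>\<^bsub>B\<^esub> ract y w)) (comult L g)"
    using x y by (simp add: L.antipode_left lin_smult[OF ract_lin'] ract_one B.mult_smult_left
        cong: lift_cong)
  also have "\<dots> = x \<otimes>\<^bsub>B\<^esub> ract y g"
    by (rule L.sw_counit1[OF _ g]) (use x y in simp)
  finally show ?thesis by simp
qed

lemma sub_bimodule_algebra:
  assumes U: "subspace K U B" and mult: "\<And>x y. \<lbrakk>x \<in> U; y \<in> U\<rbrakk> \<Longrightarrow> x \<otimes>\<^bsub>B\<^esub> y \<in> U"
    and l: "\<And>h x. \<lbrakk>h \<in> carrier L; x \<in> U\<rbrakk> \<Longrightarrow> lact h x \<in> U"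
    and r: "\<And>h x. \<lbrakk>h \<in> carrier L; x \<in> U\<rbrakk> \<Longrightarrow> ract x h \<in> U"
  shows "bimodule_algebra K L (B\<lparr>carrier := U\<rparr>) lact ract"
proof -
  let ?U = "B\<lparr>carrier := U\<rparr>"
  have c: "x \<in> carrier B" if "x \<in> U" for x using subspaceD(2)[OF U] that by auto
  have alg: "nonunital_algebra K ?U"
    by (intro nonunital_algebra.intro subspace_sub_vs[OF U] nonunital_algebra_axioms.intro)
      (simp_all add: mult c B.mult_assoc B.mult_add_left B.mult_add_right B.mult_smult_left
        B.mult_smult_right)
  show ?thesis
  proof (intro bimodule_algebra.intro L.hopf_algebra_axioms alg bimodule_algebra_axioms.intro)
    show "lact h \<in> module_hom K ?U ?U" if "h \<in> carrier L" for h
      using that l by (intro lin_hom lin_into_subspace lin_from_subspace lact_lin U) auto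
    show "(\<lambda>h. lact h b) \<in> module_hom K L ?U" if "b \<in> carrier ?U" for b
      using that l c by (intro lin_hom lin_into_subspace lact_lin' U) auto
    show "(\<lambda>b. ract b h) \<in> module_hom K ?U ?U" if "h \<in> carrier L" for h
      using that r by (intro lin_hom lin_into_subspace lin_from_subspace ract_lin U) auto
    show "ract b \<in> module_hom K L ?U" if "b \<in> carrier ?U" for b
      using that r c by (intro lin_hom lin_into_subspace ract_lin' U) auto
    fix h x y assume h: "h \<in> carrier L" and x: "x \<in> carrier ?U" and y: "y \<in> carrier ?U"
    show "lact h (x \<otimes>\<^bsub>?U\<^esub> y)
        = tensor_lift K L L ?U (\<lambda>h1 h2. lact h1 x \<otimes>\<^bsub>?U\<^esub> lact h2 y) (comult L h)"
      using h x y l c mult lact_algebra by (subst lift_subspace[OF _ U]) simp_all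
    show "ract (x \<otimes>\<^bsub>?U\<^esub> y) h
        = tensor_lift K L L ?U (\<lambda>h1 h2. ract x h1 \<otimes>\<^bsub>?U\<^esub> ract y h2) (comult L h)"
      using h x y r c mult ract_algebra by (subst lift_subspace[OF _ U]) simp_all
  qed (use c in \<open>auto simp: lact_one lact_mult ract_one ract_mult lact_ract\<close>)
qed

text \<open>Transport of structure along a bijective linear map\<close>

lemma bimodule_algebra_transport:
  assumes F: "lin K B C F" and bij: "bij_betw F (carrier B) (carrier C)"
    and Fm: "\<And>x y. \<lbrakk>x \<in> carrier B; y \<in> carrier B\<rbrakk> \<Longrightarrow> F (x \<otimes>\<^bsub>B\<^esub> y) = F x \<otimes>\<^bsub>C\<^esub> F y"
    and Fl: "\<And>h x. \<lbrakk>h \<in> carrier L; x \<in> carrier B\<rbrakk> \<Longrightarrow> F (lact h x) = lact' h (F x)"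
    and Fr: "\<And>h x. \<lbrakk>h \<in> carrier L; x \<in> carrier B\<rbrakk> \<Longrightarrow> F (ract x h) = ract' (F x) h"
  shows "bimodule_algebra K L C lact' ract'"
proof -
  note C = lin_vs(2)[OF F]
  interpret C: vectorspace K C by (rule C)
  have surj: "\<exists>x. x \<in> carrier B \<and> y = F x" if "y \<in> carrier C" for y
    using bij that by (auto simp: bij_betw_def)
  note Fs = lin_add[OF F, symmetric] lin_smult[OF F, symmetric] Fm[symmetric] Fl[symmetric] Fr[symmetric]
  note c = lin_closed[OF F]
  have alg: "nonunital_algebra K C"
  proof (intro nonunital_algebra.intro C nonunital_algebra_axioms.intro)
    fix X Y assume "X \<in> carrier C" "Y \<in> carrier C"
    then obtain x y where x: "x \<in> carrier B" "X = F x" and y: "y \<in> carrier B" "Y = F y" using surj by metis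
    show "X \<otimes>\<^bsub>C\<^esub> Y \<in> carrier C" using x y c by (simp add: Fs B.mult_closed)
    show "k \<odot>\<^bsub>C\<^esub> X \<otimes>\<^bsub>C\<^esub> Y = k \<odot>\<^bsub>C\<^esub> (X \<otimes>\<^bsub>C\<^esub> Y)" "X \<otimes>\<^bsub>C\<^esub> (k \<odot>\<^bsub>C\<^esub> Y) = k \<odot>\<^bsub>C\<^esub> (X \<otimes>\<^bsub>C\<^esub> Y)"
      if "k \<in> carrier K" for k
      using x y that by (simp_all add: Fs B.mult_closed B.mult_smult_left B.mult_smult_right)
    fix Z assume "Z \<in> carrier C"
    then obtain z where z: "z \<in> carrier B" "Z = F z" using surj by metis
    show "X \<otimes>\<^bsub>C\<^esub> Y \<otimes>\<^bsub>C\<^esub> Z = X \<otimes>\<^bsub>C\<^esub> (Y \<otimes>\<^bsub>C\<^esub> Z)" "(X \<oplus>\<^bsub>C\<^esub> Y) \<otimes>\<^bsub>C\<^esub> Z = X \<otimes>\<^bsub>C\<^esub> Z \<oplus>\<^bsub>C\<^esub> Y \<otimes>\<^bsub>C\<^esub> Z"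
      "X \<otimes>\<^bsub>C\<^esub> (Y \<oplus>\<^bsub>C\<^esub> Z) = X \<otimes>\<^bsub>C\<^esub> Y \<oplus>\<^bsub>C\<^esub> X \<otimes>\<^bsub>C\<^esub> Z"
      using x y z by (simp_all add: Fs B.mult_closed B.mult_assoc B.mult_add_left B.mult_add_right)
  qed
  show ?thesis
  proof (intro bimodule_algebra.intro L.hopf_algebra_axioms alg bimodule_algebra_axioms.intro)
    fix h assume h: "h \<in> carrier L"
    show "lact' h \<in> module_hom K C C"
    proof (rule lin_hom, rule linI[OF C C])
      fix X assume "X \<in> carrier C"
      then obtain x where x: "x \<in> carrier B" "X = F x" using surj by metis
      show "lact' h X \<in> carrier C" using x h c by (simp add: Fs)
      show "lact' h (k \<odot>\<^bsub>C\<^esub> X) = k \<odot>\<^bsub>C\<^esub> lact' h X" if "k \<in> carrier K" for k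
        using x h that by (simp add: Fs lin_smult[OF lact_lin])
      fix Y assume "Y \<in> carrier C"
      then obtain y where y: "y \<in> carrier B" "Y = F y" using surj by metis
      show "lact' h (X \<oplus>\<^bsub>C\<^esub> Y) = lact' h X \<oplus>\<^bsub>C\<^esub> lact' h Y"
        using x y h by (simp add: Fs lin_add[OF lact_lin])
    qed
    show "(\<lambda>X. ract' X h) \<in> module_hom K C C"
    proof (rule lin_hom, rule linI[OF C C])
      fix X assume "X \<in> carrier C"
      then obtain x where x: "x \<in> carrier B" "X = F x" using surj by metis
      show "ract' X h \<in> carrier C" using x h c by (simp add: Fs)
      show "ract' (k \<odot>\<^bsub>C\<^esub> X) h = k \<odot>\<^bsub>C\<^esub> ract' X h" if "k \<in> carrier K" for k
        using x h that by (simp add: Fs lin_smult[OF ract_lin])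
      fix Y assume "Y \<in> carrier C"
      then obtain y where y: "y \<in> carrier B" "Y = F y" using surj by metis
      show "ract' (X \<oplus>\<^bsub>C\<^esub> Y) h = ract' X h \<oplus>\<^bsub>C\<^esub> ract' Y h"
        using x y h by (simp add: Fs lin_add[OF ract_lin])
    qed
  next
    fix X assume "X \<in> carrier C"
    then obtain x where x: "x \<in> carrier B" "X = F x" using surj by metis
    have "lin K L C (\<lambda>h. F (lact h x))" "lin K L C (\<lambda>h. F (ract x h))"
      by (rule lin_comp[OF F lact_lin'[OF x(1)]], rule lin_comp[OF F ract_lin'[OF x(1)]])
    then show "(\<lambda>h. lact' h X) \<in> module_hom K L C" "ract' X \<in> module_hom K L C"
      using lin_cong[of L "\<lambda>h. F (lact h x)" "\<lambda>h. lact' h X" K C]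
        lin_cong[of L "\<lambda>h. F (ract x h)" "ract' X" K C] x
      by (auto intro!: lin_hom simp: Fl Fr)
    show "lact' \<one>\<^bsub>L\<^esub> X = X" "ract' X \<one>\<^bsub>L\<^esub> = X"
      using x by (simp_all add: Fs lact_one ract_one)
    fix h k assume h: "h \<in> carrier L" and k: "k \<in> carrier L"
    show "lact' (h \<otimes>\<^bsub>L\<^esub> k) X = lact' h (lact' k X)" "ract' X (h \<otimes>\<^bsub>L\<^esub> k) = ract' (ract' X h) k"
      "ract' (lact' h X) k = lact' h (ract' X k)"
      using x h k by (simp_all add: Fs lact_mult ract_mult lact_ract)
  next
    fix h X Y assume h: "h \<in> carrier L" and "X \<in> carrier C" "Y \<in> carrier C"
    then obtain x y where x: "x \<in> carrier B" "X = F x" and y: "y \<in> carrier B" "Y = F y" using surj by metis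
    show "lact' h (X \<otimes>\<^bsub>C\<^esub> Y)
        = tensor_lift K L L C (\<lambda>h1 h2. lact' h1 X \<otimes>\<^bsub>C\<^esub> lact' h2 Y) (comult L h)"
      using x y h by (simp add: Fs B.mult_closed lact_algebra lin_lift[OF F] cong: lift_cong)
    show "ract' (X \<otimes>\<^bsub>C\<^esub> Y) h
        = tensor_lift K L L C (\<lambda>h1 h2. ract' X h1 \<otimes>\<^bsub>C\<^esub> ract' Y h2) (comult L h)"
      using x y h by (simp add: Fs B.mult_closed ract_algebra lin_lift[OF F] cong: lift_cong)
  qed
qed

text \<open>The span \<open>L \<triangleright> X \<triangleleft> L\<close> is a subalgebra as soon as it contains the products
  \<open>(x \<triangleleft> p)(u \<triangleright> y)\<close> with \<open>x\<close>, \<open>y\<close> in \<open>X\<close>: by \<open>smash_left\<close> and \<open>smash_right\<close> all products of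
  generators reduce to these.\<close>

lemma bimodule_span_algebra:
  assumes X: "X \<subseteq> carrier B"
    and mult: "\<And>x y p u. \<lbrakk>x \<in> X; y \<in> X; p \<in> carrier L; u \<in> carrier L\<rbrakk>
      \<Longrightarrow> ract x p \<otimes>\<^bsub>B\<^esub> lact u y \<in> carrier (bimodule_span K L B lact ract X)"
  shows "subspace K (carrier (bimodule_span K L B lact ract X)) B"
    and "bimodule_algebra K L (bimodule_span K L B lact ract X) lact ract"
proof -
  define G where "G = {ract (lact f x) g | f x g. f \<in> carrier L \<and> g \<in> carrier L \<and> x \<in> X}"
  define U where "U = module.span K B G"
  have span: "bimodule_span K L B lact ract X = B\<lparr>carrier := U\<rparr>"
    unfolding bimodule_span_def U_def G_def ..
  have Xc: "x \<in> carrier B" if "x \<in> X" for x using X that by (rule subsetD)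
  have G: "G \<subseteq> carrier B" using Xc by (auto simp: G_def)
  have U: "subspace K U B" and GU: "G \<subseteq> U" unfolding U_def by (rule span_subspace[OF vsB G])+
  have Uc: "x \<in> carrier B" if "x \<in> U" for x using subspaceD(2)[OF U] that by (rule subsetD)
  have GI: "ract (lact f x) g \<in> G" if "f \<in> carrier L" "g \<in> carrier L" "x \<in> X" for f g x
    using that unfolding G_def by blast
  have least: "F x \<in> U" if F: "lin K B B F" and "\<And>x. x \<in> G \<Longrightarrow> F x \<in> U" and x: "x \<in> U" for F x
  proof -
    have "G \<subseteq> {x \<in> carrier B. F x \<in> U}" using G that(2) by blast
    from span_least[OF lin_preimage_subspace[OF F U] this] show ?thesis using x unfolding U_def by blast
  qed
  have l: "lact h x \<in> U" if h: "h \<in> carrier L" and x: "x \<in> U" for h x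
  proof (rule least[OF lact_lin[OF h] _ x])
    fix y assume "y \<in> G"
    then obtain f g z where y: "y = ract (lact f z) g" "f \<in> carrier L" "g \<in> carrier L" "z \<in> X"
      unfolding G_def by blast
    then have "lact h y = ract (lact (h \<otimes>\<^bsub>L\<^esub> f) z) g" using h Xc by (simp add: lact_mult lact_ract)
    moreover have "\<dots> \<in> G" by (rule GI) (use h y in simp_all)
    ultimately show "lact h y \<in> U" using GU by auto
  qed
  have r: "ract x h \<in> U" if h: "h \<in> carrier L" and x: "x \<in> U" for h x
  proof (rule least[OF ract_lin[OF h] _ x])
    fix y assume "y \<in> G"
    then obtain f g z where y: "y = ract (lact f z) g" "f \<in> carrier L" "g \<in> carrier L" "z \<in> X"
      unfolding G_def by blast
    then have "ract y h = ract (lact f z) (g \<otimes>\<^bsub>L\<^esub> h)" using h Xc by (simp add: ract_mult)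
    moreover have "\<dots> \<in> G" by (rule GI) (use h y in simp_all)
    ultimately show "ract y h \<in> U" using GU by auto
  qed
  have m1: "ract x p \<otimes>\<^bsub>B\<^esub> ract (lact u y) g \<in> U"
    if "x \<in> X" "y \<in> X" "p \<in> carrier L" "u \<in> carrier L" "g \<in> carrier L" for x y p u g
  proof -
    note c = Xc[OF that(1)] Xc[OF that(2)]
    have "ract x p \<otimes>\<^bsub>B\<^esub> ract (lact u y) g = tensor_lift K L L B
        (\<lambda>g1 g2. ract (ract x (p \<otimes>\<^bsub>L\<^esub> antipode L g1) \<otimes>\<^bsub>B\<^esub> lact u y) g2) (comult L g)"
      using that c by (simp add: smash_right[of g] ract_mult cong: lift_cong)
    also have "\<dots> \<in> U"
    proof (rule lift_in_subspace[OF _ U])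
      fix g1 g2 assume g: "g1 \<in> carrier L" "g2 \<in> carrier L"
      have "ract x (p \<otimes>\<^bsub>L\<^esub> antipode L g1) \<otimes>\<^bsub>B\<^esub> lact u y \<in> carrier (bimodule_span K L B lact ract X)"
        by (rule mult) (use g that in simp_all)
      then show "ract (ract x (p \<otimes>\<^bsub>L\<^esub> antipode L g1) \<otimes>\<^bsub>B\<^esub> lact u y) g2 \<in> U"
        using g by (intro r) (simp_all add: span)
    qed (use that c in \<open>simp_all add: B.mult_closed ract_lin'\<close>)
    finally show ?thesis .
  qed
  have m2: "ract (lact f x) p \<otimes>\<^bsub>B\<^esub> ract (lact u y) g \<in> U"
    if "x \<in> X" "y \<in> X" "f \<in> carrier L" "p \<in> carrier L" "u \<in> carrier L" "g \<in> carrier L" for f x y p u g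
  proof -
    note c = Xc[OF that(1)] Xc[OF that(2)]
    have "ract (lact f x) p \<otimes>\<^bsub>B\<^esub> ract (lact u y) g = tensor_lift K L L B
        (\<lambda>f1 f2. lact f1 (ract x p \<otimes>\<^bsub>B\<^esub> ract (lact (antipode L f2 \<otimes>\<^bsub>L\<^esub> u) y) g)) (comult L f)"
      using that c by (simp add: lact_ract smash_left[of f] lact_mult cong: lift_cong)
    also have "\<dots> \<in> U"
      by (rule lift_in_subspace[OF _ U]) (use that c in \<open>simp_all add: B.mult_closed lact_lin' l m1\<close>)
    finally show ?thesis .
  qed
  have m3: "x \<otimes>\<^bsub>B\<^esub> y \<in> U" if x: "x \<in> U" and y: "y \<in> U" for x y
  proof -
    have "lin K B B (\<lambda>x. x \<otimes>\<^bsub>B\<^esub> y)" using Uc[OF y] by simp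
    moreover have "v \<otimes>\<^bsub>B\<^esub> y \<in> U" if v: "v \<in> G" for v
    proof -
      have "lin K B B (\<lambda>y. v \<otimes>\<^bsub>B\<^esub> y)" using subsetD[OF G v] by simp
      moreover have "v \<otimes>\<^bsub>B\<^esub> w \<in> U" if "w \<in> G" for w
        using v that m2 unfolding G_def by blast
      ultimately show ?thesis using y by (rule least)
    qed
    ultimately show ?thesis using x by (rule least)
  qed
  show "subspace K (carrier (bimodule_span K L B lact ract X)) B" using U by (simp add: span)
  show "bimodule_algebra K L (bimodule_span K L B lact ract X) lact ract"
    unfolding span by (rule sub_bimodule_algebra[OF U m3 l r])
qed

lemma bimodule_span_base:
  assumes "X \<subseteq> carrier B" "x \<in> X"
  shows "x \<in> carrier (bimodule_span K L B lact ract X)"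
proof -
  let ?G = "{ract (lact f x) g | f x g. f \<in> carrier L \<and> g \<in> carrier L \<and> x \<in> X}"
  have "?G \<subseteq> carrier B" using assms(1) by auto
  from span_subspace(2)[OF vsB this]
  have "ract (lact \<one>\<^bsub>L\<^esub> x) \<one>\<^bsub>L\<^esub> \<in> carrier (bimodule_span K L B lact ract X)"
    unfolding bimodule_span_def using assms(2) L.unit_closed by fastforce
  then show ?thesis using subsetD[OF assms] by (simp add: lact_one ract_one)
qed

end

section \<open>The vector space \<open>Hom (L \<otimes> L, A)\<close>\<close>

lemma hom_algebra_vs:
  assumes L: "vectorspace K L" and A: "vectorspace K A"
  shows "vectorspace K (hom_algebra K L A)"
proof -
  let ?Hom = "hom_algebra K L A" and ?T = "tensor K L L"
  interpret A: vectorspace K A by (rule A)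
  interpret T: vectorspace K ?T by (rule tensor_vs[OF L L])
  note T = T.vectorspace_axioms
  have mem: "\<alpha> \<in> carrier ?Hom \<longleftrightarrow> \<alpha> \<in> extensional (carrier ?T) \<and> lin K ?T A \<alpha>" for \<alpha>
    using A T by (simp add: hom_algebra_def Let_def lin_def)
  have ops: "\<alpha> \<oplus>\<^bsub>?Hom\<^esub> \<beta> = (\<lambda>X\<in>carrier ?T. \<alpha> X \<oplus>\<^bsub>A\<^esub> \<beta> X)"
    "c \<odot>\<^bsub>?Hom\<^esub> \<alpha> = (\<lambda>X\<in>carrier ?T. c \<odot>\<^bsub>A\<^esub> \<alpha> X)" "\<zero>\<^bsub>?Hom\<^esub> = (\<lambda>X\<in>carrier ?T. \<zero>\<^bsub>A\<^esub>)" for \<alpha> \<beta> c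
    by (simp_all add: hom_algebra_def Let_def)
  have res: "lin K ?T A (\<lambda>X\<in>carrier ?T. \<alpha> X)" if "lin K ?T A \<alpha>" for \<alpha>
    using that by (rule iffD2[OF lin_cong, rotated]) simp
  have c: "\<alpha> X \<in> carrier A" if "\<alpha> \<in> carrier ?Hom" "X \<in> carrier ?T" for \<alpha> X
    using that lin_closed[of K ?T A \<alpha> X] by (simp add: mem)
  have r: "(\<lambda>X\<in>carrier ?T. \<alpha> X) = \<alpha>" if "\<alpha> \<in> carrier ?Hom" for \<alpha>
    using that by (simp add: mem extensional_restrict)
  have z: "lin K ?T A (\<lambda>X. \<zero>\<^bsub>A\<^esub>)" by (rule linI[OF T A]) simp_all
  have closed: "\<alpha> \<oplus>\<^bsub>?Hom\<^esub> \<beta> \<in> carrier ?Hom" "k \<odot>\<^bsub>?Hom\<^esub> \<alpha> \<in> carrier ?Hom" "\<zero>\<^bsub>?Hom\<^esub> \<in> carrier ?Hom"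
    if "\<alpha> \<in> carrier ?Hom" "\<beta> \<in> carrier ?Hom" "k \<in> carrier K" for \<alpha> \<beta> k
    using that by (simp_all add: mem ops res lin_sum lin_smult_const z)
  have z': "\<zero>\<^bsub>?Hom\<^esub> \<in> carrier ?Hom" by (simp add: mem ops res z)
  show ?thesis
  proof (rule vs_criteria[OF A.field_axioms])
    show "\<forall>v\<in>carrier ?Hom. \<exists>w\<in>carrier ?Hom. v \<oplus>\<^bsub>?Hom\<^esub> w = \<zero>\<^bsub>?Hom\<^esub>"
    proof
      fix v assume v: "v \<in> carrier ?Hom"
      have "v \<oplus>\<^bsub>?Hom\<^esub> ((\<ominus>\<^bsub>K\<^esub> \<one>\<^bsub>K\<^esub>) \<odot>\<^bsub>?Hom\<^esub> v) = \<zero>\<^bsub>?Hom\<^esub>"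
        using c[OF v] by (auto simp: ops A.smult_l_minus A.M.r_neg intro!: restrict_ext)
      then show "\<exists>w\<in>carrier ?Hom. v \<oplus>\<^bsub>?Hom\<^esub> w = \<zero>\<^bsub>?Hom\<^esub>"
        using closed(2)[OF v v, of "\<ominus>\<^bsub>K\<^esub> \<one>\<^bsub>K\<^esub>"] by auto
    qed
    show "\<forall>v\<in>carrier ?Hom. v \<oplus>\<^bsub>?Hom\<^esub> \<zero>\<^bsub>?Hom\<^esub> = v"
      using c r by (auto simp: ops cong: restrict_cong)
    show "\<forall>v\<in>carrier ?Hom. \<one>\<^bsub>K\<^esub> \<odot>\<^bsub>?Hom\<^esub> v = v"
      using c r by (auto simp: ops cong: restrict_cong)
  qed (use closed(1,2) z' c in
    \<open>auto simp: ops(1,2) A.M.a_ac A.smult_assoc1 A.smult_l_distr A.smult_r_distr intro!: restrict_ext\<close>)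
qed

section \<open>Evaluation of tensors at functionals\<close>

text \<open>The analogue of \<open>tensor_separation\<close> for functionals on the second factor, by exchange of the factors\<close>

lemma tensor_separation_right:
  assumes V: "vectorspace K V" and W: "vectorspace K W"
    and F: "\<And>f. f \<in> F \<Longrightarrow> lin K W (scalars K) f"
    and sep: "\<And>w. \<lbrakk>w \<in> carrier W; \<And>f. f \<in> F \<Longrightarrow> f w = \<zero>\<^bsub>K\<^esub>\<rbrakk> \<Longrightarrow> w = \<zero>\<^bsub>W\<^esub>"
    and X: "X \<in> carrier (tensor K V W)" and Y: "Y \<in> carrier (tensor K V W)"
    and eq: "\<And>f. f \<in> F \<Longrightarrow> tensor_lift K V W V (\<lambda>v w. f w \<odot>\<^bsub>V\<^esub> v) X
      = tensor_lift K V W V (\<lambda>v w. f w \<odot>\<^bsub>V\<^esub> v) Y"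
  shows "X = Y"
proof -
  let ?s = "tensor_lift K V W (tensor K W V) (\<lambda>v w. pure_tensor K W V w v)"
  let ?t = "tensor_lift K W V (tensor K V W) (\<lambda>w v. pure_tensor K V W v w)"
  have s: "bilin K V W (tensor K W V) (\<lambda>v w. pure_tensor K W V w v)"
    and t: "bilin K W V (tensor K V W) (\<lambda>w v. pure_tensor K V W v w)"
    using V W by (simp_all add: lin_rules)
  have ts: "?t (?s Z) = Z" if Z: "Z \<in> carrier (tensor K V W)" for Z
    by (rule tensor_ext[OF lin_comp[OF lift_lin[OF t] lift_lin[OF s]] lin_id[OF tensor_vs[OF V W]] V W Z])
      (simp add: lift_pure[OF s] lift_pure[OF t])
  have e: "tensor_lift K W V V (\<lambda>w v. f w \<odot>\<^bsub>V\<^esub> v) (?s Z) = tensor_lift K V W V (\<lambda>v w. f w \<odot>\<^bsub>V\<^esub> v) Z"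
    if f: "f \<in> F" and Z: "Z \<in> carrier (tensor K V W)" for f Z
    unfolding lin_lift[OF lift_lin[OF eval_bilin[OF F[OF f] V]] s Z]
    by (rule lift_cong) (simp_all add: lift_pure[OF eval_bilin[OF F[OF f] V]])
  have "?s X = ?s Y"
  proof (rule tensor_separation[OF W V F sep lift_closed[OF s X] lift_closed[OF s Y]])
    fix f assume f: "f \<in> F"
    show "tensor_lift K W V V (\<lambda>w v. f w \<odot>\<^bsub>V\<^esub> v) (?s X)
        = tensor_lift K W V V (\<lambda>w v. f w \<odot>\<^bsub>V\<^esub> v) (?s Y)"
      unfolding e[OF f X] e[OF f Y] by (rule eq[OF f])
  qed
  then show ?thesis using ts[OF X] ts[OF Y] by metis
qed

lemma tensor_ext2:
  assumes P: "bilin K (tensor K V W) (tensor K V' W') Z P" and Q: "bilin K (tensor K V W) (tensor K V' W') Z Q"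
    and vs: "vectorspace K V" "vectorspace K W" "vectorspace K V'" "vectorspace K W'"
    and X: "X \<in> carrier (tensor K V W)" and Y: "Y \<in> carrier (tensor K V' W')"
    and eq: "\<And>v w v' w'. \<lbrakk>v \<in> carrier V; w \<in> carrier W; v' \<in> carrier V'; w' \<in> carrier W'\<rbrakk>
      \<Longrightarrow> P (pure_tensor K V W v w) (pure_tensor K V' W' v' w')
        = Q (pure_tensor K V W v w) (pure_tensor K V' W' v' w')"
  shows "P X Y = Q X Y"
proof (rule tensor_ext[OF bilin_lin2[OF P Y] bilin_lin2[OF Q Y] vs(1,2) X])
  fix v w assume v: "v \<in> carrier V" and w: "w \<in> carrier W"
  have p: "pure_tensor K V W v w \<in> carrier (tensor K V W)" by (rule pure_closed[OF vs(1,2) v w])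
  show "P (pure_tensor K V W v w) Y = Q (pure_tensor K V W v w) Y"
    by (rule tensor_ext[OF bilin_lin1[OF P p] bilin_lin1[OF Q p] vs(3,4) Y]) (rule eq[OF v w])
qed

context partial_bicomodule_algebra
begin

text \<open>\<open>H\<^sup>0\<close>, \<open>A \<otimes> H\<close> and \<open>H \<otimes> A\<close>\<close>

abbreviation D where "D \<equiv> finite_dual K H"
abbreviation AH where "AH \<equiv> tensor K A H"
abbreviation HA where "HA \<equiv> tensor K H A"

interpretation D: hopf_algebra K D by (rule H.finite_dual_hopf)

lemma vsA [simp]: "vectorspace K A" and algA [simp]: "nonunital_algebra K A"
  by (rule A.vectorspace_axioms A.nonunital_algebra_axioms)+

lemma algAH [simp]: "nonunital_algebra K AH" and algHA [simp]: "nonunital_algebra K HA"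
  and algHH [simp]: "nonunital_algebra K (tensor K H H)"
  by (simp_all add: tensor_algebra)

lemma algHAH [simp]: "nonunital_algebra K (tensor K H AH)"
  and algHHA [simp]: "nonunital_algebra K (tensor K H HA)"
  and algAHH [simp]: "nonunital_algebra K (tensor K A (tensor K H H))"
  by (simp_all add: tensor_algebra)

lemmas [simp] = A.mult_closed A.unit_closed tensor_mult_closed

lemma rho_lin: "lin K A AH rho" and lam_lin: "lin K A HA lam"
  by (simp_all add: lin_def rho_linear lam_linear)

lemmas [simp] = lin_comp[OF rho_lin] lin_comp[OF lam_lin] rho_lin lam_lin

lemma rho_closed [simp]: "a \<in> carrier A \<Longrightarrow> rho a \<in> carrier AH"
  and lam_closed [simp]: "a \<in> carrier A \<Longrightarrow> lam a \<in> carrier HA"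
  by (rule lin_closed[OF rho_lin] lin_closed[OF lam_lin]; assumption)+

text \<open>\<open>id \<otimes> f : A \<otimes> H \<rightarrow> A\<close> and \<open>g \<otimes> id : H \<otimes> A \<rightarrow> A\<close>\<close>

definition evR where "evR f X = tensor_lift K A H A (\<lambda>b h. f h \<odot>\<^bsub>A\<^esub> b) X"
definition evL where "evL g X = tensor_lift K H A A (\<lambda>h b. g h \<odot>\<^bsub>A\<^esub> b) X"

text \<open>The map \<open>g \<otimes> id \<otimes> f : H \<otimes> A \<otimes> H \<rightarrow> A\<close>. The order of \<open>f\<close> and \<open>g\<close> is that of the arguments of
  \<open>\<Psi>(Y)(f \<otimes> g)\<close>, and \<open>hat f g Y\<close> is written \<open>Y^(f, g)\<close> below.\<close>

definition hat where "hat f g Y = tensor_lift K H AH A (\<lambda>h X. g h \<odot>\<^bsub>A\<^esub> evR f X) Y"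

lemma evR_lin: "f \<in> carrier D \<Longrightarrow> lin K AH A (evR f)"
  unfolding evR_def[abs_def] by (rule lift_lin) simp

lemma evR_lin': "X \<in> carrier AH \<Longrightarrow> lin K D A (\<lambda>f. evR f X)"
  unfolding evR_def by simp

lemma evL_lin: "g \<in> carrier D \<Longrightarrow> lin K HA A (evL g)"
  unfolding evL_def[abs_def] by (rule lift_lin) simp

lemma evL_lin': "X \<in> carrier HA \<Longrightarrow> lin K D A (\<lambda>g. evL g X)"
  unfolding evL_def by simp

lemma ev_closed [simp]:
  "\<lbrakk>f \<in> carrier D; X \<in> carrier AH\<rbrakk> \<Longrightarrow> evR f X \<in> carrier A"
  "\<lbrakk>f \<in> carrier D; Y \<in> carrier HA\<rbrakk> \<Longrightarrow> evL f Y \<in> carrier A"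
  by (rule lin_closed[OF evR_lin] lin_closed[OF evL_lin]; assumption)+

lemma ev_lin [simp]:
  "\<lbrakk>f \<in> carrier D; lin K V AH F\<rbrakk> \<Longrightarrow> lin K V A (\<lambda>x. evR f (F x))"
  "\<lbrakk>X \<in> carrier AH; lin K V D G\<rbrakk> \<Longrightarrow> lin K V A (\<lambda>x. evR (G x) X)"
  "\<lbrakk>f \<in> carrier D; lin K V HA F'\<rbrakk> \<Longrightarrow> lin K V A (\<lambda>x. evL f (F' x))"
  "\<lbrakk>Y \<in> carrier HA; lin K V D G\<rbrakk> \<Longrightarrow> lin K V A (\<lambda>x. evL (G x) Y)"
  by (rule lin_comp[OF evR_lin] lin_comp[OF evR_lin'] lin_comp[OF evL_lin] lin_comp[OF evL_lin'];
      assumption)+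

lemma evR_pure: "\<lbrakk>f \<in> carrier D; a \<in> carrier A; h \<in> carrier H\<rbrakk>
    \<Longrightarrow> evR f (pure_tensor K A H a h) = f h \<odot>\<^bsub>A\<^esub> a"
  unfolding evR_def by (rule lift_pure) simp_all

lemma evL_pure: "\<lbrakk>f \<in> carrier D; a \<in> carrier A; h \<in> carrier H\<rbrakk>
    \<Longrightarrow> evL f (pure_tensor K H A h a) = f h \<odot>\<^bsub>A\<^esub> a"
  unfolding evL_def by (rule lift_pure) simp_all

lemma hat_bilin: "\<lbrakk>f \<in> carrier D; g \<in> carrier D\<rbrakk> \<Longrightarrow> bilin K H AH A (\<lambda>h X. g h \<odot>\<^bsub>A\<^esub> evR f X)"
  by simp

lemma hat_lin: "\<lbrakk>f \<in> carrier D; g \<in> carrier D\<rbrakk> \<Longrightarrow> lin K (tensor K H AH) A (hat f g)"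
  unfolding hat_def[abs_def] by (rule lift_lin[OF hat_bilin])

lemma hat_lin1: "\<lbrakk>Y \<in> carrier (tensor K H AH); g \<in> carrier D\<rbrakk> \<Longrightarrow> lin K D A (\<lambda>f. hat f g Y)"
  unfolding hat_def by simp

lemma hat_lin2: "\<lbrakk>Y \<in> carrier (tensor K H AH); f \<in> carrier D\<rbrakk> \<Longrightarrow> lin K D A (\<lambda>g. hat f g Y)"
  unfolding hat_def by simp

lemma hat_closed [simp]:
  "\<lbrakk>f \<in> carrier D; g \<in> carrier D; Y \<in> carrier (tensor K H AH)\<rbrakk> \<Longrightarrow> hat f g Y \<in> carrier A"
  by (rule lin_closed[OF hat_lin])

lemma hat_lin_comp [simp]:
  "\<lbrakk>f \<in> carrier D; g \<in> carrier D; lin K V (tensor K H AH) F\<rbrakk> \<Longrightarrow> lin K V A (\<lambda>x. hat f g (F x))"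
  "\<lbrakk>Y \<in> carrier (tensor K H AH); g \<in> carrier D; lin K V D G\<rbrakk> \<Longrightarrow> lin K V A (\<lambda>x. hat (G x) g Y)"
  "\<lbrakk>Y \<in> carrier (tensor K H AH); f \<in> carrier D; lin K V D G\<rbrakk> \<Longrightarrow> lin K V A (\<lambda>x. hat f (G x) Y)"
  by (rule lin_comp[OF hat_lin] lin_comp[OF hat_lin1] lin_comp[OF hat_lin2]; assumption)+

lemma hat_pure: "\<lbrakk>f \<in> carrier D; g \<in> carrier D; h \<in> carrier H; X \<in> carrier AH\<rbrakk>
    \<Longrightarrow> hat f g (pure_tensor K H AH h X) = g h \<odot>\<^bsub>A\<^esub> evR f X"
  unfolding hat_def by (rule lift_pure[OF hat_bilin])

subsection \<open>Evaluation of products\<close>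

lemma smult_mult: "\<lbrakk>c \<in> carrier K; d \<in> carrier K; a \<in> carrier A; b \<in> carrier A\<rbrakk>
    \<Longrightarrow> (c \<odot>\<^bsub>A\<^esub> a) \<otimes>\<^bsub>A\<^esub> (d \<odot>\<^bsub>A\<^esub> b) = (c \<otimes>\<^bsub>K\<^esub> d) \<odot>\<^bsub>A\<^esub> (a \<otimes>\<^bsub>A\<^esub> b)"
  by (simp add: A.mult_smult_left A.mult_smult_right A.smult_assoc1[symmetric] H.R.m_comm)

lemma lift_mult_mult:
  assumes f: "f \<in> carrier D" and h: "h \<in> carrier H" and k: "k \<in> carrier H" and a: "a \<in> carrier A"
  shows "tensor_lift K D D A (\<lambda>f1 f2. (f1 h \<otimes>\<^bsub>K\<^esub> f2 k) \<odot>\<^bsub>A\<^esub> a) (comult D f) = f (h \<otimes>\<^bsub>H\<^esub> k) \<odot>\<^bsub>A\<^esub> a"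
  using f h k a lift_smult_right[of K D D "\<lambda>f1 f2. f1 h \<otimes>\<^bsub>K\<^esub> f2 k" "comult D f" A a] by simp

lemma evR_mult:
  assumes f: "f \<in> carrier D" and X: "X \<in> carrier AH" and Y: "Y \<in> carrier AH"
  shows "evR f (X \<otimes>\<^bsub>AH\<^esub> Y)
    = tensor_lift K D D A (\<lambda>f1 f2. evR f1 X \<otimes>\<^bsub>A\<^esub> evR f2 Y) (comult D f)"
proof (rule tensor_ext2[where Z = A, OF _ _ _ _ _ _ X Y])
  fix a h b k assume "a \<in> carrier A" "h \<in> carrier H" "b \<in> carrier A" "k \<in> carrier H"
  then show "evR f (pure_tensor K A H a h \<otimes>\<^bsub>AH\<^esub> pure_tensor K A H b k)
    = tensor_lift K D D A (\<lambda>f1 f2. evR f1 (pure_tensor K A H a h) \<otimes>\<^bsub>A\<^esub> evR f2 (pure_tensor K A H b k))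
        (comult D f)"
    using f by (simp add: tensor_mult_pure evR_pure smult_mult lift_mult_mult cong: lift_cong)
qed (use f in simp_all)

lemma evL_mult:
  assumes f: "f \<in> carrier D" and X: "X \<in> carrier HA" and Y: "Y \<in> carrier HA"
  shows "evL f (X \<otimes>\<^bsub>HA\<^esub> Y)
    = tensor_lift K D D A (\<lambda>f1 f2. evL f1 X \<otimes>\<^bsub>A\<^esub> evL f2 Y) (comult D f)"
proof (rule tensor_ext2[where Z = A, OF _ _ _ _ _ _ X Y])
  fix h a k b assume "a \<in> carrier A" "h \<in> carrier H" "b \<in> carrier A" "k \<in> carrier H"
  then show "evL f (pure_tensor K H A h a \<otimes>\<^bsub>HA\<^esub> pure_tensor K H A k b)
    = tensor_lift K D D A (\<lambda>f1 f2. evL f1 (pure_tensor K H A h a) \<otimes>\<^bsub>A\<^esub> evL f2 (pure_tensor K H A k b))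
        (comult D f)"
    using f by (simp add: tensor_mult_pure evL_pure smult_mult lift_mult_mult cong: lift_cong)
qed (use f in simp_all)

text \<open>\<open>(XY)^(f, g) = X^(f\<^sub>1, g\<^sub>1) Y^(f\<^sub>2, g\<^sub>2)\<close>\<close>

lemma hat_mult:
  assumes f: "f \<in> carrier D" and g: "g \<in> carrier D"
    and X: "X \<in> carrier (tensor K H AH)" and Y: "Y \<in> carrier (tensor K H AH)"
  shows "hat f g (X \<otimes>\<^bsub>tensor K H AH\<^esub> Y) = tensor_lift K D D A (\<lambda>f1 f2.
    tensor_lift K D D A (\<lambda>g1 g2. hat f1 g1 X \<otimes>\<^bsub>A\<^esub> hat f2 g2 Y) (comult D g)) (comult D f)"
proof (rule tensor_ext2[where Z = A, OF _ _ _ _ _ _ X Y])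
  fix h V k W assume h: "h \<in> carrier H" "V \<in> carrier AH" "k \<in> carrier H" "W \<in> carrier AH"
  have "tensor_lift K D D A (\<lambda>f1 f2. tensor_lift K D D A (\<lambda>g1 g2.
      hat f1 g1 (pure_tensor K H AH h V) \<otimes>\<^bsub>A\<^esub> hat f2 g2 (pure_tensor K H AH k W)) (comult D g)) (comult D f)
    = tensor_lift K D D A (\<lambda>f1 f2. g (h \<otimes>\<^bsub>H\<^esub> k) \<odot>\<^bsub>A\<^esub> (evR f1 V \<otimes>\<^bsub>A\<^esub> evR f2 W)) (comult D f)"
    using h f g by (simp add: hat_pure smult_mult lift_mult_mult cong: lift_cong)
  then show "hat f g (pure_tensor K H AH h V \<otimes>\<^bsub>tensor K H AH\<^esub> pure_tensor K H AH k W)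
    = tensor_lift K D D A (\<lambda>f1 f2. tensor_lift K D D A (\<lambda>g1 g2.
      hat f1 g1 (pure_tensor K H AH h V) \<otimes>\<^bsub>A\<^esub> hat f2 g2 (pure_tensor K H AH k W)) (comult D g)) (comult D f)"
    using h f g by (simp add: tensor_mult_pure hat_pure evR_mult lift_smult_left cong: lift_cong)
qed (use f g in simp_all)

subsection \<open>The functionals separate points\<close>

text \<open>Both copies of \<open>H\<close> are separated by \<open>H\<^sup>0\<close>: first \<open>g \<otimes> id\<close>, then \<open>id \<otimes> f\<close> determines the element.\<close>

lemma hat_inj:
  assumes sep: "separates_points K H"
    and X: "X \<in> carrier (tensor K H AH)" and Y: "Y \<in> carrier (tensor K H AH)"
    and eq: "\<And>f g. \<lbrakk>f \<in> carrier D; g \<in> carrier D\<rbrakk> \<Longrightarrow> hat f g X = hat f g Y"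
  shows "X = Y"
proof -
  have s: "h = \<zero>\<^bsub>H\<^esub>" if "h \<in> carrier H" "\<And>f. f \<in> carrier D \<Longrightarrow> f h = \<zero>\<^bsub>K\<^esub>" for h
    using sep that unfolding separates_points_def by blast
  have AH: "vectorspace K AH" by simp
  show ?thesis
  proof (rule tensor_separation[OF H.vsH AH H.finite_dual_lin s X Y])
    fix g assume g: "g \<in> carrier D"
    have b: "bilin K H AH AH (\<lambda>h W. g h \<odot>\<^bsub>AH\<^esub> W)" using g by simp
    have e: "evR f (tensor_lift K H AH AH (\<lambda>h W. g h \<odot>\<^bsub>AH\<^esub> W) Z) = hat f g Z"
      if f: "f \<in> carrier D" and Z: "Z \<in> carrier (tensor K H AH)" for f Z
      unfolding lin_lift[OF evR_lin[OF f] b Z] hat_def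
      by (rule lift_cong) (simp_all add: lin_smult[OF evR_lin[OF f]] g)
    show "tensor_lift K H AH AH (\<lambda>h W. g h \<odot>\<^bsub>AH\<^esub> W) X = tensor_lift K H AH AH (\<lambda>h W. g h \<odot>\<^bsub>AH\<^esub> W) Y"
    proof (rule tensor_separation_right[OF vsA H.vsH H.finite_dual_lin s lift_closed[OF b X] lift_closed[OF b Y]])
      fix f assume f: "f \<in> carrier D"
      show "tensor_lift K A H A (\<lambda>a h. f h \<odot>\<^bsub>A\<^esub> a) (tensor_lift K H AH AH (\<lambda>h W. g h \<odot>\<^bsub>AH\<^esub> W) X)
          = tensor_lift K A H A (\<lambda>a h. f h \<odot>\<^bsub>A\<^esub> a) (tensor_lift K H AH AH (\<lambda>h W. g h \<odot>\<^bsub>AH\<^esub> W) Y)"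
        using e[OF f X] e[OF f Y] eq[OF f g] unfolding evR_def by simp
    qed assumption+
  qed assumption+
qed

section \<open>The induced partial actions\<close>

lemma eval_mult_lin [simp]:
  "\<lbrakk>f \<in> carrier D; k \<in> carrier H\<rbrakk> \<Longrightarrow> lin K H (scalars K) (\<lambda>x. f (x \<otimes>\<^bsub>H\<^esub> k))"
  by (rule H.finite_dual_comp_lin) (simp_all add: lin_mult1 lin_id)

lemma eval_dual_mult_lin [simp]:
  "\<lbrakk>u \<in> carrier D; k \<in> carrier H\<rbrakk> \<Longrightarrow> lin K D (scalars K) (\<lambda>f. (f \<otimes>\<^bsub>D\<^esub> u) k)"
  "\<lbrakk>u \<in> carrier D; k \<in> carrier H\<rbrakk> \<Longrightarrow> lin K D (scalars K) (\<lambda>f. (u \<otimes>\<^bsub>D\<^esub> f) k)"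
  by (rule lin_comp[OF H.eval_lin]; simp add: lin_mult1 lin_mult2 lin_id)+

lemma id_lin: "lin K H H id" "lin K A A id"
  using lin_id[OF H.vsH] lin_id[OF vsA] by (simp_all add: id_def)

text \<open>The induced actions \<open>f \<rightharpoonup> a\<close> and \<open>a \<leftharpoonup> g\<close>\<close>

abbreviation lac where "lac f a \<equiv> evR f (rho a)"
abbreviation rac where "rac a g \<equiv> evL g (lam a)"

lemma lac_mult: "\<lbrakk>f \<in> carrier D; a \<in> carrier A; b \<in> carrier A\<rbrakk> \<Longrightarrow>
    lac f (a \<otimes>\<^bsub>A\<^esub> b) = tensor_lift K D D A (\<lambda>f1 f2. lac f1 a \<otimes>\<^bsub>A\<^esub> lac f2 b) (comult D f)"
  by (simp add: rho_mult evR_mult)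

lemma rac_mult: "\<lbrakk>g \<in> carrier D; a \<in> carrier A; b \<in> carrier A\<rbrakk> \<Longrightarrow>
    rac (a \<otimes>\<^bsub>A\<^esub> b) g = tensor_lift K D D A (\<lambda>g1 g2. rac a g1 \<otimes>\<^bsub>A\<^esub> rac b g2) (comult D g)"
  by (simp add: lam_mult evL_mult)

text \<open>\<open>f \<rightharpoonup> (u \<rightharpoonup> b) = (f\<^sub>1 \<rightharpoonup> 1)(f\<^sub>2u \<rightharpoonup> b)\<close>\<close>

lemma lac_lac:
  assumes f: "f \<in> carrier D" and u: "u \<in> carrier D" and b: "b \<in> carrier A"
  shows "lac f (lac u b)
    = tensor_lift K D D A (\<lambda>f1 f2. lac f1 \<one>\<^bsub>A\<^esub> \<otimes>\<^bsub>A\<^esub> lac (f2 \<otimes>\<^bsub>D\<^esub> u) b) (comult D f)"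
proof -
  let ?HH = "tensor K H H" and ?T = "tensor K A (tensor K H H)"
  define pr where "pr Z = tensor_lift K H H (scalars K) (\<lambda>h k. f h \<otimes>\<^bsub>K\<^esub> u k) Z" for Z
  have prl: "lin K ?HH (scalars K) pr" unfolding pr_def[abs_def] using f u by (intro lift_lin) simp
  have prc [simp]: "pr Z \<in> carrier K" if "Z \<in> carrier ?HH" for Z using lin_closed[OF prl that] by simp
  note [simp] = lin_comp[OF prl] prl
  have bp: "bilin K A ?HH A (\<lambda>b Z. pr Z \<odot>\<^bsub>A\<^esub> b)" by simp
  have pure: "pr (pure_tensor K H H h k) = f h \<otimes>\<^bsub>K\<^esub> u k" if "h \<in> carrier H" "k \<in> carrier H" for h k
    unfolding pr_def using that f u by (intro lift_pure) simp_all
  \<comment> \<open>apply \<open>id \<otimes> f \<otimes> u\<close> to both sides of the coassociativity law for \<open>\<rho>\<close>\<close>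
  let ?\<Phi> = "tensor_lift K A ?HH A (\<lambda>b Z. pr Z \<odot>\<^bsub>A\<^esub> b)"
  have X1: "tensor_map K A H AH H rho id (rho b) \<in> carrier (tensor K AH H)"
    by (rule lin_closed[OF tensor_map_lin[OF rho_lin id_lin(1)] rho_closed[OF b]])
  have X2: "pure_tensor K AH H (rho \<one>\<^bsub>A\<^esub>) \<one>\<^bsub>H\<^esub> \<in> carrier (tensor K AH H)" by simp
  have X3: "tensor_map K A H A ?HH id (comult H) (rho b) \<in> carrier ?T"
    by (rule lin_closed[OF tensor_map_lin[OF id_lin(2) H.comult_lin] rho_closed[OF b]])
  have X4: "tensor_assoc K A H H (pure_tensor K AH H (rho \<one>\<^bsub>A\<^esub>) \<one>\<^bsub>H\<^esub>) \<in> carrier ?T"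
    by (rule lin_closed[OF tensor_assoc_lin X2]) simp_all
  have m: "bilin K AH H A (\<lambda>X w. u w \<odot>\<^bsub>A\<^esub> evR f X)" using f u by simp
  have 1: "?\<Phi> (tensor_assoc K A H H (tensor_map K A H AH H rho id (rho b))) = lac f (lac u b)"
  proof -
    have "?\<Phi> (tensor_assoc K A H H (tensor_map K A H AH H rho id (rho b)))
      = tensor_lift K AH H A (\<lambda>X w. u w \<odot>\<^bsub>A\<^esub> evR f X) (tensor_map K A H AH H rho id (rho b))"
      unfolding lift_tensor_assoc[OF vsA H.vsH H.vsH bp X1]
      using f u by (intro lift_cong refl)
        (simp add: pure evR_def lift_smult_left A.smult_assoc1[symmetric] H.R.m_comm cong: lift_cong)
    also have "\<dots> = tensor_lift K A H A (\<lambda>c w. u w \<odot>\<^bsub>A\<^esub> lac f c) (rho b)"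
      by (simp add: lift_tensor_map[OF rho_lin id_lin(1) m] b)
    also have "\<dots> = lac f (lac u b)"
    proof -
      have l: "lin K A A (\<lambda>c. lac f c)" using f by simp
      have "bilin K A H A (\<lambda>c w. u w \<odot>\<^bsub>A\<^esub> c)" using u by simp
      from lin_lift[OF l this rho_closed[OF b]] show ?thesis
        unfolding evR_def[of u] using u by (simp add: lin_smult[OF l] cong: lift_cong)
    qed
    finally show ?thesis .
  qed
  have pr_mult: "pr (pure_tensor K H H h \<one>\<^bsub>H\<^esub> \<otimes>\<^bsub>?HH\<^esub> comult H k)
      = tensor_lift K D D (scalars K) (\<lambda>f1 f2. f1 h \<otimes>\<^bsub>K\<^esub> (f2 \<otimes>\<^bsub>D\<^esub> u) k) (comult D f)"
    if h: "h \<in> carrier H" and k: "k \<in> carrier H" for h k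
  proof -
    have bb: "bilin K H H (scalars K) (\<lambda>h k. f h \<otimes>\<^bsub>K\<^esub> u k)" using f u by simp
    have "pr (pure_tensor K H H h \<one>\<^bsub>H\<^esub> \<otimes>\<^bsub>?HH\<^esub> comult H k)
      = tensor_lift K H H (scalars K) (\<lambda>k1 k2. f (h \<otimes>\<^bsub>H\<^esub> k1) \<otimes>\<^bsub>K\<^esub> u k2) (comult H k)"
      unfolding pr_def using h k f u
      by (subst lift_tensor_mult[OF H.algH H.algH bb])
        (simp_all add: lift_pure H.unit_left cong: lift_cong)
    also have "\<dots> = tensor_lift K H H (scalars K) (\<lambda>k1 k2. tensor_lift K D D (scalars K)
        (\<lambda>f1 f2. (f1 h \<otimes>\<^bsub>K\<^esub> f2 k1) \<otimes>\<^bsub>K\<^esub> u k2) (comult D f)) (comult H k)"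
      using h k f u by (simp add: lift_scal_right[symmetric] cong: lift_cong)
    also have "\<dots> = tensor_lift K D D (scalars K) (\<lambda>f1 f2. tensor_lift K H H (scalars K)
        (\<lambda>k1 k2. (f1 h \<otimes>\<^bsub>K\<^esub> f2 k1) \<otimes>\<^bsub>K\<^esub> u k2) (comult H k)) (comult D f)"
      by (rule lift_swap) (use h k f u in simp_all)
    also have "\<dots> = tensor_lift K D D (scalars K) (\<lambda>f1 f2. f1 h \<otimes>\<^bsub>K\<^esub> (f2 \<otimes>\<^bsub>D\<^esub> u) k) (comult D f)"
      using h k f u by (simp add: lift_scal_left H.R.m_assoc cong: lift_cong)
    finally show ?thesis .
  qed
  have 2: "?\<Phi> (tensor_assoc K A H H (pure_tensor K AH H (rho \<one>\<^bsub>A\<^esub>) \<one>\<^bsub>H\<^esub>)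
        \<otimes>\<^bsub>?T\<^esub> tensor_map K A H A ?HH id (comult H) (rho b))
      = tensor_lift K D D A (\<lambda>f1 f2. lac f1 \<one>\<^bsub>A\<^esub> \<otimes>\<^bsub>A\<^esub> lac (f2 \<otimes>\<^bsub>D\<^esub> u) b) (comult D f)"
  proof -
    let ?Y = "tensor_map K A H A ?HH id (comult H) (rho b)"
    have i: "bilin K A ?HH A (\<lambda>v' Z'. pr (Z \<otimes>\<^bsub>?HH\<^esub> Z') \<odot>\<^bsub>A\<^esub> (v \<otimes>\<^bsub>A\<^esub> v'))"
      if "v \<in> carrier A" "Z \<in> carrier ?HH" for v Z
      using that by simp
    have "?\<Phi> (tensor_assoc K A H H (pure_tensor K AH H (rho \<one>\<^bsub>A\<^esub>) \<one>\<^bsub>H\<^esub>) \<otimes>\<^bsub>?T\<^esub> ?Y)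
      = tensor_lift K A ?HH A (\<lambda>v Z. tensor_lift K A ?HH A (\<lambda>v' Z'. pr (Z \<otimes>\<^bsub>?HH\<^esub> Z') \<odot>\<^bsub>A\<^esub> (v \<otimes>\<^bsub>A\<^esub> v')) ?Y)
          (tensor_assoc K A H H (pure_tensor K AH H (rho \<one>\<^bsub>A\<^esub>) \<one>\<^bsub>H\<^esub>))"
      by (rule lift_tensor_mult[OF algA algHH bp X4 X3])
    also have "\<dots> = tensor_lift K A ?HH A (\<lambda>v Z. tensor_lift K A H A
          (\<lambda>v' k. pr (Z \<otimes>\<^bsub>?HH\<^esub> comult H k) \<odot>\<^bsub>A\<^esub> (v \<otimes>\<^bsub>A\<^esub> v')) (rho b))
          (tensor_assoc K A H H (pure_tensor K AH H (rho \<one>\<^bsub>A\<^esub>) \<one>\<^bsub>H\<^esub>))"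
      by (intro lift_cong refl) (simp add: lift_tensor_map[OF id_lin(2) H.comult_lin i] b)
    also have "\<dots> = tensor_lift K AH H A (\<lambda>X w. tensor_lift K A H A (\<lambda>v h. tensor_lift K A H A
          (\<lambda>v' k. pr (pure_tensor K H H h w \<otimes>\<^bsub>?HH\<^esub> comult H k) \<odot>\<^bsub>A\<^esub> (v \<otimes>\<^bsub>A\<^esub> v')) (rho b)) X)
          (pure_tensor K AH H (rho \<one>\<^bsub>A\<^esub>) \<one>\<^bsub>H\<^esub>)"
      by (rule lift_tensor_assoc[OF vsA H.vsH H.vsH _ X2]) (use b in simp)
    also have "\<dots> = tensor_lift K A H A (\<lambda>v h. tensor_lift K A H A
          (\<lambda>v' k. pr (pure_tensor K H H h \<one>\<^bsub>H\<^esub> \<otimes>\<^bsub>?HH\<^esub> comult H k) \<odot>\<^bsub>A\<^esub> (v \<otimes>\<^bsub>A\<^esub> v')) (rho b)) (rho \<one>\<^bsub>A\<^esub>)"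
      by (rule lift_pure) (use b in simp_all)
    also have "\<dots> = tensor_lift K A H A (\<lambda>v h. tensor_lift K A H A (\<lambda>v' k. tensor_lift K D D A
          (\<lambda>f1 f2. (f1 h \<odot>\<^bsub>A\<^esub> v) \<otimes>\<^bsub>A\<^esub> ((f2 \<otimes>\<^bsub>D\<^esub> u) k \<odot>\<^bsub>A\<^esub> v')) (comult D f)) (rho b)) (rho \<one>\<^bsub>A\<^esub>)"
      using f u b
      by (simp add: pr_mult lift_smult_right smult_mult cong: lift_cong del: H.finite_dual_ops(4))
    also have "\<dots> = tensor_lift K A H A (\<lambda>v h. tensor_lift K D D A (\<lambda>f1 f2. tensor_lift K A H A
          (\<lambda>v' k. (f1 h \<odot>\<^bsub>A\<^esub> v) \<otimes>\<^bsub>A\<^esub> ((f2 \<otimes>\<^bsub>D\<^esub> u) k \<odot>\<^bsub>A\<^esub> v')) (rho b)) (comult D f)) (rho \<one>\<^bsub>A\<^esub>)"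
      by (intro lift_cong refl lift_swap) (use f u b in \<open>simp_all del: H.finite_dual_ops(4)\<close>)
    also have "\<dots> = tensor_lift K A H A (\<lambda>v h. tensor_lift K D D A (\<lambda>f1 f2.
          (f1 h \<odot>\<^bsub>A\<^esub> v) \<otimes>\<^bsub>A\<^esub> lac (f2 \<otimes>\<^bsub>D\<^esub> u) b) (comult D f)) (rho \<one>\<^bsub>A\<^esub>)"
      using f u b unfolding evR_def
      by (simp add: lift_mult_left cong: lift_cong del: H.finite_dual_ops(4))
    also have "\<dots> = tensor_lift K D D A (\<lambda>f1 f2. tensor_lift K A H A (\<lambda>v h.
          (f1 h \<odot>\<^bsub>A\<^esub> v) \<otimes>\<^bsub>A\<^esub> lac (f2 \<otimes>\<^bsub>D\<^esub> u) b) (rho \<one>\<^bsub>A\<^esub>)) (comult D f)"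
      by (rule lift_swap) (use f u b in \<open>simp_all del: H.finite_dual_ops(4)\<close>)
    also have "\<dots> = tensor_lift K D D A (\<lambda>f1 f2. lac f1 \<one>\<^bsub>A\<^esub> \<otimes>\<^bsub>A\<^esub> lac (f2 \<otimes>\<^bsub>D\<^esub> u) b) (comult D f)"
      using f u b unfolding evR_def[of _ "rho \<one>\<^bsub>A\<^esub>"]
      by (simp add: lift_mult_right cong: lift_cong del: H.finite_dual_ops(4))
    finally show ?thesis .
  qed
  show ?thesis using 1 2 rho_coassoc[OF b] by simp
qed

text \<open>\<open>(a \<leftharpoonup> p) \<leftharpoonup> g = (a \<leftharpoonup> pg\<^sub>1)(1 \<leftharpoonup> g\<^sub>2)\<close>\<close>

lemma rac_rac:
  assumes p: "p \<in> carrier D" and g: "g \<in> carrier D" and a: "a \<in> carrier A"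
  shows "rac (rac a p) g
    = tensor_lift K D D A (\<lambda>g1 g2. rac a (p \<otimes>\<^bsub>D\<^esub> g1) \<otimes>\<^bsub>A\<^esub> rac \<one>\<^bsub>A\<^esub> g2) (comult D g)"
proof -
  let ?HH = "tensor K H H" and ?T = "tensor K H HA"
  have b: "bilin K H HA A (\<lambda>h W. p h \<odot>\<^bsub>A\<^esub> evL g W)" using p g by simp
  \<comment> \<open>apply \<open>p \<otimes> g \<otimes> id\<close> to both sides of the coassociativity law for \<open>\<lambda>\<close>\<close>
  let ?\<Phi> = "tensor_lift K H HA A (\<lambda>h W. p h \<odot>\<^bsub>A\<^esub> evL g W)"
  have 1: "?\<Phi> (tensor_map K H A H HA id lam (lam a)) = rac (rac a p) g"
  proof -
    have "?\<Phi> (tensor_map K H A H HA id lam (lam a)) = tensor_lift K H A A (\<lambda>h c. p h \<odot>\<^bsub>A\<^esub> rac c g) (lam a)"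
      using a by (simp add: lift_tensor_map[OF id_lin(1) lam_lin b])
    also have "\<dots> = rac (rac a p) g"
    proof -
      have l: "lin K A A (\<lambda>c. rac c g)" using g by simp
      have "bilin K H A A (\<lambda>h c. p h \<odot>\<^bsub>A\<^esub> c)" using p by simp
      from lin_lift[OF l this lam_closed[OF a]] show ?thesis
        unfolding evL_def[of p] using p by (simp add: lin_smult[OF l] cong: lift_cong)
    qed
    finally show ?thesis .
  qed
  let ?M = "tensor_map K H A ?HH A (comult H) id (lam a)"
  have M: "?M \<in> carrier (tensor K ?HH A)"
    by (rule lin_closed[OF tensor_map_lin[OF H.comult_lin id_lin(2)] lam_closed[OF a]])
  have Z1: "tensor_assoc K H H A ?M \<in> carrier ?T"
    by (rule lin_closed[OF tensor_assoc_lin M]) simp_all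
  have Z2: "pure_tensor K H HA \<one>\<^bsub>H\<^esub> (lam \<one>\<^bsub>A\<^esub>) \<in> carrier ?T" by simp
  have 2: "?\<Phi> (tensor_assoc K H H A ?M \<otimes>\<^bsub>?T\<^esub> pure_tensor K H HA \<one>\<^bsub>H\<^esub> (lam \<one>\<^bsub>A\<^esub>))
    = tensor_lift K D D A (\<lambda>g1 g2. rac a (p \<otimes>\<^bsub>D\<^esub> g1) \<otimes>\<^bsub>A\<^esub> rac \<one>\<^bsub>A\<^esub> g2) (comult D g)"
  proof -
    have i: "bilin K H HA A (\<lambda>h' W'. p (h \<otimes>\<^bsub>H\<^esub> h') \<odot>\<^bsub>A\<^esub> evL g (W \<otimes>\<^bsub>HA\<^esub> W'))"
      if "h \<in> carrier H" "W \<in> carrier HA" for h W using that p g by simp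
    have b': "bilin K H HA A (\<lambda>h W. p h \<odot>\<^bsub>A\<^esub> evL g (W \<otimes>\<^bsub>HA\<^esub> lam \<one>\<^bsub>A\<^esub>))" using p g by simp
    have b'': "bilin K ?HH A A (\<lambda>X c. tensor_lift K H H A
          (\<lambda>h k. p h \<odot>\<^bsub>A\<^esub> evL g (pure_tensor K H A k c \<otimes>\<^bsub>HA\<^esub> lam \<one>\<^bsub>A\<^esub>)) X)" using p g by simp
    have "?\<Phi> (tensor_assoc K H H A ?M \<otimes>\<^bsub>?T\<^esub> pure_tensor K H HA \<one>\<^bsub>H\<^esub> (lam \<one>\<^bsub>A\<^esub>))
      = tensor_lift K H HA A (\<lambda>h W. tensor_lift K H HA A (\<lambda>h' W'. p (h \<otimes>\<^bsub>H\<^esub> h') \<odot>\<^bsub>A\<^esub> evL g (W \<otimes>\<^bsub>HA\<^esub> W'))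
          (pure_tensor K H HA \<one>\<^bsub>H\<^esub> (lam \<one>\<^bsub>A\<^esub>))) (tensor_assoc K H H A ?M)"
      by (rule lift_tensor_mult[OF H.algH algHA b Z1 Z2])
    also have "\<dots> = tensor_lift K H HA A (\<lambda>h W. p h \<odot>\<^bsub>A\<^esub> evL g (W \<otimes>\<^bsub>HA\<^esub> lam \<one>\<^bsub>A\<^esub>)) (tensor_assoc K H H A ?M)"
      by (intro lift_cong refl) (simp add: lift_pure[OF i] H.unit_right)
    also have "\<dots> = tensor_lift K ?HH A A (\<lambda>X c. tensor_lift K H H A
          (\<lambda>h k. p h \<odot>\<^bsub>A\<^esub> evL g (pure_tensor K H A k c \<otimes>\<^bsub>HA\<^esub> lam \<one>\<^bsub>A\<^esub>)) X) ?M"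
      by (rule lift_tensor_assoc[OF H.vsH H.vsH vsA b' M])
    also have "\<dots> = tensor_lift K H A A (\<lambda>h c. tensor_lift K H H A
          (\<lambda>h1 h2. p h1 \<odot>\<^bsub>A\<^esub> evL g (pure_tensor K H A h2 c \<otimes>\<^bsub>HA\<^esub> lam \<one>\<^bsub>A\<^esub>)) (comult H h)) (lam a)"
      using a by (simp add: lift_tensor_map[OF H.comult_lin id_lin(2) b''])
    also have "\<dots> = tensor_lift K H A A (\<lambda>h c. tensor_lift K H H A (\<lambda>h1 h2. tensor_lift K D D A
          (\<lambda>g1 g2. ((p h1 \<otimes>\<^bsub>K\<^esub> g1 h2) \<odot>\<^bsub>A\<^esub> c) \<otimes>\<^bsub>A\<^esub> rac \<one>\<^bsub>A\<^esub> g2) (comult D g)) (comult H h)) (lam a)"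
      using p g by (simp add: evL_mult evL_pure lift_smult_left A.mult_smult_left A.smult_assoc1
          cong: lift_cong)
    also have "\<dots> = tensor_lift K H A A (\<lambda>h c. tensor_lift K D D A (\<lambda>g1 g2. tensor_lift K H H A
          (\<lambda>h1 h2. ((p h1 \<otimes>\<^bsub>K\<^esub> g1 h2) \<odot>\<^bsub>A\<^esub> c) \<otimes>\<^bsub>A\<^esub> rac \<one>\<^bsub>A\<^esub> g2) (comult H h)) (comult D g)) (lam a)"
      by (intro lift_cong refl lift_swap) (use p g in simp_all)
    also have "\<dots> = tensor_lift K H A A (\<lambda>h c. tensor_lift K D D A (\<lambda>g1 g2.
          ((p \<otimes>\<^bsub>D\<^esub> g1) h \<odot>\<^bsub>A\<^esub> c) \<otimes>\<^bsub>A\<^esub> rac \<one>\<^bsub>A\<^esub> g2) (comult D g)) (lam a)"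
      using p g by (simp add: lift_smult_right lift_mult_right cong: lift_cong)
    also have "\<dots> = tensor_lift K D D A (\<lambda>g1 g2. tensor_lift K H A A (\<lambda>h c.
          ((p \<otimes>\<^bsub>D\<^esub> g1) h \<odot>\<^bsub>A\<^esub> c) \<otimes>\<^bsub>A\<^esub> rac \<one>\<^bsub>A\<^esub> g2) (lam a)) (comult D g)"
      by (rule lift_swap) (use p g a in \<open>simp_all del: H.finite_dual_ops(4)\<close>)
    also have "\<dots> = tensor_lift K D D A (\<lambda>g1 g2. rac a (p \<otimes>\<^bsub>D\<^esub> g1) \<otimes>\<^bsub>A\<^esub> rac \<one>\<^bsub>A\<^esub> g2) (comult D g)"
      using p g a unfolding evL_def[of _ "lam a"]
      by (simp add: lift_mult_right cong: lift_cong del: H.finite_dual_ops(4))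
    finally show ?thesis .
  qed
  show ?thesis using 1 2 lam_coassoc[OF a] by simp
qed

subsection \<open>The map \<open>\<theta>\<close>\<close>

lemma theta_lin: "lin K A (tensor K H AH) (theta K H A lam rho)"
  unfolding theta_def[abs_def] by (rule lin_comp[OF tensor_map_lin[OF id_lin(1) rho_lin] lam_lin])

lemma theta_closed [simp]: "a \<in> carrier A \<Longrightarrow> theta K H A lam rho a \<in> carrier (tensor K H AH)"
  by (rule lin_closed[OF theta_lin])

text \<open>\<open>\<theta>(a)^(f, g) = f \<rightharpoonup> (a \<leftharpoonup> g) = (f \<rightharpoonup> a) \<leftharpoonup> g\<close>, from the two expressions for \<open>\<theta>\<close>\<close>

lemma hat_theta:
  assumes f: "f \<in> carrier D" and g: "g \<in> carrier D" and a: "a \<in> carrier A"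
  shows "hat f g (theta K H A lam rho a) = lac f (rac a g)"
    and "hat f g (theta K H A lam rho a) = rac (lac f a) g"
proof -
  have "hat f g (theta K H A lam rho a) = tensor_lift K H A A (\<lambda>h c. g h \<odot>\<^bsub>A\<^esub> lac f c) (lam a)"
    unfolding hat_def theta_def using a by (simp add: lift_tensor_map[OF id_lin(1) rho_lin hat_bilin[OF f g]])
  also have "\<dots> = lac f (rac a g)"
  proof -
    have l: "lin K A A (\<lambda>c. lac f c)" using f by simp
    have "bilin K H A A (\<lambda>h c. g h \<odot>\<^bsub>A\<^esub> c)" using g by simp
    from lin_lift[OF l this lam_closed[OF a]] show ?thesis
      unfolding evL_def using g by (simp add: lin_smult[OF l] cong: lift_cong)
  qed
  finally show "hat f g (theta K H A lam rho a) = lac f (rac a g)" .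
  let ?M = "tensor_map K A H HA H lam id (rho a)"
  have M: "?M \<in> carrier (tensor K HA H)"
    by (rule lin_closed[OF tensor_map_lin[OF lam_lin id_lin(1)] rho_closed[OF a]])
  have b: "bilin K HA H A (\<lambda>X k. f k \<odot>\<^bsub>A\<^esub> evL g X)" using f g by simp
  have "hat f g (theta K H A lam rho a) = hat f g (tensor_assoc K H A H ?M)"
    unfolding theta_def lam_rho[OF a] ..
  also have "\<dots> = tensor_lift K HA H A (\<lambda>X k. tensor_lift K H A A
      (\<lambda>h c. g h \<odot>\<^bsub>A\<^esub> evR f (pure_tensor K A H c k)) X) ?M"
    unfolding hat_def by (rule lift_tensor_assoc[OF H.vsH vsA H.vsH hat_bilin[OF f g] M])
  also have "\<dots> = tensor_lift K HA H A (\<lambda>X k. f k \<odot>\<^bsub>A\<^esub> evL g X) ?M"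
    using f g unfolding evL_def
    by (intro lift_cong refl) (simp add: evR_pure lift_smult_left A.smult_assoc1[symmetric] H.R.m_comm
        cong: lift_cong)
  also have "\<dots> = tensor_lift K A H A (\<lambda>c k. f k \<odot>\<^bsub>A\<^esub> rac c g) (rho a)"
    using a by (simp add: lift_tensor_map[OF lam_lin id_lin(1) b])
  also have "\<dots> = rac (lac f a) g"
  proof -
    have l: "lin K A A (\<lambda>c. rac c g)" using g by simp
    have "bilin K A H A (\<lambda>c k. f k \<odot>\<^bsub>A\<^esub> c)" using f by simp
    from lin_lift[OF l this rho_closed[OF a]] show ?thesis
      unfolding evR_def using f by (simp add: lin_smult[OF l] cong: lift_cong)
  qed
  finally show "hat f g (theta K H A lam rho a) = rac (lac f a) g" .
qed

text \<open>\<open>f \<rightharpoonup> (c (u \<rightharpoonup> b)) = (f\<^sub>1 \<rightharpoonup> c)(f\<^sub>2u \<rightharpoonup> b)\<close>\<close>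

lemma lac_mult_lac:
  assumes f: "f \<in> carrier D" and u: "u \<in> carrier D" and c: "c \<in> carrier A" and b: "b \<in> carrier A"
  shows "lac f (c \<otimes>\<^bsub>A\<^esub> lac u b)
    = tensor_lift K D D A (\<lambda>f1 f2. lac f1 c \<otimes>\<^bsub>A\<^esub> lac (f2 \<otimes>\<^bsub>D\<^esub> u) b) (comult D f)"
proof -
  have "lac f (c \<otimes>\<^bsub>A\<^esub> lac u b) = tensor_lift K D D A (\<lambda>f1 x. tensor_lift K D D A
      (\<lambda>v w. (lac f1 c \<otimes>\<^bsub>A\<^esub> lac v \<one>\<^bsub>A\<^esub>) \<otimes>\<^bsub>A\<^esub> lac (w \<otimes>\<^bsub>D\<^esub> u) b) (comult D x)) (comult D f)"
    using f u c b by (simp add: lac_mult lac_lac lift_mult_left A.mult_assoc cong: lift_cong)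
  also have "\<dots> = tensor_lift K D D A (\<lambda>x w. tensor_lift K D D A
      (\<lambda>f1 v. (lac f1 c \<otimes>\<^bsub>A\<^esub> lac v \<one>\<^bsub>A\<^esub>) \<otimes>\<^bsub>A\<^esub> lac (w \<otimes>\<^bsub>D\<^esub> u) b) (comult D x)) (comult D f)"
    by (rule D.sw_coassoc[symmetric]) (use f u c b in simp_all)
  also have "\<dots> = tensor_lift K D D A (\<lambda>x w. lac x (c \<otimes>\<^bsub>A\<^esub> \<one>\<^bsub>A\<^esub>) \<otimes>\<^bsub>A\<^esub> lac (w \<otimes>\<^bsub>D\<^esub> u) b) (comult D f)"
    using f u c b by (simp add: lac_mult lift_mult_right cong: lift_cong)
  finally show ?thesis using c by (simp add: A.unit_right)
qed

text \<open>\<open>((a \<leftharpoonup> p) c) \<leftharpoonup> g = (a \<leftharpoonup> pg\<^sub>1)(c \<leftharpoonup> g\<^sub>2)\<close>\<close>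

lemma rac_rac_mult:
  assumes p: "p \<in> carrier D" and g: "g \<in> carrier D" and a: "a \<in> carrier A" and c: "c \<in> carrier A"
  shows "rac (rac a p \<otimes>\<^bsub>A\<^esub> c) g
    = tensor_lift K D D A (\<lambda>g1 g2. rac a (p \<otimes>\<^bsub>D\<^esub> g1) \<otimes>\<^bsub>A\<^esub> rac c g2) (comult D g)"
proof -
  have "rac (rac a p \<otimes>\<^bsub>A\<^esub> c) g = tensor_lift K D D A (\<lambda>x w. tensor_lift K D D A
      (\<lambda>u v. rac a (p \<otimes>\<^bsub>D\<^esub> u) \<otimes>\<^bsub>A\<^esub> (rac \<one>\<^bsub>A\<^esub> v \<otimes>\<^bsub>A\<^esub> rac c w)) (comult D x)) (comult D g)"
    using p g a c by (simp add: rac_mult rac_rac lift_mult_right A.mult_assoc cong: lift_cong)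
  also have "\<dots> = tensor_lift K D D A (\<lambda>u x. tensor_lift K D D A
      (\<lambda>v w. rac a (p \<otimes>\<^bsub>D\<^esub> u) \<otimes>\<^bsub>A\<^esub> (rac \<one>\<^bsub>A\<^esub> v \<otimes>\<^bsub>A\<^esub> rac c w)) (comult D x)) (comult D g)"
    by (rule D.sw_coassoc) (use p g a c in simp_all)
  also have "\<dots> = tensor_lift K D D A (\<lambda>u x. rac a (p \<otimes>\<^bsub>D\<^esub> u) \<otimes>\<^bsub>A\<^esub> rac (\<one>\<^bsub>A\<^esub> \<otimes>\<^bsub>A\<^esub> c) x) (comult D g)"
    using p g a c by (simp add: rac_mult lift_mult_left cong: lift_cong)
  finally show ?thesis using c by (simp add: A.unit_left)
qed

section \<open>The bimodule algebra \<open>H \<otimes> A \<otimes> H\<close>\<close>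

lemma lact_factor_lin: "f \<in> carrier D \<Longrightarrow> lin K H H (\<lambda>k. tensor_lift K H H H (\<lambda>k1 k2. f k2 \<odot>\<^bsub>H\<^esub> k1) (comult H k))"
  by simp

lemma ract_factor_lin: "f \<in> carrier D \<Longrightarrow> lin K H H (\<lambda>h. tensor_lift K H H H (\<lambda>h1 h2. f h1 \<odot>\<^bsub>H\<^esub> h2) (comult H h))"
  by simp

lemma AH_id_lin: "lin K AH AH id"
  using lin_id[of K AH] by (simp add: id_def)

lemma HAH_lact_lin: "f \<in> carrier D \<Longrightarrow> lin K (tensor K H AH) (tensor K H AH) (HAH_lact K H A f)"
  unfolding HAH_lact_def by (intro tensor_map_lin id_lin lact_factor_lin)

lemma HAH_ract_lin: "f \<in> carrier D \<Longrightarrow> lin K (tensor K H AH) (tensor K H AH) (\<lambda>X. HAH_ract K H A X f)"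
  unfolding HAH_ract_def by (intro tensor_map_lin AH_id_lin ract_factor_lin)

lemma HAH_act_closed [simp]:
  "\<lbrakk>f \<in> carrier D; X \<in> carrier (tensor K H AH)\<rbrakk> \<Longrightarrow> HAH_lact K H A f X \<in> carrier (tensor K H AH)"
  "\<lbrakk>f \<in> carrier D; X \<in> carrier (tensor K H AH)\<rbrakk> \<Longrightarrow> HAH_ract K H A X f \<in> carrier (tensor K H AH)"
  by (rule lin_closed[OF HAH_lact_lin] lin_closed[OF HAH_ract_lin]; assumption)+

text \<open>\<open>(u \<triangleright> X)^(f, g) = X^(fu, g)\<close> and \<open>(X \<triangleleft> u)^(f, g) = X^(f, ug)\<close>\<close>

lemma hat_lact:
  assumes f: "f \<in> carrier D" and g: "g \<in> carrier D" and u: "u \<in> carrier D" and X: "X \<in> carrier (tensor K H AH)"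
  shows "hat f g (HAH_lact K H A u X) = hat (f \<otimes>\<^bsub>D\<^esub> u) g X"
proof -
  let ?l = "\<lambda>k. tensor_lift K H H H (\<lambda>k1 k2. u k2 \<odot>\<^bsub>H\<^esub> k1) (comult H k)"
  have bR: "bilin K A H A (\<lambda>b h. f h \<odot>\<^bsub>A\<^esub> b)" using f by simp
  have bH: "bilin K H H H (\<lambda>k1 k2. u k2 \<odot>\<^bsub>H\<^esub> k1)" using u by simp
  have e: "f (?l k) = (f \<otimes>\<^bsub>D\<^esub> u) k" if k: "k \<in> carrier H" for k
    unfolding lin_lift[OF H.finite_dual_lin[OF f] bH H.comult_closed[OF k]]
    using f u k lin_smult[OF H.finite_dual_lin[OF f]] by (simp add: H.R.m_comm cong: lift_cong)
  have R: "evR f (tensor_map K A H A H id ?l W) = evR (f \<otimes>\<^bsub>D\<^esub> u) W" if W: "W \<in> carrier AH" for W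
    unfolding evR_def lift_tensor_map[OF id_lin(2) lact_factor_lin[OF u] bR W]
    by (rule lift_cong) (simp_all add: e del: H.finite_dual_ops(4))
  show ?thesis
    unfolding hat_def HAH_lact_def
      lift_tensor_map[OF id_lin(1) tensor_map_lin[OF id_lin(2) lact_factor_lin[OF u]] hat_bilin[OF f g] X]
    by (rule lift_cong) (simp_all add: R)
qed

lemma hat_ract:
  assumes f: "f \<in> carrier D" and g: "g \<in> carrier D" and u: "u \<in> carrier D" and X: "X \<in> carrier (tensor K H AH)"
  shows "hat f g (HAH_ract K H A X u) = hat f (u \<otimes>\<^bsub>D\<^esub> g) X"
proof -
  let ?r = "\<lambda>h. tensor_lift K H H H (\<lambda>h1 h2. u h1 \<odot>\<^bsub>H\<^esub> h2) (comult H h)"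
  have bH: "bilin K H H H (\<lambda>h1 h2. u h1 \<odot>\<^bsub>H\<^esub> h2)" using u by simp
  have e: "g (?r h) = (u \<otimes>\<^bsub>D\<^esub> g) h" if h: "h \<in> carrier H" for h
    unfolding lin_lift[OF H.finite_dual_lin[OF g] bH H.comult_closed[OF h]]
    using g u h lin_smult[OF H.finite_dual_lin[OF g]] by (simp cong: lift_cong)
  show ?thesis
    unfolding hat_def HAH_ract_def
      lift_tensor_map[OF ract_factor_lin[OF u] AH_id_lin hat_bilin[OF f g] X]
    by (rule lift_cong) (simp_all add: e del: H.finite_dual_ops(4))
qed

text \<open>By \<open>hat_inj\<close> the linearity of the actions in the acting element, and then all axioms of a
  bimodule algebra, can be tested on the elements \<open>Y^(f, g)\<close>.\<close>

lemma HAH_act_lin':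
  assumes sep: "separates_points K H" and X: "X \<in> carrier (tensor K H AH)"
  shows "lin K D (tensor K H AH) (\<lambda>u. HAH_lact K H A u X)"
    and "lin K D (tensor K H AH) (\<lambda>u. HAH_ract K H A X u)"
proof -
  let ?B = "tensor K H AH"
  interpret B: nonunital_algebra K ?B by simp
  note inj = hat_inj[OF sep]
  have l: "lin K D A (\<lambda>u. hat (f \<otimes>\<^bsub>D\<^esub> u) g X)" "lin K D A (\<lambda>u. hat f (u \<otimes>\<^bsub>D\<^esub> g) X)"
    if "f \<in> carrier D" "g \<in> carrier D" for f g
    using that X by simp_all
  show "lin K D ?B (\<lambda>u. HAH_lact K H A u X)"
  proof (rule linI)
    fix u v assume u: "u \<in> carrier D" and v: "v \<in> carrier D"
    show "HAH_lact K H A (u \<oplus>\<^bsub>D\<^esub> v) X = HAH_lact K H A u X \<oplus>\<^bsub>?B\<^esub> HAH_lact K H A v X"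
      by (rule inj)
        (use X u v in \<open>simp_all add: hat_lact lin_add[OF hat_lin] lin_add[OF l(1)] del: H.finite_dual_ops\<close>)
  next
    fix c u assume c: "c \<in> carrier K" and u: "u \<in> carrier D"
    show "HAH_lact K H A (c \<odot>\<^bsub>D\<^esub> u) X = c \<odot>\<^bsub>?B\<^esub> HAH_lact K H A u X"
      by (rule inj)
        (use X c u in \<open>simp_all add: hat_lact lin_smult[OF hat_lin] lin_smult[OF l(1)] del: H.finite_dual_ops\<close>)
  qed (use X in simp_all)
  show "lin K D ?B (\<lambda>u. HAH_ract K H A X u)"
  proof (rule linI)
    fix u v assume u: "u \<in> carrier D" and v: "v \<in> carrier D"
    show "HAH_ract K H A X (u \<oplus>\<^bsub>D\<^esub> v) = HAH_ract K H A X u \<oplus>\<^bsub>?B\<^esub> HAH_ract K H A X v"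
      by (rule inj)
        (use X u v in \<open>simp_all add: hat_ract lin_add[OF hat_lin] lin_add[OF l(2)] del: H.finite_dual_ops\<close>)
  next
    fix c u assume c: "c \<in> carrier K" and u: "u \<in> carrier D"
    show "HAH_ract K H A X (c \<odot>\<^bsub>D\<^esub> u) = c \<odot>\<^bsub>?B\<^esub> HAH_ract K H A X u"
      by (rule inj)
        (use X c u in \<open>simp_all add: hat_ract lin_smult[OF hat_lin] lin_smult[OF l(2)] del: H.finite_dual_ops\<close>)
  qed (use X in simp_all)
qed

lemma HAH_bimodule_algebra:
  assumes sep: "separates_points K H"
  shows "bimodule_algebra K D (tensor K H AH) (HAH_lact K H A) (HAH_ract K H A)"
proof -
  let ?B = "tensor K H AH" and ?l = "HAH_lact K H A" and ?r = "HAH_ract K H A"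
  note inj = hat_inj[OF sep]
  interpret B: nonunital_algebra K ?B by simp
  show ?thesis
  proof (intro bimodule_algebra.intro H.finite_dual_hopf algHAH bimodule_algebra_axioms.intro)
    fix X assume X: "X \<in> carrier ?B"
    show "(\<lambda>u. ?l u X) \<in> module_hom K D ?B" by (rule lin_hom[OF HAH_act_lin'(1)[OF sep X]])
    show "?r X \<in> module_hom K D ?B" by (rule lin_hom[OF HAH_act_lin'(2)[OF sep X]])
    show "?l \<one>\<^bsub>D\<^esub> X = X" "?r X \<one>\<^bsub>D\<^esub> = X"
      by (rule inj; use X in \<open>simp add: hat_lact hat_ract D.unit_left D.unit_right\<close>)+
    fix u v assume u: "u \<in> carrier D" and v: "v \<in> carrier D"
    show "?l (u \<otimes>\<^bsub>D\<^esub> v) X = ?l u (?l v X)" "?r X (u \<otimes>\<^bsub>D\<^esub> v) = ?r (?r X u) v"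
      "?r (?l u X) v = ?l u (?r X v)"
      by (rule inj; use X u v in \<open>simp add: hat_lact hat_ract D.mult_assoc\<close>)+
  next
    fix u X Y assume u: "u \<in> carrier D" and X: "X \<in> carrier ?B" and Y: "Y \<in> carrier ?B"
    note [simp] = HAH_act_lin'[OF sep]
    have bl: "bilin K D D ?B (\<lambda>u1 u2. ?l u1 X \<otimes>\<^bsub>?B\<^esub> ?l u2 Y)" using X Y by simp
    have br: "bilin K D D ?B (\<lambda>u1 u2. ?r X u1 \<otimes>\<^bsub>?B\<^esub> ?r Y u2)" using X Y by simp
    show "?l u (X \<otimes>\<^bsub>?B\<^esub> Y) = tensor_lift K D D ?B (\<lambda>u1 u2. ?l u1 X \<otimes>\<^bsub>?B\<^esub> ?l u2 Y) (comult D u)"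
    proof (rule inj)
      fix f g assume f: "f \<in> carrier D" and g: "g \<in> carrier D"
      have b: "bilin K D D A (\<lambda>w1 w2. tensor_lift K D D A (\<lambda>g1 g2. hat w1 g1 X \<otimes>\<^bsub>A\<^esub> hat w2 g2 Y) (comult D g))"
        using X Y g by simp
      have "hat f g (?l u (X \<otimes>\<^bsub>?B\<^esub> Y)) = tensor_lift K D D A (\<lambda>f1 f2. tensor_lift K D D A (\<lambda>u1 u2.
          tensor_lift K D D A (\<lambda>g1 g2. hat (f1 \<otimes>\<^bsub>D\<^esub> u1) g1 X \<otimes>\<^bsub>A\<^esub> hat (f2 \<otimes>\<^bsub>D\<^esub> u2) g2 Y) (comult D g))
          (comult D u)) (comult D f)"
        using f g u X Y D.sw_mult[OF b f u] by (simp add: hat_lact hat_mult)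
      also have "\<dots> = tensor_lift K D D A (\<lambda>u1 u2. tensor_lift K D D A (\<lambda>f1 f2.
          tensor_lift K D D A (\<lambda>g1 g2. hat (f1 \<otimes>\<^bsub>D\<^esub> u1) g1 X \<otimes>\<^bsub>A\<^esub> hat (f2 \<otimes>\<^bsub>D\<^esub> u2) g2 Y) (comult D g))
          (comult D f)) (comult D u)"
        by (rule lift_swap) (use f g u X Y in simp_all)
      also have "\<dots> = hat f g (tensor_lift K D D ?B (\<lambda>u1 u2. ?l u1 X \<otimes>\<^bsub>?B\<^esub> ?l u2 Y) (comult D u))"
        unfolding lin_lift[OF hat_lin[OF f g] bl H.finite_dual_comult_closed[OF u]]
        using f g X Y by (simp add: hat_mult hat_lact cong: lift_cong)
      finally show "hat f g (?l u (X \<otimes>\<^bsub>?B\<^esub> Y))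
        = hat f g (tensor_lift K D D ?B (\<lambda>u1 u2. ?l u1 X \<otimes>\<^bsub>?B\<^esub> ?l u2 Y) (comult D u))" .
    qed (use u X Y lift_closed[OF bl H.finite_dual_comult_closed[OF u]] in simp_all)
    show "?r (X \<otimes>\<^bsub>?B\<^esub> Y) u = tensor_lift K D D ?B (\<lambda>u1 u2. ?r X u1 \<otimes>\<^bsub>?B\<^esub> ?r Y u2) (comult D u)"
    proof (rule inj)
      fix f g assume f: "f \<in> carrier D" and g: "g \<in> carrier D"
      have b: "bilin K D D A (\<lambda>g1 g2. hat f1 g1 X \<otimes>\<^bsub>A\<^esub> hat f2 g2 Y)"
        if "f1 \<in> carrier D" "f2 \<in> carrier D" for f1 f2 using X Y that by simp
      have "hat f g (?r (X \<otimes>\<^bsub>?B\<^esub> Y) u) = tensor_lift K D D A (\<lambda>f1 f2. tensor_lift K D D A (\<lambda>u1 u2.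
          tensor_lift K D D A (\<lambda>g1 g2. hat f1 (u1 \<otimes>\<^bsub>D\<^esub> g1) X \<otimes>\<^bsub>A\<^esub> hat f2 (u2 \<otimes>\<^bsub>D\<^esub> g2) Y) (comult D g))
          (comult D u)) (comult D f)"
        using f g u X Y by (simp add: hat_ract hat_mult D.sw_mult[OF b] cong: lift_cong)
      also have "\<dots> = tensor_lift K D D A (\<lambda>u1 u2. tensor_lift K D D A (\<lambda>f1 f2.
          tensor_lift K D D A (\<lambda>g1 g2. hat f1 (u1 \<otimes>\<^bsub>D\<^esub> g1) X \<otimes>\<^bsub>A\<^esub> hat f2 (u2 \<otimes>\<^bsub>D\<^esub> g2) Y) (comult D g))
          (comult D f)) (comult D u)"
        by (rule lift_swap) (use f g u X Y in simp_all)
      also have "\<dots> = hat f g (tensor_lift K D D ?B (\<lambda>u1 u2. ?r X u1 \<otimes>\<^bsub>?B\<^esub> ?r Y u2) (comult D u))"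
        unfolding lin_lift[OF hat_lin[OF f g] br H.finite_dual_comult_closed[OF u]]
        using f g X Y by (simp add: hat_mult hat_ract cong: lift_cong)
      finally show "hat f g (?r (X \<otimes>\<^bsub>?B\<^esub> Y) u)
        = hat f g (tensor_lift K D D ?B (\<lambda>u1 u2. ?r X u1 \<otimes>\<^bsub>?B\<^esub> ?r Y u2) (comult D u))" .
    qed (use u X Y lift_closed[OF br H.finite_dual_comult_closed[OF u]] in simp_all)
  qed (rule lin_hom[OF HAH_lact_lin] lin_hom[OF HAH_ract_lin]; assumption)+
qed

text \<open>\<open>(\<theta>(a) \<triangleleft> p)(u \<triangleright> \<theta>(b)) = \<theta>((a \<leftharpoonup> p)(u \<rightharpoonup> b))\<close>\<close>

lemma theta_mult:
  assumes sep: "separates_points K H" and p: "p \<in> carrier D" and u: "u \<in> carrier D"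
    and a: "a \<in> carrier A" and b: "b \<in> carrier A"
  shows "HAH_ract K H A (theta K H A lam rho a) p \<otimes>\<^bsub>tensor K H AH\<^esub> HAH_lact K H A u (theta K H A lam rho b)
    = theta K H A lam rho (rac a p \<otimes>\<^bsub>A\<^esub> lac u b)"
proof (rule hat_inj[OF sep])
  fix f g assume f: "f \<in> carrier D" and g: "g \<in> carrier D"
  have bb: "bilin K D D A (\<lambda>f1 f2. lac f1 (rac a p) \<otimes>\<^bsub>A\<^esub> lac (f2 \<otimes>\<^bsub>D\<^esub> u) b)" using p u a b by simp
  have comm: "lac f1 (rac a p) = rac (lac f1 a) p" if "f1 \<in> carrier D" for f1
    using hat_theta[OF that p a] by simp
  have "hat f g (theta K H A lam rho (rac a p \<otimes>\<^bsub>A\<^esub> lac u b)) = rac (lac f (rac a p \<otimes>\<^bsub>A\<^esub> lac u b)) g"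
    by (rule hat_theta(2)) (use f g p u a b in simp_all)
  also have "\<dots> = tensor_lift K D D A (\<lambda>f1 f2. rac (lac f1 (rac a p) \<otimes>\<^bsub>A\<^esub> lac (f2 \<otimes>\<^bsub>D\<^esub> u) b) g) (comult D f)"
    unfolding lac_mult_lac[OF f u ev_closed(2)[OF p lam_closed[OF a]] b]
    by (rule lin_lift[OF lin_comp[OF evL_lin[OF g] lam_lin] bb H.finite_dual_comult_closed[OF f]])
  also have "\<dots> = tensor_lift K D D A (\<lambda>f1 f2. tensor_lift K D D A (\<lambda>g1 g2.
      rac (lac f1 a) (p \<otimes>\<^bsub>D\<^esub> g1) \<otimes>\<^bsub>A\<^esub> rac (lac (f2 \<otimes>\<^bsub>D\<^esub> u) b) g2) (comult D g)) (comult D f)"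
    using f g p u a b by (simp add: comm rac_rac_mult cong: lift_cong)
  also have "\<dots> = hat f g (HAH_ract K H A (theta K H A lam rho a) p
      \<otimes>\<^bsub>tensor K H AH\<^esub> HAH_lact K H A u (theta K H A lam rho b))"
    using f g p u a b by (simp add: hat_mult hat_ract hat_lact hat_theta(2) cong: lift_cong)
  finally show "hat f g (HAH_ract K H A (theta K H A lam rho a) p
      \<otimes>\<^bsub>tensor K H AH\<^esub> HAH_lact K H A u (theta K H A lam rho b))
    = hat f g (theta K H A lam rho (rac a p \<otimes>\<^bsub>A\<^esub> lac u b))" by simp
qed (use p u a b in simp_all)

section \<open>The map \<open>\<Psi>\<close> and the two globalizations\<close>

text \<open>\<open>H \<otimes> A \<otimes> H\<close>, \<open>H\<^sup>0 \<otimes> H\<^sup>0\<close> and \<open>Hom(H\<^sup>0 \<otimes> H\<^sup>0, A)\<close>\<close>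

abbreviation HAHs where "HAHs \<equiv> tensor K H AH"
abbreviation DD where "DD \<equiv> tensor K D D"
abbreviation Hom where "Hom \<equiv> hom_algebra K D A"

lemma Hom_vs: "vectorspace K Hom" by (rule hom_algebra_vs) simp_all

lemma Hom_simps:
  "carrier Hom = {\<alpha> \<in> extensional (carrier DD). lin K DD A \<alpha>}"
  "\<alpha> \<oplus>\<^bsub>Hom\<^esub> \<beta> = (\<lambda>X\<in>carrier DD. \<alpha> X \<oplus>\<^bsub>A\<^esub> \<beta> X)"
  "c \<odot>\<^bsub>Hom\<^esub> \<alpha> = (\<lambda>X\<in>carrier DD. c \<odot>\<^bsub>A\<^esub> \<alpha> X)"
  "\<alpha> \<otimes>\<^bsub>Hom\<^esub> \<beta> = (\<lambda>X\<in>carrier DD. tensor_lift K D D A (\<lambda>f g.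
     tensor_lift K D D A (\<lambda>f1 f2. tensor_lift K D D A (\<lambda>g1 g2.
       \<alpha> (pure_tensor K D D f1 g1) \<otimes>\<^bsub>A\<^esub> \<beta> (pure_tensor K D D f2 g2))
       (comult D g)) (comult D f)) X)"
  by (simp_all add: hom_algebra_def Let_def lin_def)

text \<open>\<open>\<Psi>(Y)(f \<otimes> g) = Y^(f, g)\<close>\<close>

lemma Psi_eq: "Y \<in> carrier HAHs \<Longrightarrow>
    Psi K H A Y = (\<lambda>X\<in>carrier DD. tensor_lift K D D A (\<lambda>f g. hat f g Y) X)"
  unfolding Psi_def Let_def hat_def evR_def
  by (intro restrict_ext lift_cong refl)
    (simp add: lift_smult_left A.smult_assoc1[symmetric] cong: lift_cong)

lemma hat_bilin_dual: "Y \<in> carrier HAHs \<Longrightarrow> bilin K D D A (\<lambda>f g. hat f g Y)"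
  by simp

lemma Psi_pure: "\<lbrakk>Y \<in> carrier HAHs; f \<in> carrier D; g \<in> carrier D\<rbrakk>
    \<Longrightarrow> Psi K H A Y (pure_tensor K D D f g) = hat f g Y"
  by (simp add: Psi_eq lift_pure[OF hat_bilin_dual])

lemma Psi_lin: "lin K HAHs Hom (Psi K H A)"
proof (rule linI[OF _ Hom_vs])
  show "vectorspace K HAHs" by simp
  interpret B: vectorspace K HAHs by simp
  show "Psi K H A Y \<in> carrier Hom" if "Y \<in> carrier HAHs" for Y
  proof -
    have "lin K DD A (\<lambda>X\<in>carrier DD. tensor_lift K D D A (\<lambda>f g. hat f g Y) X)"
      by (rule iffD2[OF lin_cong lift_lin[OF hat_bilin_dual[OF that]]]) simp
    then show ?thesis by (simp add: Psi_eq[OF that] Hom_simps(1))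
  qed
  show "Psi K H A (X \<oplus>\<^bsub>HAHs\<^esub> Y) = Psi K H A X \<oplus>\<^bsub>Hom\<^esub> Psi K H A Y"
    if X: "X \<in> carrier HAHs" and Y: "Y \<in> carrier HAHs" for X Y
  proof -
    have "tensor_lift K D D A (\<lambda>f g. hat f g (X \<oplus>\<^bsub>HAHs\<^esub> Y)) Z
        = tensor_lift K D D A (\<lambda>f g. hat f g X) Z \<oplus>\<^bsub>A\<^esub> tensor_lift K D D A (\<lambda>f g. hat f g Y) Z"
      if Z: "Z \<in> carrier DD" for Z
    proof (rule tensor_ext[where Z = A, OF _ _ _ _ Z])
      show "lin K DD A (\<lambda>Z. tensor_lift K D D A (\<lambda>f g. hat f g X) Z
          \<oplus>\<^bsub>A\<^esub> tensor_lift K D D A (\<lambda>f g. hat f g Y) Z)"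
        by (rule lin_sum[OF lift_lin[OF hat_bilin_dual[OF X]] lift_lin[OF hat_bilin_dual[OF Y]]])
      show "lin K DD A (tensor_lift K D D A (\<lambda>f g. hat f g (X \<oplus>\<^bsub>HAHs\<^esub> Y)))"
        by (rule lift_lin[OF hat_bilin_dual[OF B.M.a_closed[OF X Y]]])
      fix f g assume f: "f \<in> carrier D" and g: "g \<in> carrier D"
      show "tensor_lift K D D A (\<lambda>f g. hat f g (X \<oplus>\<^bsub>HAHs\<^esub> Y)) (pure_tensor K D D f g)
        = tensor_lift K D D A (\<lambda>f g. hat f g X) (pure_tensor K D D f g)
          \<oplus>\<^bsub>A\<^esub> tensor_lift K D D A (\<lambda>f g. hat f g Y) (pure_tensor K D D f g)"
        unfolding lift_pure[OF hat_bilin_dual[OF B.M.a_closed[OF X Y]] f g]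
          lift_pure[OF hat_bilin_dual[OF X] f g] lift_pure[OF hat_bilin_dual[OF Y] f g]
        by (rule lin_add[OF hat_lin[OF f g] X Y])
    qed simp_all
    then show ?thesis
      unfolding Psi_eq[OF X] Psi_eq[OF Y] Psi_eq[OF B.M.a_closed[OF X Y]] Hom_simps(2)
      by (intro restrict_ext) simp
  qed
  show "Psi K H A (c \<odot>\<^bsub>HAHs\<^esub> X) = c \<odot>\<^bsub>Hom\<^esub> Psi K H A X"
    if c: "c \<in> carrier K" and X: "X \<in> carrier HAHs" for c X
    unfolding Psi_eq[OF X] Psi_eq[OF B.smult_closed[OF c X]] Hom_simps(3)
    using c X by (intro restrict_ext) (simp add: lift_smult_left lin_smult[OF hat_lin] cong: lift_cong)
qed

lemma Psi_inj:
  assumes sep: "separates_points K H"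
  shows "inj_on (Psi K H A) (carrier HAHs)"
proof (rule inj_onI)
  fix X Y assume X: "X \<in> carrier HAHs" and Y: "Y \<in> carrier HAHs" and e: "Psi K H A X = Psi K H A Y"
  show "X = Y"
    by (rule hat_inj[OF sep X Y]) (simp only: Psi_pure[OF X, symmetric] Psi_pure[OF Y, symmetric] e)
qed

lemma Psi_mult: "\<lbrakk>X \<in> carrier HAHs; Y \<in> carrier HAHs\<rbrakk>
    \<Longrightarrow> Psi K H A (X \<otimes>\<^bsub>HAHs\<^esub> Y) = Psi K H A X \<otimes>\<^bsub>Hom\<^esub> Psi K H A Y"
  unfolding Hom_simps(4)
  by (subst Psi_eq, simp) (intro restrict_ext lift_cong refl, simp add: hat_mult Psi_pure cong: lift_cong)

lemma Psi_lact: "\<lbrakk>u \<in> carrier D; X \<in> carrier HAHs\<rbrakk>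
    \<Longrightarrow> Psi K H A (HAH_lact K H A u X) = hom_lact K D A u (Psi K H A X)"
  unfolding hom_lact_def
  by (subst Psi_eq, simp) (intro restrict_ext lift_cong refl, simp add: hat_lact Psi_pure)

lemma Psi_ract: "\<lbrakk>u \<in> carrier D; X \<in> carrier HAHs\<rbrakk>
    \<Longrightarrow> Psi K H A (HAH_ract K H A X u) = hom_ract K D A (Psi K H A X) u"
  unfolding hom_ract_def
  by (subst Psi_eq, simp) (intro restrict_ext lift_cong refl, simp add: hat_ract Psi_pure)

lemma Psi_theta: "a \<in> carrier A \<Longrightarrow> Psi K H A (theta K H A lam rho a) = phi K H A lam rho a"
  unfolding phi_def Let_def dual_ract_def dual_lact_def evL_def[symmetric] evR_def[symmetric]
  by (subst Psi_eq, simp) (intro restrict_ext lift_cong refl, simp add: hat_theta(2))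

lemma globalization_iso:
  assumes sep: "separates_points K H"
  shows "bimodule_algebra_iso K D
    (theta_globalization K H A lam rho) (HAH_lact K H A) (HAH_ract K H A)
    (phi_globalization K H A lam rho) (hom_lact K D A) (hom_ract K D A)
    (restrict (Psi K H A) (carrier (theta_globalization K H A lam rho)))"
proof -
  interpret B: bimodule_algebra K D HAHs "HAH_lact K H A" "HAH_ract K H A"
    by (rule HAH_bimodule_algebra[OF sep])
  let ?\<Psi> = "Psi K H A" and ?\<theta> = "theta K H A lam rho" and ?\<phi> = "phi K H A lam rho"
  define T where "T = theta_globalization K H A lam rho"
  define U where "U = carrier T"
  define P where "P = phi_globalization K H A lam rho"
  define G where "G = {HAH_ract K H A (HAH_lact K H A f x) g | f x g.
    f \<in> carrier D \<and> g \<in> carrier D \<and> x \<in> ?\<theta> ` carrier A}"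
  have T_span: "T = bimodule_span K D HAHs (HAH_lact K H A) (HAH_ract K H A) (?\<theta> ` carrier A)"
    by (simp add: T_def theta_globalization_def HAH_def)
  have UG: "U = module.span K HAHs G" and T: "T = HAHs\<lparr>carrier := U\<rparr>"
    by (simp_all add: U_def T_span bimodule_span_def G_def)
  have \<theta>: "?\<theta> ` carrier A \<subseteq> carrier HAHs" by (rule image_subsetI) simp
  have mult: "HAH_ract K H A x p \<otimes>\<^bsub>HAHs\<^esub> HAH_lact K H A u y \<in> carrier
      (bimodule_span K D HAHs (HAH_lact K H A) (HAH_ract K H A) (?\<theta> ` carrier A))"
    if xy: "x \<in> ?\<theta> ` carrier A" "y \<in> ?\<theta> ` carrier A" and pu: "p \<in> carrier D" "u \<in> carrier D" for x y p u
  proof -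
    obtain a b where ab: "a \<in> carrier A" "x = ?\<theta> a" "b \<in> carrier A" "y = ?\<theta> b" using xy by blast
    have "HAH_ract K H A x p \<otimes>\<^bsub>HAHs\<^esub> HAH_lact K H A u y = ?\<theta> (rac a p \<otimes>\<^bsub>A\<^esub> lac u b)"
      unfolding ab(2,4) by (rule theta_mult[OF sep pu ab(1,3)])
    also have "\<dots> \<in> carrier
      (bimodule_span K D HAHs (HAH_lact K H A) (HAH_ract K H A) (?\<theta> ` carrier A))"
      by (rule B.bimodule_span_base[OF \<theta> imageI]) (use ab(1,3) pu in simp)
    finally show ?thesis .
  qed
  have U: "subspace K U HAHs"
    unfolding U_def T_span by (rule B.bimodule_span_algebra(1)[OF \<theta> mult])
  have Talg: "bimodule_algebra K D T (HAH_lact K H A) (HAH_ract K H A)"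
    unfolding T_span by (rule B.bimodule_span_algebra(2)[OF \<theta> mult])
  interpret T: bimodule_algebra K D T "HAH_lact K H A" "HAH_ract K H A" by (rule Talg)
  have Uc: "x \<in> carrier HAHs" if "x \<in> U" for x using subspaceD(2)[OF U] that by (rule subsetD)
  have Gc: "G \<subseteq> carrier HAHs"
  proof
    fix x assume "x \<in> G"
    then obtain f y g where "x = HAH_ract K H A (HAH_lact K H A f y) g" "f \<in> carrier D" "g \<in> carrier D"
      "y \<in> ?\<theta> ` carrier A" unfolding G_def by blast
    moreover have "y \<in> carrier HAHs" using \<theta> calculation(4) by (rule subsetD)
    ultimately show "x \<in> carrier HAHs" by simp
  qed
  have gen: "?\<Psi> (HAH_ract K H A (HAH_lact K H A f (?\<theta> a)) g)
      = hom_ract K D A (hom_lact K D A f (?\<phi> a)) g"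
    if "f \<in> carrier D" "g \<in> carrier D" "a \<in> carrier A" for f g a
    using that by (simp add: Psi_ract Psi_lact Psi_theta)
  have "?\<Psi> ` G = {hom_ract K D A (hom_lact K D A f x) g | f x g.
    f \<in> carrier D \<and> g \<in> carrier D \<and> x \<in> ?\<phi> ` carrier A}" (is "_ = ?R")
  proof
    show "?\<Psi> ` G \<subseteq> ?R"
    proof (rule image_subsetI)
      fix x assume "x \<in> G"
      then obtain f a g where x: "x = HAH_ract K H A (HAH_lact K H A f (?\<theta> a)) g" "f \<in> carrier D"
        "g \<in> carrier D" "a \<in> carrier A" unfolding G_def by blast
      show "?\<Psi> x \<in> ?R" unfolding x(1) gen[OF x(2-4)] using x(2-4) by blast
    qed
    show "?R \<subseteq> ?\<Psi> ` G"
    proof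
      fix y assume "y \<in> ?R"
      then obtain f a g where y: "y = hom_ract K D A (hom_lact K D A f (?\<phi> a)) g" "f \<in> carrier D"
        "g \<in> carrier D" "a \<in> carrier A" by blast
      have "HAH_ract K H A (HAH_lact K H A f (?\<theta> a)) g \<in> G" unfolding G_def using y(2-4) by blast
      then show "y \<in> ?\<Psi> ` G" unfolding y(1) gen[OF y(2-4), symmetric] by (rule imageI)
    qed
  qed
  then have P: "P = Hom\<lparr>carrier := ?\<Psi> ` U\<rparr>"
    by (simp add: P_def phi_globalization_def Let_def bimodule_span_def UG span_image[OF Psi_lin Gc])
  let ?F = "restrict ?\<Psi> U"
  have F: "?F x = ?\<Psi> x" if "x \<in> U" for x using that by simp
  have "lin K T P ?\<Psi>"
    unfolding T P by (rule lin_into_subspace[OF lin_from_subspace[OF Psi_lin U] lin_image_subspace[OF Psi_lin U]])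
      simp
  then have lF: "lin K T P ?F" by (rule iffD2[OF lin_cong, rotated]) (simp add: U_def)
  have bij: "bij_betw ?F (carrier T) (carrier P)"
  proof -
    have "inj_on ?\<Psi> U" by (rule inj_on_subset[OF Psi_inj[OF sep] subspaceD(2)[OF U]])
    then show ?thesis by (simp add: T P bij_betw_def inj_on_restrict_eq)
  qed
  have m: "?F (x \<otimes>\<^bsub>T\<^esub> y) = ?F x \<otimes>\<^bsub>P\<^esub> ?F y" if x: "x \<in> carrier T" and y: "y \<in> carrier T" for x y
  proof -
    have "x \<otimes>\<^bsub>T\<^esub> y \<in> U" unfolding U_def by (rule T.B.mult_closed[OF x y])
    moreover have "x \<otimes>\<^bsub>T\<^esub> y = x \<otimes>\<^bsub>HAHs\<^esub> y" by (simp add: T)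
    ultimately show ?thesis using x y Psi_mult[OF Uc Uc, of x y] by (simp add: F P U_def)
  qed
  have l: "?F (HAH_lact K H A h x) = hom_lact K D A h (?F x)" if h: "h \<in> carrier D" and x: "x \<in> carrier T" for h x
  proof -
    have "HAH_lact K H A h x \<in> U" unfolding U_def by (rule T.lact_closed[OF h x])
    then show ?thesis using x Psi_lact[OF h Uc, of x] by (simp add: F U_def)
  qed
  have r: "?F (HAH_ract K H A x h) = hom_ract K D A (?F x) h" if h: "h \<in> carrier D" and x: "x \<in> carrier T" for h x
  proof -
    have "HAH_ract K H A x h \<in> U" unfolding U_def by (rule T.ract_closed[OF h x])
    then show ?thesis using x Psi_ract[OF h Uc, of x] by (simp add: F U_def)
  qed
  have "bimodule_algebra K D P (hom_lact K D A) (hom_ract K D A)"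
    by (rule T.bimodule_algebra_transport[OF lF bij m l r])
  then have "bimodule_algebra_iso K D T (HAH_lact K H A) (HAH_ract K H A) P (hom_lact K D A) (hom_ract K D A) ?F"
    unfolding bimodule_algebra_iso_def using Talg lin_hom[OF lF] m l r bij by (intro conjI ballI)
  then show ?thesis unfolding T_def P_def U_def .
qed

end

theorem proposition3p20:
  fixes K :: "('k, 'm) ring_scheme"
    and H :: "('k, 'h, 'n) hopf_scheme"
    and A :: "('k, 'a, 'p) module_scheme"
    and lam :: "'a \<Rightarrow> ('h \<times> 'a \<Rightarrow> 'k) set"
    and rho :: "'a \<Rightarrow> ('a \<times> 'h \<Rightarrow> 'k) set"
  assumes "hopf_algebra K H"
    and "separates_points K H"
    and "partial_bicomodule_algebra K H A lam rho"
  shows "bimodule_algebra_iso K (finite_dual K H)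
    (theta_globalization K H A lam rho) (HAH_lact K H A) (HAH_ract K H A)
    (phi_globalization K H A lam rho)
      (hom_lact K (finite_dual K H) A) (hom_ract K (finite_dual K H) A)
    (restrict (Psi K H A) (carrier (theta_globalization K H A lam rho)))"
  using assms(2,3) by (rule partial_bicomodule_algebra.globalization_iso[rotated])

end
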